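(* Let $2\le n<p<p_0<\infty$. There exists a constant $c$ depending only on $n$ and $p_0$ such that $$\|f\|_{B^{n/p}_{p,n}}\le c\Big(1-\frac np\Big)^{-1/n}\|\nabla f\|_{L^n}$$ for every $f$ in the homogeneous Sobolev space $\dot W^1_n(\mathbb{R}^n)$.
   Context: $\dot W^1_n$ denotes the space of locally integrable $f$ (vanishing at infinity in the sense that its level sets $\{|f|>t\}$, $t>0$, have finite measure) with weak gradient $\nabla f\in L^n$. $\omega_n=|B^n|$, $\Delta_hf(x)=f(x+h)-f(x)$, $\omega(f,t)_p=(\frac{1}{t^n\omega_n}\int_{|h|<t}\|\Delta_hf\|^p_{L^p}dh)^{1/p}$, and $\|f\|_{B^{s}_{p,q}}=(\int_0^\infty t^{-sq}\omega(f,t)_p^q\frac{dt}{t})^{1/q}$. *)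

theory Defs
  imports "HOL-Analysis.Analysis"
begin

text \<open>Positive real powers of extended nonnegative reals (used with positive exponents only).\<close>
definition enn_powr :: "ennreal \<Rightarrow> real \<Rightarrow> ennreal" where
  "enn_powr x a = (if x = \<infinity> then \<infinity> else ennreal (enn2real x powr a))"

definition partial_deriv :: "'n::finite \<Rightarrow> (real^'n \<Rightarrow> real) \<Rightarrow> real^'n \<Rightarrow> real" where
  "partial_deriv i \<phi> x = deriv (\<lambda>t. \<phi> (x + t *\<^sub>R axis i 1)) 0"

fun iter_partial :: "'n::finite list \<Rightarrow> (real^'n \<Rightarrow> real) \<Rightarrow> real^'n \<Rightarrow> real" where
  "iter_partial [] \<phi> = \<phi>"
| "iter_partial (i # is) \<phi> = partial_deriv i (iter_partial is \<phi>)"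

definition smooth_fun :: "(real^'n::finite \<Rightarrow> real) \<Rightarrow> bool" where
  "smooth_fun \<phi> \<longleftrightarrow> (\<forall>is. continuous_on UNIV (iter_partial is \<phi>) \<and>
      (\<forall>i x. (\<lambda>t. iter_partial is \<phi> (x + t *\<^sub>R axis i 1)) differentiable (at 0)))"

definition test_fun :: "(real^'n::finite \<Rightarrow> real) \<Rightarrow> bool" where
  "test_fun \<phi> \<longleftrightarrow> smooth_fun \<phi> \<and> bounded {x. \<phi> x \<noteq> 0}"

definition weak_gradient :: "(real^'n::finite \<Rightarrow> real) \<Rightarrow> (real^'n \<Rightarrow> real^'n) \<Rightarrow> bool" where
  "weak_gradient f G \<longleftrightarrow> (\<forall>\<phi> i. test_fun \<phi> \<longrightarrow>
      (\<integral>x. f x * partial_deriv i \<phi> x \<partial>lebesgue) = - (\<integral>x. G x $ i * \<phi> x \<partial>lebesgue))"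

definition locally_integrable :: "(real^'n::finite \<Rightarrow> real) \<Rightarrow> bool" where
  "locally_integrable f \<longleftrightarrow> (\<forall>K. compact K \<longrightarrow> set_integrable lebesgue K f)"

definition vanishes_at_infinity :: "(real^'n::finite \<Rightarrow> real) \<Rightarrow> bool" where
  "vanishes_at_infinity f \<longleftrightarrow> (\<forall>t>0. emeasure lebesgue {x. \<bar>f x\<bar> > t} < \<infinity>)"

definition Lq_norm_vec :: "real \<Rightarrow> (real^'n::finite \<Rightarrow> real^'n) \<Rightarrow> ennreal" where
  "Lq_norm_vec q G = enn_powr (\<integral>\<^sup>+x. ennreal (norm (G x) powr q) \<partial>lebesgue) (1/q)"

definition in_Wdot1n :: "(real^'n::finite \<Rightarrow> real) \<Rightarrow> (real^'n \<Rightarrow> real^'n) \<Rightarrow> bool" where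
  "in_Wdot1n f G \<longleftrightarrow> locally_integrable f \<and> vanishes_at_infinity f \<and>
     G \<in> borel_measurable lebesgue \<and> Lq_norm_vec (real CARD('n)) G < \<infinity> \<and> weak_gradient f G"

definition omega_n :: "'n::finite itself \<Rightarrow> real" where
  "omega_n _ = measure lebesgue (ball (0::real^'n) 1)"

definition modulus :: "(real^'n::finite \<Rightarrow> real) \<Rightarrow> real \<Rightarrow> real \<Rightarrow> ennreal" where
  "modulus f t p = enn_powr
     ((\<integral>\<^sup>+h\<in>ball 0 t. (\<integral>\<^sup>+x. ennreal (\<bar>f (x + h) - f x\<bar> powr p) \<partial>lebesgue) \<partial>lebesgue)
        / ennreal (t ^ CARD('n) * omega_n TYPE('n))) (1/p)"

definition besov_norm :: "real \<Rightarrow> real \<Rightarrow> real \<Rightarrow> (real^'n::finite \<Rightarrow> real) \<Rightarrow> ennreal" where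
  "besov_norm s p q f = enn_powr
     (\<integral>\<^sup>+t\<in>{0<..}. ennreal (t powr (- s * q) / t) * enn_powr (modulus f t p) q \<partial>lborel) (1/q)"

end

theory Submission
  imports Defs
begin

text \<open>
  Write \<open>g = |\<nabla>f|\<close> and \<open>n = CARD('n)\<close>. Averaging the fundamental theorem of calculus over balls (after
  mollification, then passing to the limit at Lebesgue points) bounds \<open>|f(x + h) - f(x)|\<close>, for \<open>|h| < t\<close>, by
  \<open>S\<^sub>t g(x) + S\<^sub>t g(x + h)\<close> up to a constant, where
  \<open>S\<^sub>t g(x) = t \<integral>\<^sub>0\<^sup>1 \<integral>\<^sub>B g(x + s t w) dw ds\<close> is linear in \<open>g\<close> and maps \<open>L\<^sup>r\<close> to \<open>L\<^sup>p\<close> with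
  norm of order \<open>t\<^bsup>1 - n/r + n/p\<^esup>\<close> for \<open>r \<le> p\<close>.

  For fixed \<open>t\<close> this is used twice: with some \<open>r < n\<close> (depending on \<open>n\<close> and \<open>p0\<close> only) on the part of \<open>g\<close>
  consisting of those dyadic layers \<open>2\<^sup>k < g \<le> 2\<^sup>k\<^sup>+\<^sup>1\<close> for which \<open>|{g > 2\<^sup>k}| \<le> t\<^sup>n\<close>, and with \<open>r = p\<close> on the
  remaining layers. Hardy type inequalities for the two resulting functions of \<open>t\<close> give
  \<open>\<integral> g\<^sup>n\<close>; the second one costs the factor \<open>(1 - n/p)\<^sup>-\<^sup>1\<close>.
\<close>

section \<open>Powers of extended nonnegative reals\<close>

text \<open>No single exponent \<open>r\<close> works. At \<open>r = n\<close> the factor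
  \<open>t^(n * n/p)\<close> that \<open>S_t\<close> contributes to the \<open>n\<close>-th power of
  the norm cancels the weight \<open>t^(- n * n/p)\<close> and leaves the divergent integral of
  \<open>dt/t\<close>. With \<open>r < n\<close> the integral converges at infinity, with
  \<open>r = p\<close> at 0, so each layer has to change exponent at a finite time. Cutting by the
  measure of \<open>{g > 2^k}\<close> puts this time at \<open>|{g > 2^k}|^(1/n)\<close>;
  integrating the powers of \<open>t\<close> up to there and from there on returns multiples of at
  most \<open>2^(kn) |{g > 2^k}|\<close>, whose sum is controlled by the energy. The exponent for
  the high part satisfies \<open>n/r = 1 + n/(2 p0)\<close>. This leaves the power
  \<open>n/p - n/(2 p0) \<ge> n/(2 p0)\<close> of \<open>t\<close>, bounded below uniformly in
  \<open>p < p0\<close>. Only the low part sees the weight \<open>t^(n (1 - n/p) - 1)\<close>, whose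
  integral near 0 blows up like \<open>1/(1 - n/p)\<close>; the \<open>n\<close>-th root in the
  Besov norm turns this into the exponent \<open>-1/n\<close>.\<close>

lemma enn_powr_ennreal: "0 \<le> r \<Longrightarrow> enn_powr (ennreal r) a = ennreal (r powr a)"
  by (simp add: enn_powr_def)

lemma enn_powr_zero [simp]: "enn_powr 0 a = 0"
  by (simp add: enn_powr_def)

lemma enn_powr_top [simp]: "enn_powr top a = top"
  by (simp add: enn_powr_def)

lemma enn_powr_eq_0_iff [simp]: "enn_powr x a = 0 \<longleftrightarrow> x = 0"
  by (cases x) (auto simp: enn_powr_def ennreal_eq_0_iff)

lemma enn_powr_eq_top_iff [simp]: "enn_powr x a = top \<longleftrightarrow> x = top"
  by (cases x) (auto simp: enn_powr_def)

lemma enn_powr_one [simp]: "enn_powr x 1 = x"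
  by (cases x) (auto simp: enn_powr_def)

lemma enn_powr_base_one [simp]: "enn_powr 1 a = 1"
  using enn_powr_ennreal[of 1 a] by simp

lemma enn_powr_mono: "0 \<le> a \<Longrightarrow> x \<le> y \<Longrightarrow> enn_powr x a \<le> enn_powr y a"
  by (cases x; cases y) (auto simp: enn_powr_ennreal top_unique intro!: ennreal_leI powr_mono2)

lemma enn_powr_mult: "enn_powr (x * y) a = enn_powr x a * enn_powr y a"
proof (cases x)
  case (real r)
  show ?thesis
  proof (cases y)
    case (real s)
    with \<open>x = ennreal r\<close> \<open>0 \<le> r\<close> show ?thesis
      by (simp add: enn_powr_ennreal ennreal_mult[symmetric] powr_mult)
  next
    case top
    with real show ?thesis
      by (cases "r = 0") (auto simp: enn_powr_ennreal ennreal_mult_top)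
  qed
next
  case top
  then show ?thesis
    by (cases "y = 0") (auto simp: ennreal_top_mult)
qed

text \<open>Valid for every sign of the exponents because \<open>0 powr a = 0\<close> for all
  \<open>a\<close>, including \<open>a = 0\<close>, and \<open>top\<close> is sent to
  \<open>top\<close>. This covers exponents such as \<open>p / r - 1\<close>, which may
  vanish.\<close>

lemma enn_powr_add: "enn_powr x (a + b) = enn_powr x a * enn_powr x b"
  by (cases x) (auto simp: enn_powr_ennreal ennreal_mult[symmetric] powr_add)

lemma enn_powr_powr: "enn_powr (enn_powr x a) b = enn_powr x (a * b)"
  by (cases x) (auto simp: enn_powr_ennreal powr_powr)

lemma enn_powr_measurable [measurable]: "(\<lambda>x. enn_powr x a) \<in> borel_measurable borel"
  unfolding enn_powr_def by measurable

lemma enn_powr_measurable' [measurable (raw)]: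
  "f \<in> borel_measurable M \<Longrightarrow> (\<lambda>x. enn_powr (f x) a) \<in> borel_measurable M"
  using measurable_compose[OF _ enn_powr_measurable] .

lemma enn_powr_add_le:
  assumes "0 \<le> a"
  shows "enn_powr (x + y) a \<le> enn_powr 2 a * (enn_powr x a + enn_powr y a)"
proof -
  have "x + y \<le> 2 * max x y"
    by (metis add_mono max.cobounded1 max.cobounded2 mult_2)
  then have "enn_powr (x + y) a \<le> enn_powr 2 a * enn_powr (max x y) a"
    using enn_powr_mono[OF assms] by (simp add: enn_powr_mult[symmetric])
  also have "enn_powr (max x y) a \<le> enn_powr x a + enn_powr y a"
    by (auto simp: max_def)
  finally show ?thesis
    by (simp add: mult_left_mono)
qed

text \<open>A convex function lies above its tangent at \<open>a\<close>; for powers this is Young's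
  inequality with exponents \<open>p\<close> and \<open>p / (p - 1)\<close>. The negative term is
  moved to the right so that the inequality carries over to \<open>ennreal\<close>.\<close>

lemma powr_tangent:
  fixes a h p :: real
  assumes "1 < p" "0 < a" "0 \<le> h"
  shows "p * a powr (p - 1) * h \<le> h powr p + (p - 1) * a powr p"
proof -
  have "h * a powr (p - 1) \<le> h powr p / p + (a powr (p - 1)) powr (p / (p - 1)) / (p / (p - 1))"
    using assms by (intro Youngs_inequality) (auto simp: field_simps)
  also have "(a powr (p - 1)) powr (p / (p - 1)) = a powr p"
    using assms by (simp add: powr_powr)
  finally show ?thesis
    using assms by (simp add: field_simps)
qed

lemma enn_powr_tangent:
  assumes "1 < p" "0 < a"
  shows "ennreal (p * a powr (p - 1)) * h \<le> enn_powr h p + ennreal ((p - 1) * a powr p)"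
proof (cases h)
  case (real r)
  then show ?thesis
    using assms powr_tangent[OF assms, of r]
    by (simp add: enn_powr_ennreal ennreal_mult[symmetric] ennreal_plus[symmetric] ennreal_leI del: ennreal_plus)
qed simp

text \<open>Integrate the tangent line inequality above, with \<open>a\<close> the weighted mean of \<open>h\<close>.\<close>

lemma nn_integral_Jensen:
  assumes p: "1 < p" and [measurable]: "w \<in> borel_measurable M" "h \<in> borel_measurable M"
  shows "enn_powr (\<integral>\<^sup>+x. w x * h x \<partial>M) p
    \<le> enn_powr (\<integral>\<^sup>+x. w x \<partial>M) (p - 1) * (\<integral>\<^sup>+x. w x * enn_powr (h x) p \<partial>M)"
proof -
  define W where "W = (\<integral>\<^sup>+x. w x \<partial>M)"
  define H where "H = (\<integral>\<^sup>+x. w x * h x \<partial>M)"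
  define Q where "Q = (\<integral>\<^sup>+x. w x * enn_powr (h x) p \<partial>M)"
  have tangent: "ennreal (p * a powr (p - 1)) * H \<le> Q + ennreal ((p - 1) * a powr p) * W" if "0 < a" for a
  proof -
    have "ennreal (p * a powr (p - 1)) * H = (\<integral>\<^sup>+x. w x * (ennreal (p * a powr (p - 1)) * h x) \<partial>M)"
      unfolding H_def by (subst nn_integral_cmult[symmetric]) (auto simp: ac_simps)
    also have "\<dots> \<le> (\<integral>\<^sup>+x. w x * (enn_powr (h x) p + ennreal ((p - 1) * a powr p)) \<partial>M)"
      by (intro nn_integral_mono mult_left_mono enn_powr_tangent p that) auto
    also have "\<dots> = Q + ennreal ((p - 1) * a powr p) * W"
      unfolding Q_def W_def
      by (subst nn_integral_cmult[symmetric])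
         (auto simp: distrib_left nn_integral_add[symmetric] ac_simps)
    finally show ?thesis .
  qed
  \<comment> \<open>The right-hand side is 0 as soon as \<open>Q\<close> or \<open>W\<close> is,
    even against an infinite other factor, so these cases call for \<open>H = 0\<close>
    itself.\<close>
  have Q0: "H = 0" if "Q = 0"
  proof -
    have "AE x in M. w x * enn_powr (h x) p = 0"
      using that unfolding Q_def by (subst (asm) nn_integral_0_iff_AE) auto
    then have "AE x in M. w x * h x = 0"
      by eventually_elim auto
    then show ?thesis
      unfolding H_def by (subst nn_integral_0_iff_AE) auto
  qed
  have W0: "H = 0" if "W = 0"
  proof -
    have "AE x in M. w x = 0"
      using that unfolding W_def by (subst (asm) nn_integral_0_iff_AE) auto
    then have "AE x in M. w x * h x = 0"
      by eventually_elim auto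
    then show ?thesis
      unfolding H_def by (subst nn_integral_0_iff_AE) auto
  qed
  have "enn_powr H p \<le> enn_powr W (p - 1) * Q"
  proof (cases "W = 0 \<or> Q = 0 \<or> W = top \<or> Q = top")
    case True
    then show ?thesis
      using W0 Q0 by (cases "W = 0 \<or> Q = 0") (auto simp: ennreal_mult_top ennreal_top_mult)
  next
    case False
    then obtain u v where u: "W = ennreal u" "0 < u" and v: "Q = ennreal v" "0 < v"
      by (metis ennreal_cases ennreal_0 less_eq_real_def)
    have "H \<noteq> top"
      using tangent[of 1] p u v by (auto simp: ennreal_mult_top ennreal_mult[symmetric] ennreal_plus[symmetric] top_unique simp del: ennreal_plus)
    then obtain r where r: "H = ennreal r" "0 \<le> r"
      by (cases H) auto
    show ?thesis
    proof (cases "r = 0")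
      case False
      define a where "a = r / u"
      have a: "0 < a" using r u False by (simp add: a_def)
      have "p * a powr (p - 1) * r \<le> v + (p - 1) * a powr p * u"
        using tangent[OF a] p u v r a
        by (simp add: ennreal_mult[symmetric] ennreal_plus[symmetric] del: ennreal_plus)
      moreover have "a powr p = a powr (p - 1) * a"
        using a by (metis add.commute diff_add_cancel powr_add powr_one[of a] less_imp_le)
      ultimately have "a powr (p - 1) * r \<le> v"
        using u by (simp add: a_def field_simps)
      moreover have "r powr p = u powr (p - 1) * (a powr (p - 1) * r)"
        using r u False by (simp add: a_def powr_divide powr_diff field_simps)
      ultimately have "r powr p \<le> u powr (p - 1) * v"
        by (simp add: mult_left_mono)
      then show ?thesis
        using u v r by (simp add: enn_powr_ennreal ennreal_mult[symmetric] ennreal_leI)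
    qed (use r in simp)
  qed
  then show ?thesis
    by (simp add: W_def H_def Q_def)
qed

lemma nn_integral_count_space_ge:
  "x \<in> A \<Longrightarrow> f x \<le> (\<integral>\<^sup>+y. f y \<partial>count_space A)"
proof -
  assume "x \<in> A"
  then have "f x = (\<integral>\<^sup>+y. f y * indicator {x} y \<partial>count_space A)"
    by (subst nn_integral_indicator_singleton) auto
  also have "\<dots> \<le> (\<integral>\<^sup>+y. f y \<partial>count_space A)"
    by (intro nn_integral_mono) (auto split: split_indicator)
  finally show ?thesis .
qed

text \<open>With \<open>T\<close> the sum of the powers, each \<open>enn_powr (x k) \<theta>\<close>
  is at most \<open>T\<close>. Splitting \<open>x k\<close> into its powers
  \<open>1 - \<theta>\<close> and \<open>\<theta>\<close> and bounding the first by a power of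
  \<open>T\<close> makes the sum of the \<open>x k\<close> at most
  \<open>enn_powr T (1/\<theta>)\<close>.\<close>

lemma enn_powr_sum_le:
  assumes "0 < \<theta>" "\<theta> \<le> 1"
  shows "enn_powr (\<integral>\<^sup>+k. x k \<partial>count_space A) \<theta> \<le> (\<integral>\<^sup>+k. enn_powr (x k) \<theta> \<partial>count_space A)"
proof -
  define T where "T = (\<integral>\<^sup>+k. enn_powr (x k) \<theta> \<partial>count_space A)"
  have "x k \<le> enn_powr T (1/\<theta> - 1) * enn_powr (x k) \<theta>" if "k \<in> A" for k
  proof -
    have "enn_powr (x k) \<theta> \<le> T"
      unfolding T_def using that by (rule nn_integral_count_space_ge)
    then have "enn_powr (enn_powr (x k) \<theta>) (1/\<theta> - 1) \<le> enn_powr T (1/\<theta> - 1)"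
      using assms by (intro enn_powr_mono) auto
    moreover have "\<theta> * (1/\<theta> - 1) = 1 - \<theta>"
      using assms by (simp add: field_simps)
    ultimately have "enn_powr (x k) (1 - \<theta>) * enn_powr (x k) \<theta> \<le> enn_powr T (1/\<theta> - 1) * enn_powr (x k) \<theta>"
      by (simp add: enn_powr_powr mult_right_mono)
    then show ?thesis
      by (simp add: enn_powr_add[symmetric])
  qed
  then have "(\<integral>\<^sup>+k. x k \<partial>count_space A) \<le> (\<integral>\<^sup>+k. enn_powr T (1/\<theta> - 1) * enn_powr (x k) \<theta> \<partial>count_space A)"
    by (intro nn_integral_mono) auto
  also have "\<dots> = enn_powr T (1/\<theta> - 1) * enn_powr T 1"
    by (simp add: nn_integral_cmult T_def)
  also have "\<dots> = enn_powr T (1/\<theta>)"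
    by (simp only: enn_powr_add[symmetric]) simp
  finally have "enn_powr (\<integral>\<^sup>+k. x k \<partial>count_space A) \<theta> \<le> enn_powr (enn_powr T (1/\<theta>)) \<theta>"
    using assms by (intro enn_powr_mono) auto
  also have "\<dots> = T"
    using assms by (simp add: enn_powr_powr)
  finally show ?thesis
    by (simp add: T_def)
qed

section \<open>Averages over balls\<close>

lemma nn_integral_lborel_translate:
  fixes g :: "'a::euclidean_space \<Rightarrow> ennreal"
  assumes [measurable]: "g \<in> borel_measurable borel"
  shows "(\<integral>\<^sup>+x. g (x + a) \<partial>lborel) = (\<integral>\<^sup>+x. g x \<partial>lborel)"
proof -
  have "(\<integral>\<^sup>+x. g x \<partial>lborel) = (\<integral>\<^sup>+x. g x \<partial>distr lborel borel ((+) a))"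
    by (simp add: lborel_distr_plus)
  also have "\<dots> = (\<integral>\<^sup>+x. g (x + a) \<partial>lborel)"
    by (subst nn_integral_distr) (auto simp: add.commute)
  finally show ?thesis ..
qed

lemma nn_integral_lborel_affine:
  fixes g :: "'a::euclidean_space \<Rightarrow> ennreal"
  assumes [measurable]: "g \<in> borel_measurable borel" and c: "0 < c"
  shows "(\<integral>\<^sup>+x. g x \<partial>lborel) = ennreal (c ^ DIM('a)) * (\<integral>\<^sup>+w. g (x + c *\<^sub>R w) \<partial>lborel)"
proof -
  have "(\<integral>\<^sup>+x. g x \<partial>lborel)
      = (\<integral>\<^sup>+x. g x \<partial>density (distr lborel borel (\<lambda>w. x + c *\<^sub>R w)) (\<lambda>_. ennreal (\<bar>c\<bar> ^ DIM('a))))"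
    using lborel_affine[of c x] c by simp
  also have "\<dots> = ennreal (c ^ DIM('a)) * (\<integral>\<^sup>+w. g (x + c *\<^sub>R w) \<partial>lborel)"
    using c by (subst nn_integral_density) (auto simp: nn_integral_distr nn_integral_cmult)
  finally show ?thesis .
qed

lemma ball_in_sets_borel [measurable]: "ball x r \<in> sets borel"
  by simp

abbreviation unit_ball_measure :: "'a::euclidean_space itself \<Rightarrow> ennreal" where
  "unit_ball_measure _ \<equiv> emeasure lborel (ball (0::'a) 1)"

text \<open>For \<open>\<rho> > 0\<close> this is the volume of the unit ball times the mean of
  \<open>g\<close> over the ball of radius \<open>\<rho>\<close> about \<open>x\<close>. Integrating
  over a fixed ball keeps \<open>\<rho>\<close> and \<open>x\<close> in the argument of
  \<open>g\<close>, where joint measurability and translation invariance apply directly.\<close>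

definition ball_integral :: "real \<Rightarrow> ('a::euclidean_space \<Rightarrow> ennreal) \<Rightarrow> 'a \<Rightarrow> ennreal" where
  "ball_integral \<rho> g x = (\<integral>\<^sup>+w. indicator (ball 0 1) w * g (x + \<rho> *\<^sub>R w) \<partial>lborel)"

lemma ball_integral_measurable [measurable (raw)]:
  assumes [measurable]: "g \<in> borel_measurable borel" "\<rho> \<in> borel_measurable M" "X \<in> borel_measurable M"
  shows "(\<lambda>z. ball_integral (\<rho> z) g (X z)) \<in> borel_measurable M"
  unfolding ball_integral_def by measurable

lemma ball_integral_pow_le:
  fixes g :: "'a::euclidean_space \<Rightarrow> ennreal"
  assumes [measurable]: "g \<in> borel_measurable borel" and r: "1 < r"
  shows "enn_powr (ball_integral \<rho> g x) r
    \<le> enn_powr (unit_ball_measure TYPE('a)) (r - 1) * ball_integral \<rho> (\<lambda>x. enn_powr (g x) r) x"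
  using nn_integral_Jensen[OF r, of "indicator (ball (0::'a) 1)" lborel "\<lambda>w. g (x + \<rho> *\<^sub>R w)"]
  unfolding ball_integral_def by simp

lemma ball_integral_le:
  fixes g :: "'a::euclidean_space \<Rightarrow> ennreal"
  assumes [measurable]: "g \<in> borel_measurable borel" and \<rho>: "0 < \<rho>"
  shows "ball_integral \<rho> g x \<le> ennreal (\<rho> powr - real DIM('a)) * (\<integral>\<^sup>+x. g x \<partial>lborel)"
proof -
  have "ball_integral \<rho> g x \<le> (\<integral>\<^sup>+w. g (x + \<rho> *\<^sub>R w) \<partial>lborel)"
    unfolding ball_integral_def by (intro nn_integral_mono) (auto split: split_indicator)
  also have "\<dots> = ennreal (\<rho> powr - real DIM('a)) * (ennreal (\<rho> ^ DIM('a)) * (\<integral>\<^sup>+w. g (x + \<rho> *\<^sub>R w) \<partial>lborel))"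
    using \<rho> by (simp add: mult.assoc[symmetric] ennreal_mult[symmetric] powr_minus powr_realpow)
  also have "\<dots> = ennreal (\<rho> powr - real DIM('a)) * (\<integral>\<^sup>+x. g x \<partial>lborel)"
    using \<rho> by (subst nn_integral_lborel_affine[of g \<rho> x]) auto
  finally show ?thesis .
qed

lemma nn_integral_ball_integral:
  fixes g :: "'a::euclidean_space \<Rightarrow> ennreal"
  assumes [measurable]: "g \<in> borel_measurable borel"
  shows "(\<integral>\<^sup>+x. ball_integral \<rho> g x \<partial>lborel) = unit_ball_measure TYPE('a) * (\<integral>\<^sup>+x. g x \<partial>lborel)"
proof -
  have "(\<integral>\<^sup>+x. ball_integral \<rho> g x \<partial>lborel)
      = (\<integral>\<^sup>+w. (\<integral>\<^sup>+x. indicator (ball 0 1) w * g (x + \<rho> *\<^sub>R w) \<partial>lborel) \<partial>lborel)"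
    unfolding ball_integral_def by (rule lborel_pair.Fubini') measurable
  also have "\<dots> = (\<integral>\<^sup>+w. (\<integral>\<^sup>+x. g x \<partial>lborel) * indicator (ball (0::'a) 1) w \<partial>lborel)"
    by (subst nn_integral_cmult) (auto simp: nn_integral_lborel_translate mult.commute)
  also have "\<dots> = unit_ball_measure TYPE('a) * (\<integral>\<^sup>+x. g x \<partial>lborel)"
    by (subst nn_integral_cmult_indicator) (auto simp: mult.commute)
  finally show ?thesis .
qed

text \<open>Interpolation by hand. After Jensen with exponent \<open>r\<close>, the integrand is the
  power \<open>p / r\<close> of an average of \<open>enn_powr (g x) r\<close>; the power
  \<open>p / r - 1\<close> is bounded by the supremum (\<open>ball_integral_le\<close>) and the one
  remaining factor is integrated exactly (\<open>nn_integral_ball_integral\<close>).\<close>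

lemma ball_integral_Lp_le:
  fixes g :: "'a::euclidean_space \<Rightarrow> ennreal"
  assumes g [measurable]: "g \<in> borel_measurable borel" and r: "1 < r" and p: "r \<le> p" and \<rho>: "0 < \<rho>"
  shows "(\<integral>\<^sup>+x. enn_powr (ball_integral \<rho> g x) p \<partial>lborel)
    \<le> enn_powr (unit_ball_measure TYPE('a)) (p - p / r + 1) * ennreal (\<rho> powr (- real DIM('a) * (p / r - 1)))
       * enn_powr (\<integral>\<^sup>+x. enn_powr (g x) r \<partial>lborel) (p / r)"
proof -
  define V where "V = unit_ball_measure TYPE('a)"
  define X where "X = ball_integral \<rho> (\<lambda>x. enn_powr (g x) r)"
  define J where "J = (\<integral>\<^sup>+x. enn_powr (g x) r \<partial>lborel)"
  define c where "c = ennreal (\<rho> powr - real DIM('a))"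
  have [measurable]: "X \<in> borel_measurable borel"
    unfolding X_def by measurable
  have pr: "0 \<le> p / r - 1" "0 \<le> p / r"
    using r p by (auto simp: field_simps)
  have pt: "enn_powr (ball_integral \<rho> g x) p \<le> enn_powr V (p - p / r) * enn_powr (c * J) (p / r - 1) * X x" for x
  proof -
    have "enn_powr (ball_integral \<rho> g x) p = enn_powr (enn_powr (ball_integral \<rho> g x) r) (p / r)"
      using r by (simp add: enn_powr_powr)
    also have "\<dots> \<le> enn_powr (enn_powr V (r - 1) * X x) (p / r)"
      unfolding X_def V_def by (intro enn_powr_mono ball_integral_pow_le g r pr)
    also have "\<dots> = enn_powr V (p - p / r) * (enn_powr (X x) (p / r - 1) * X x)"
    proof -
      have e: "(r - 1) * p / r = p - p / r"
        using r by (simp add: field_simps)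
      have "enn_powr (X x) (p / r) = enn_powr (X x) (p / r - 1 + 1)"
        by simp
      then have "enn_powr (X x) (p / r) = enn_powr (X x) (p / r - 1) * X x"
        by (simp only: enn_powr_add enn_powr_one)
      then show ?thesis
        by (simp add: enn_powr_mult enn_powr_powr e)
    qed
    also have "\<dots> \<le> enn_powr V (p - p / r) * (enn_powr (c * J) (p / r - 1) * X x)"
      unfolding X_def c_def J_def
      by (intro mult_left_mono mult_right_mono enn_powr_mono pr ball_integral_le \<rho>) auto
    finally show ?thesis
      by (simp add: mult.assoc)
  qed
  have "(\<integral>\<^sup>+x. enn_powr (ball_integral \<rho> g x) p \<partial>lborel)
      \<le> (\<integral>\<^sup>+x. enn_powr V (p - p / r) * enn_powr (c * J) (p / r - 1) * X x \<partial>lborel)"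
    by (intro nn_integral_mono pt)
  also have "\<dots> = enn_powr V (p - p / r) * enn_powr (c * J) (p / r - 1) * (V * J)"
    by (subst nn_integral_cmult) (auto simp: X_def J_def V_def nn_integral_ball_integral)
  also have "\<dots> = (enn_powr V (p - p / r) * enn_powr V 1) * enn_powr c (p / r - 1)
      * (enn_powr J (p / r - 1) * enn_powr J 1)"
    by (simp add: enn_powr_mult ac_simps)
  also have "\<dots> = enn_powr V (p - p / r + 1) * enn_powr c (p / r - 1) * enn_powr J (p / r)"
    by (simp only: enn_powr_add[symmetric]) simp
  also have "enn_powr c (p / r - 1) = ennreal (\<rho> powr (- real DIM('a) * (p / r - 1)))"
    by (simp add: c_def enn_powr_ennreal powr_powr)
  finally show ?thesis
    by (simp add: V_def J_def)
qed

section \<open>The averaging operator S_t between Lebesgue spaces\<close>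

lemma nn_integral_powr_0_to:
  assumes "0 < a" "0 \<le> T"
  shows "(\<integral>\<^sup>+s. indicator {0<..<T} s * ennreal (s powr (a - 1)) \<partial>lborel) = ennreal (T powr a / a)"
proof -
  have "((\<lambda>s. s powr (a - 1)) has_integral (T powr a / a)) {0..T}"
    using has_integral_powr_from_0[of "a - 1" T] assms by simp
  then have *: "((\<lambda>s. s powr (a - 1)) has_integral (T powr a / a)) {0<..<T}"
    using has_integral_open_interval[of "\<lambda>s. s powr (a - 1)" "T powr a / a" 0 T] by simp
  show ?thesis
    using nn_integral_has_integral_lebesgue'[OF _ *] by (simp add: mult.commute)
qed

text \<open>In dimension \<open>n \<ge> 2\<close> and for \<open>t > 0\<close>, substituting
  \<open>y = s t w\<close> shows that this is convolution with a truncated Riesz kernel,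
  \<open>(|y|^(1-n) - t^(1-n)) / (n - 1)\<close> on \<open>|y| < t\<close>.\<close>

definition segment_ball_integral :: "real \<Rightarrow> ('a::euclidean_space \<Rightarrow> ennreal) \<Rightarrow> 'a \<Rightarrow> ennreal" where
  "segment_ball_integral t g x =
     ennreal t * (\<integral>\<^sup>+s. indicator {0<..<1} s * ball_integral (s * t) g x \<partial>lborel)"

lemma segment_ball_integral_measurable [measurable (raw)]:
  assumes [measurable]: "g \<in> borel_measurable borel" "T \<in> borel_measurable M" "X \<in> borel_measurable M"
  shows "(\<lambda>z. segment_ball_integral (T z) g (X z)) \<in> borel_measurable M"
  unfolding segment_ball_integral_def by measurable

text \<open>Weighted Jensen plays the part of Minkowski's integral inequality in \<open>s\<close>.
  The average at radius \<open>s t\<close> maps \<open>L^r\<close> to \<open>L^p\<close> with norm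
  of order \<open>(s t)^(-b)\<close>, where \<open>b = N / r - N / p\<close>. Multiplied by
  \<open>s^b\<close> these averages have bounds independent of \<open>s\<close>, and the
  compensating weight \<open>s^(-b)\<close> has mass \<open>1 / (1 - b)\<close>, finite since
  \<open>b < 1\<close>.\<close>

lemma segment_ball_integral_Lp_le:
  fixes g :: "'a::euclidean_space \<Rightarrow> ennreal"
  defines "N \<equiv> real DIM('a)"
  assumes g [measurable]: "g \<in> borel_measurable borel" and r: "1 < r" and p: "r \<le> p" and t: "0 < t"
    and b: "N / r - N / p < 1"
  shows "(\<integral>\<^sup>+x. enn_powr (segment_ball_integral t g x) p \<partial>lborel)
    \<le> enn_powr (unit_ball_measure TYPE('a)) (p - p / r + 1)
       * ennreal ((t powr (1 - N / r + N / p) / (1 - N / r + N / p)) powr p)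
       * enn_powr (\<integral>\<^sup>+x. enn_powr (g x) r \<partial>lborel) (p / r)"
proof -
  define b where "b = N / r - N / p"
  define K where "K = enn_powr (unit_ball_measure TYPE('a)) (p - p / r + 1)"
  define J where "J = enn_powr (\<integral>\<^sup>+x. enn_powr (g x) r \<partial>lborel) (p / r)"
  define w where "w = (\<lambda>s. indicator {0<..<1} s * ennreal (s powr (- b)))"
  have [measurable]: "w \<in> borel_measurable borel"
    unfolding w_def by measurable
  have b1: "b < 1" using assms(6) by (simp add: b_def)
  have p1: "1 < p" using r p by simp
  have W: "(\<integral>\<^sup>+s. w s \<partial>lborel) = ennreal (1 / (1 - b))"
    using nn_integral_powr_0_to[of "1 - b" 1] b1 by (simp add: w_def)
  have bp: "N * (p / r - 1) = b * p"
    using p1 by (simp add: b_def field_simps)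
  have pt: "enn_powr (segment_ball_integral t g x) p \<le> ennreal (t powr p) * (ennreal ((1 / (1 - b)) powr (p - 1))
      * (\<integral>\<^sup>+s. w s * (ennreal (s powr (b * p)) * enn_powr (ball_integral (s * t) g x) p) \<partial>lborel))" for x
  proof -
    have "(\<integral>\<^sup>+s. indicator {0<..<1} s * ball_integral (s * t) g x \<partial>lborel)
        = (\<integral>\<^sup>+s. w s * (ennreal (s powr b) * ball_integral (s * t) g x) \<partial>lborel)"
      by (intro nn_integral_cong)
        (auto simp: w_def mult.assoc[symmetric] ennreal_mult[symmetric] powr_add[symmetric] split: split_indicator)
    moreover have "enn_powr (\<integral>\<^sup>+s. w s * (ennreal (s powr b) * ball_integral (s * t) g x) \<partial>lborel) p
       \<le> enn_powr (\<integral>\<^sup>+s. w s \<partial>lborel) (p - 1)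
        * (\<integral>\<^sup>+s. w s * enn_powr (ennreal (s powr b) * ball_integral (s * t) g x) p \<partial>lborel)"
      by (intro nn_integral_Jensen p1) measurable
    ultimately show ?thesis
      using t b1 by (simp add: segment_ball_integral_def enn_powr_mult W enn_powr_ennreal powr_powr mult_left_mono)
  qed
  have "(\<integral>\<^sup>+x. enn_powr (segment_ball_integral t g x) p \<partial>lborel) \<le>
     (\<integral>\<^sup>+x. ennreal (t powr p) * (ennreal ((1 / (1 - b)) powr (p - 1))
      * (\<integral>\<^sup>+s. w s * (ennreal (s powr (b * p)) * enn_powr (ball_integral (s * t) g x) p) \<partial>lborel)) \<partial>lborel)"
    by (intro nn_integral_mono pt)
  also have "\<dots> = ennreal (t powr p) * (ennreal ((1 / (1 - b)) powr (p - 1))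
      * (\<integral>\<^sup>+x. (\<integral>\<^sup>+s. w s * (ennreal (s powr (b * p)) * enn_powr (ball_integral (s * t) g x) p) \<partial>lborel) \<partial>lborel))"
    by (simp add: nn_integral_cmult)
  also have "(\<integral>\<^sup>+x. (\<integral>\<^sup>+s. w s * (ennreal (s powr (b * p)) * enn_powr (ball_integral (s * t) g x) p) \<partial>lborel) \<partial>lborel)
      = (\<integral>\<^sup>+s. (\<integral>\<^sup>+x. w s * (ennreal (s powr (b * p)) * enn_powr (ball_integral (s * t) g x) p) \<partial>lborel) \<partial>lborel)"
    by (rule lborel_pair.Fubini') measurable
  also have "\<dots> = (\<integral>\<^sup>+s. w s * (ennreal (s powr (b * p)) * (\<integral>\<^sup>+x. enn_powr (ball_integral (s * t) g x) p \<partial>lborel)) \<partial>lborel)"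
    by (simp add: nn_integral_cmult)
  also have "\<dots> \<le> (\<integral>\<^sup>+s. (K * ennreal (t powr (- b * p)) * J) * w s \<partial>lborel)"
  proof (intro nn_integral_mono)
    fix s :: real
    show "w s * (ennreal (s powr (b * p)) * (\<integral>\<^sup>+x. enn_powr (ball_integral (s * t) g x) p \<partial>lborel))
        \<le> (K * ennreal (t powr (- b * p)) * J) * w s"
    proof (cases "0 < s \<and> s < 1")
      case True
      have "(\<integral>\<^sup>+x. enn_powr (ball_integral (s * t) g x) p \<partial>lborel) \<le> K * ennreal ((s * t) powr (- b * p)) * J"
        using ball_integral_Lp_le[OF g r p, of "s * t"] True t bp by (simp add: K_def J_def N_def)
      then have "ennreal (s powr (b * p)) * (\<integral>\<^sup>+x. enn_powr (ball_integral (s * t) g x) p \<partial>lborel)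
          \<le> ennreal (s powr (b * p)) * (K * ennreal ((s * t) powr (- b * p)) * J)"
        by (intro mult_left_mono) auto
      also have "\<dots> = K * ennreal (s powr (b * p) * (s * t) powr (- b * p)) * J"
        by (simp add: ennreal_mult ac_simps)
      \<comment> \<open>The weight was chosen for this cancellation: no power of \<open>s\<close> is
        left besides \<open>w s\<close>.\<close>
      also have "s powr (b * p) * (s * t) powr (- b * p) = t powr (- b * p)"
        using True t by (simp add: powr_mult powr_minus field_simps)
      finally show ?thesis
        by (metis mult.commute mult_left_mono zero_le)
    qed (auto simp: w_def)
  qed
  also have "\<dots> = K * ennreal (t powr (- b * p)) * J * ennreal (1 / (1 - b))"
    by (simp add: nn_integral_cmult W)
  finally have "(\<integral>\<^sup>+x. enn_powr (segment_ball_integral t g x) p \<partial>lborel)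
     \<le> ennreal (t powr p) * (ennreal ((1 / (1 - b)) powr (p - 1)) * (K * ennreal (t powr (- b * p)) * J * ennreal (1 / (1 - b))))"
    by (simp add: mult_left_mono)
  also have "\<dots> = K * ennreal (t powr p * (1 / (1 - b)) powr (p - 1) * t powr (- b * p) * (1 / (1 - b))) * J"
    using b1 by (simp add: ennreal_mult[symmetric] ac_simps)
  also have "t powr p * (1 / (1 - b)) powr (p - 1) * t powr (- b * p) * (1 / (1 - b))
      = (t powr (1 - b) / (1 - b)) powr p"
  proof -
    have "(1 / (1 - b)) powr (p - 1) * (1 / (1 - b)) = (1 / (1 - b)) powr p"
      using b1 by (simp add: powr_diff field_simps)
    moreover have "t powr p * t powr (- b * p) = (t powr (1 - b)) powr p"
      by (simp add: powr_powr powr_add[symmetric] algebra_simps)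
    ultimately have "t powr p * (1 / (1 - b)) powr (p - 1) * t powr (- b * p) * (1 / (1 - b))
       = (t powr (1 - b)) powr p * (1 / (1 - b)) powr p"
      by (metis mult.assoc mult.commute)
    also have "\<dots> = (t powr (1 - b) / (1 - b)) powr p"
      using b1 by (simp add: powr_mult[symmetric])
    finally show ?thesis .
  qed
  finally show ?thesis
    by (simp add: K_def J_def b_def algebra_simps)
qed

section \<open>Dyadic layers\<close>

text \<open>The summands are the lengths of disjoint subintervals of \<open>[0, c)\<close>.\<close>

lemma sum_disjoint_intervals_le:
  fixes l u :: "int \<Rightarrow> real"
  assumes "\<And>k. k \<in> K \<Longrightarrow> 0 \<le> l k \<and> l k \<le> u k \<and> u k \<le> c"
    and "\<And>k k'. k \<in> K \<Longrightarrow> k' \<in> K \<Longrightarrow> k < k' \<Longrightarrow> u k \<le> l k' \<or> u k' \<le> l k"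
  shows "(\<integral>\<^sup>+k. ennreal (u k - l k) * indicator K k \<partial>count_space UNIV) \<le> ennreal c"
proof -
  have disj: "disjoint_family_on (\<lambda>k. {l k..<u k}) K"
  proof (unfold disjoint_family_on_def, intro ballI impI)
    fix k k' assume "k \<in> K" "k' \<in> K" "k \<noteq> k'"
    then show "{l k..<u k} \<inter> {l k'..<u k'} = {}"
      using assms(2)[of k k'] assms(2)[of k' k] by (cases "k < k'") auto
  qed
  have "(\<integral>\<^sup>+k. ennreal (u k - l k) * indicator K k \<partial>count_space UNIV)
      = (\<integral>\<^sup>+k. ennreal (u k - l k) \<partial>count_space K)"
    by (subst nn_integral_count_space_indicator[of K]) auto
  also have "\<dots> = (\<integral>\<^sup>+k. emeasure lborel {l k..<u k} \<partial>count_space K)"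
    using assms(1) by (intro nn_integral_cong) auto
  also have "\<dots> = emeasure lborel (\<Union>k\<in>K. {l k..<u k})"
    using disj by (intro emeasure_UN_countable[symmetric]) auto
  also have "\<dots> \<le> emeasure lborel {0..c}"
    using assms(1) by (intro emeasure_mono) force+
  also have "\<dots> \<le> ennreal c"
    by (cases "0 \<le> c") auto
  finally show ?thesis .
qed

text \<open>The layer sums and both Hardy inequalities work for any such exponent \<open>N\<close>;
  only \<open>segment_ball_integral_split_le\<close> ties it to the dimension.\<close>

locale dyadic_levels =
  fixes g :: "'a::euclidean_space \<Rightarrow> real" and N :: real
  assumes g [measurable]: "g \<in> borel_measurable borel" and nonneg: "\<And>x. 0 \<le> g x"
    and N: "1 \<le> N" and fin: "(\<integral>\<^sup>+x. ennreal (g x powr N) \<partial>lborel) < top"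
begin

definition energy :: ennreal where
  "energy = (\<integral>\<^sup>+x. ennreal (g x powr N) \<partial>lborel)"

definition superlevel :: "int \<Rightarrow> 'a set" where
  "superlevel k = {x. 2 powr k < g x}"

definition layer :: "int \<Rightarrow> 'a set" where
  "layer k = {x. 2 powr k < g x \<and> g x \<le> 2 powr (k + 1)}"

text \<open>Real-valued so that differences of levels can be formed, as in \<open>m_eq\<close>. By
  \<open>superlevel_finite\<close> no infinite measure is silently replaced by 0.\<close>

definition \<mu> :: "int \<Rightarrow> real" where
  "\<mu> k = measure lborel (superlevel k)"

definition m :: "int \<Rightarrow> real" where
  "m k = measure lborel (layer k)"

lemma superlevel_sets [measurable]: "superlevel k \<in> sets borel"
  and layer_sets [measurable]: "layer k \<in> sets borel"
  unfolding superlevel_def layer_def by measurable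

lemma superlevel_antimono: "k \<le> l \<Longrightarrow> superlevel l \<subseteq> superlevel k"
proof
  fix x assume "k \<le> l" and "x \<in> superlevel l"
  then have "(2::real) powr k \<le> 2 powr l" and "2 powr l < g x"
    by (auto simp: superlevel_def)
  then show "x \<in> superlevel k"
    unfolding superlevel_def mem_Collect_eq by (rule le_less_trans)
qed

text \<open>Chebyshev's inequality for the \<open>N\<close>-th power.\<close>

lemma superlevel_finite: "emeasure lborel (superlevel k) < top"
proof -
  have "ennreal (2 powr (N * k)) * emeasure lborel (superlevel k)
      = (\<integral>\<^sup>+x. ennreal (2 powr (N * k)) * indicator (superlevel k) x \<partial>lborel)"
    by (simp add: nn_integral_cmult_indicator)
  also have "\<dots> \<le> energy"
    unfolding energy_def
  proof (intro nn_integral_mono)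
    fix x
    have "2 powr (N * k) \<le> g x powr N" if "x \<in> superlevel k"
      using that N powr_mono2[of N "2 powr k" "g x"] by (auto simp: superlevel_def powr_powr mult.commute)
    then show "ennreal (2 powr (N * k)) * indicator (superlevel k) x \<le> ennreal (g x powr N)"
      by (auto split: split_indicator intro: ennreal_leI)
  qed
  finally have "ennreal (2 powr (N * k)) * emeasure lborel (superlevel k) < top"
    using fin unfolding energy_def[symmetric] by (rule le_less_trans)
  then show ?thesis
    by (auto simp: ennreal_mult_less_top)
qed

lemma emeasure_superlevel: "emeasure lborel (superlevel k) = ennreal (\<mu> k)"
  unfolding \<mu>_def using superlevel_finite[of k] by (intro emeasure_eq_ennreal_measure) auto

lemma layer_finite: "emeasure lborel (layer k) < top"
proof -
  have "emeasure lborel (layer k) \<le> emeasure lborel (superlevel k)"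
    by (intro emeasure_mono) (auto simp: layer_def superlevel_def)
  then show ?thesis using superlevel_finite[of k] by (rule le_less_trans)
qed

lemma emeasure_layer: "emeasure lborel (layer k) = ennreal (m k)"
  unfolding m_def using layer_finite[of k] by (intro emeasure_eq_ennreal_measure) auto

lemma \<mu>_nonneg [simp]: "0 \<le> \<mu> k" and m_nonneg [simp]: "0 \<le> m k"
  by (auto simp: \<mu>_def m_def)

lemma m_eq: "m k = \<mu> k - \<mu> (k + 1)"
proof -
  have "layer k = superlevel k - superlevel (k + 1)"
    by (auto simp: layer_def superlevel_def)
  moreover have "superlevel (k + 1) \<subseteq> superlevel k"
    by (rule superlevel_antimono) simp
  ultimately show ?thesis
    unfolding m_def \<mu>_def using superlevel_finite[of k] superlevel_finite[of "k + 1"]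
    by (simp add: measure_Diff)
qed

lemma m_le_\<mu>: "m k \<le> \<mu> k"
  by (simp add: m_eq)

lemma \<mu>_antimono: "k \<le> l \<Longrightarrow> \<mu> l \<le> \<mu> k"
proof -
  assume "k \<le> l"
  then have "superlevel l \<subseteq> superlevel k" by (rule superlevel_antimono)
  then have "ennreal (\<mu> l) \<le> ennreal (\<mu> k)"
    unfolding emeasure_superlevel[symmetric] by (intro emeasure_mono) auto
  then show ?thesis by simp
qed

text \<open>After exchanging sum and integral, each point \<open>x\<close> carries the geometric
  series of \<open>2 powr (N * k)\<close> over \<open>2 powr k < g x\<close>. Since
  \<open>N \<ge> 1\<close>, each term is at most twice its difference from the preceding one, and
  these differences are lengths of disjoint intervals below \<open>g x powr N\<close>.\<close>

lemma sum_\<mu>_le: "(\<integral>\<^sup>+k. ennreal (2 powr (N * k) * \<mu> k) \<partial>count_space UNIV) \<le> 2 * energy"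
proof -
  have pt: "(\<integral>\<^sup>+k. ennreal (2 powr (N * k)) * indicator (superlevel k) x \<partial>count_space UNIV)
      \<le> 2 * ennreal (g x powr N)" for x
  proof -
    define K where "K = {k. x \<in> superlevel k}"
    have "(\<integral>\<^sup>+k. ennreal (2 powr (N * k)) * indicator (superlevel k) x \<partial>count_space UNIV)
        \<le> (\<integral>\<^sup>+k. 2 * (ennreal (2 powr (N * k) - 2 powr (N * (real_of_int k - 1))) * indicator K k) \<partial>count_space UNIV)"
    proof (intro nn_integral_mono)
      fix k :: int
      have "(2::real) powr (1 - N) \<le> 1"
        using powr_mono[of "1 - N" 0 2] N by simp
      then have "2 powr (N * k) * 2 powr (1 - N) \<le> 2 powr (N * k) * 1"
        by (intro mult_left_mono) auto
      moreover have "2 powr (N * k) * 2 powr (1 - N) = 2 * 2 powr (N * (real_of_int k - 1))"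
      proof -
        have "2 powr (N * k) * 2 powr (1 - N) = 2 powr (1 + N * (real_of_int k - 1))"
          by (simp add: powr_add[symmetric] algebra_simps)
        then show ?thesis
          by (simp add: powr_add)
      qed
      ultimately have "2 powr (N * k) \<le> 2 * (2 powr (N * k) - 2 powr (N * (real_of_int k - 1)))"
        by simp
      then have "ennreal (2 powr (N * k)) \<le> 2 * ennreal (2 powr (N * k) - 2 powr (N * (real_of_int k - 1)))"
        by (metis ennreal_leI ennreal_mult'' ennreal_numeral le_numeral_extra(3) mult_nonneg_nonneg
            powr_ge_zero zero_le_numeral ennreal_mult')
      then show "ennreal (2 powr (N * k)) * indicator (superlevel k) x
        \<le> 2 * (ennreal (2 powr (N * k) - 2 powr (N * (real_of_int k - 1))) * indicator K k)"
        by (auto simp: K_def split: split_indicator)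
    qed
    also have "\<dots> \<le> 2 * ennreal (g x powr N)"
    proof (subst nn_integral_cmult, simp, intro mult_left_mono sum_disjoint_intervals_le)
      fix k assume "k \<in> K"
      then have "2 powr k < g x" by (simp add: K_def superlevel_def)
      then have "(2 powr k) powr N \<le> g x powr N"
        using N by (intro powr_mono2) auto
      then show "0 \<le> 2 powr (N * (real_of_int k - 1)) \<and> 2 powr (N * (real_of_int k - 1)) \<le> 2 powr (N * k)
          \<and> 2 powr (N * k) \<le> g x powr N"
        using N by (auto simp: powr_powr mult.commute)
    next
      fix k k' :: int assume "k < k'"
      then have "real_of_int k \<le> real_of_int k' - 1" by linarith
      then show "2 powr (N * k) \<le> 2 powr (N * (real_of_int k' - 1)) \<or> 2 powr (N * k') \<le> 2 powr (N * (real_of_int k - 1))"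
        using N by simp
    qed simp
    finally show ?thesis .
  qed
  have "(\<integral>\<^sup>+k. ennreal (2 powr (N * k) * \<mu> k) \<partial>count_space UNIV)
      = (\<integral>\<^sup>+k. (\<integral>\<^sup>+x. ennreal (2 powr (N * k)) * indicator (superlevel k) x \<partial>lborel) \<partial>count_space UNIV)"
    by (simp add: nn_integral_cmult_indicator emeasure_superlevel ennreal_mult)
  also have "\<dots> = (\<integral>\<^sup>+x. (\<integral>\<^sup>+k. ennreal (2 powr (N * k)) * indicator (superlevel k) x \<partial>count_space UNIV) \<partial>lborel)"
    by (intro nn_integral_count_space_nn_integral[symmetric]) auto
  also have "\<dots> \<le> (\<integral>\<^sup>+x. 2 * ennreal (g x powr N) \<partial>lborel)"
    by (intro nn_integral_mono pt)
  also have "\<dots> = 2 * energy"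
    unfolding energy_def by (intro nn_integral_cmult) auto
  finally show ?thesis .
qed

text \<open>The free sequence \<open>x\<close> serves two uses: \<open>m k\<close> in the high part
  and \<open>m k powr (N / p) * \<mu> k powr (1 - N / p)\<close> in the low part. The shift by 1 is
  the upper end of a layer.\<close>

lemma sum_shift_le:
  assumes "\<And>k. 0 \<le> x k \<and> x k \<le> \<mu> k"
  shows "(\<integral>\<^sup>+k. ennreal (2 powr (N * (real_of_int k + 1)) * x k) \<partial>count_space UNIV) \<le> ennreal (2 * 2 powr N) * energy"
proof -
  have "(\<integral>\<^sup>+k. ennreal (2 powr (N * (real_of_int k + 1)) * x k) \<partial>count_space UNIV)
      \<le> (\<integral>\<^sup>+k. ennreal (2 powr N) * ennreal (2 powr (N * k) * \<mu> k) \<partial>count_space UNIV)"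
    using assms
    by (intro nn_integral_mono)
      (auto simp: ennreal_mult[symmetric] algebra_simps powr_add intro!: ennreal_leI mult_left_mono)
  also have "\<dots> \<le> ennreal (2 powr N) * (2 * energy)"
    by (simp add: nn_integral_cmult mult_left_mono sum_\<mu>_le)
  also have "\<dots> = ennreal (2 * 2 powr N) * energy"
    by (simp add: ennreal_mult ac_simps)
  finally show ?thesis .
qed

lemma layers_power_le:
  assumes r: "0 < r"
  shows "(\<integral>\<^sup>+x. enn_powr (ennreal (g x) * indicator (\<Union>k\<in>K. layer k) x) r \<partial>lborel)
    \<le> (\<integral>\<^sup>+k. ennreal (2 powr (r * (real_of_int k + 1)) * m k) * indicator K k \<partial>count_space UNIV)"
proof -
  have "(\<integral>\<^sup>+x. enn_powr (ennreal (g x) * indicator (\<Union>k\<in>K. layer k) x) r \<partial>lborel)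
     \<le> (\<integral>\<^sup>+x. (\<integral>\<^sup>+k. ennreal (2 powr (r * (real_of_int k + 1))) * indicator K k * indicator (layer k) x \<partial>count_space UNIV) \<partial>lborel)"
  proof (intro nn_integral_mono)
    fix x
    show "enn_powr (ennreal (g x) * indicator (\<Union>k\<in>K. layer k) x) r
      \<le> (\<integral>\<^sup>+k. ennreal (2 powr (r * (real_of_int k + 1))) * indicator K k * indicator (layer k) x \<partial>count_space UNIV)"
    proof (cases "x \<in> (\<Union>k\<in>K. layer k)")
      case True
      then obtain k where k: "k \<in> K" "x \<in> layer k" by auto
      have "g x powr r \<le> (2 powr (real_of_int k + 1)) powr r"
        using k r nonneg by (intro powr_mono2) (auto simp: layer_def)
      then have "enn_powr (ennreal (g x) * indicator (\<Union>k\<in>K. layer k) x) r \<le> ennreal (2 powr (r * (real_of_int k + 1)))"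
        using True nonneg by (auto simp: enn_powr_ennreal powr_powr mult.commute intro!: ennreal_leI)
      also have "\<dots> = ennreal (2 powr (r * (real_of_int k + 1))) * indicator K k * indicator (layer k) x"
        using k by simp
      also have "\<dots> \<le> (\<integral>\<^sup>+k. ennreal (2 powr (r * (real_of_int k + 1))) * indicator K k * indicator (layer k) x \<partial>count_space UNIV)"
        by (rule nn_integral_count_space_ge) simp
      finally show ?thesis .
    qed simp
  qed
  also have "\<dots> = (\<integral>\<^sup>+k. (\<integral>\<^sup>+x. ennreal (2 powr (r * (real_of_int k + 1))) * indicator K k * indicator (layer k) x \<partial>lborel) \<partial>count_space UNIV)"
    by (intro nn_integral_count_space_nn_integral) auto
  also have "\<dots> = (\<integral>\<^sup>+k. ennreal (2 powr (r * (real_of_int k + 1)) * m k) * indicator K k \<partial>count_space UNIV)"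
    by (simp add: nn_integral_cmult_indicator emeasure_layer) (simp add: ennreal_mult ac_simps)
  finally show ?thesis .
qed

text \<open>For \<open>t > 0\<close>, layer \<open>k\<close> belongs to the high part exactly from
  \<open>t = \<mu> k powr (1/N)\<close> onwards. A cutoff that depends on \<open>k\<close> in this
  simple way lets the integral over \<open>t\<close> be computed layer by layer.\<close>

definition high :: "real \<Rightarrow> 'a \<Rightarrow> ennreal" where
  "high t x = ennreal (g x) * indicator (\<Union>k\<in>{k. \<mu> k \<le> t powr N}. layer k) x"

definition low :: "real \<Rightarrow> 'a \<Rightarrow> ennreal" where
  "low t x = ennreal (g x) * indicator (\<Union>k\<in>{k. t powr N < \<mu> k}. layer k) x"

text \<open>Joint measurability in \<open>t\<close> and \<open>x\<close> is what makes the
  \<open>x\<close>-integrals measurable functions of \<open>t\<close>; the union over layers becomes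
  a countable disjunction over the integers.\<close>

lemma high_measurable [measurable (raw)]:
  assumes [measurable]: "T \<in> borel_measurable M" "X \<in> borel_measurable M"
  shows "(\<lambda>z. high (T z) (X z)) \<in> borel_measurable M"
proof -
  have [measurable]: "Measurable.pred M (\<lambda>z. X z \<in> layer k)" for k
    using measurable_sets[OF assms(2) layer_sets[of k]] by (simp add: pred_def vimage_def Int_def conj_commute)
  have "high (T z) (X z) = (if \<exists>k. \<mu> k \<le> T z powr N \<and> X z \<in> layer k then ennreal (g (X z)) else 0)" for z
    by (auto simp: high_def split: split_indicator)
  then show ?thesis by simp
qed

lemma low_measurable [measurable (raw)]:
  assumes [measurable]: "T \<in> borel_measurable M" "X \<in> borel_measurable M"
  shows "(\<lambda>z. low (T z) (X z)) \<in> borel_measurable M"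
proof -
  have [measurable]: "Measurable.pred M (\<lambda>z. X z \<in> layer k)" for k
    using measurable_sets[OF assms(2) layer_sets[of k]] by (simp add: pred_def vimage_def Int_def conj_commute)
  have "low (T z) (X z) = (if \<exists>k. T z powr N < \<mu> k \<and> X z \<in> layer k then ennreal (g (X z)) else 0)" for z
    by (auto simp: low_def split: split_indicator)
  then show ?thesis by simp
qed

lemma le_high_low: "ennreal (g x) \<le> high t x + low t x"
proof (cases "g x = 0")
  case False
  then have pos: "0 < g x" using nonneg[of x] by simp
  \<comment> \<open>Layers are open below and closed above, so the index is the ceiling minus 1 and
    not the floor.\<close>
  define k where "k = \<lceil>log 2 (g x)\<rceil> - 1"
  have "real_of_int k < log 2 (g x)" "log 2 (g x) \<le> real_of_int k + 1"
    unfolding k_def by linarith+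
  then have "x \<in> layer k"
    using pos by (simp add: layer_def less_log_iff log_le_iff)
  then show ?thesis
    by (cases "\<mu> k \<le> t powr N") (auto simp: high_def low_def split: split_indicator)
qed simp

text \<open>A Riemann sum for the integral of \<open>s powr (-1/2)\<close> over
  \<open>[0, T]\<close>: \<open>m k\<close> is a difference of consecutive levels, and factoring it
  through square roots bounds each term by twice a difference of square roots, which
  telescopes.\<close>

lemma level_weight_sum_le:
  assumes "0 \<le> T"
  shows "(\<integral>\<^sup>+k. ennreal (m k * \<mu> k powr (-1/2)) * indicator {k. \<mu> k \<le> T} k \<partial>count_space UNIV)
    \<le> ennreal (2 * sqrt T)"
proof -
  have "(\<integral>\<^sup>+k. ennreal (m k * \<mu> k powr (-1/2)) * indicator {k. \<mu> k \<le> T} k \<partial>count_space UNIV)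
     \<le> (\<integral>\<^sup>+k. 2 * (ennreal (sqrt (\<mu> k) - sqrt (\<mu> (k + 1))) * indicator {k. \<mu> k \<le> T} k) \<partial>count_space UNIV)"
  proof (intro nn_integral_mono)
    fix k
    have mono: "\<mu> (k + 1) \<le> \<mu> k" by (rule \<mu>_antimono) simp
    have "m k * \<mu> k powr (-1/2) \<le> 2 * (sqrt (\<mu> k) - sqrt (\<mu> (k + 1)))"
    proof (cases "\<mu> k = 0")
      case False
      then have pos: "0 < \<mu> k" using \<mu>_nonneg[of k] by linarith
      have "m k = (sqrt (\<mu> k) - sqrt (\<mu> (k + 1))) * (sqrt (\<mu> k) + sqrt (\<mu> (k + 1)))"
        by (simp add: m_eq algebra_simps)
      also have "\<dots> \<le> (sqrt (\<mu> k) - sqrt (\<mu> (k + 1))) * (2 * sqrt (\<mu> k))"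
        using mono by (intro mult_left_mono) auto
      finally have "m k \<le> 2 * (sqrt (\<mu> k) - sqrt (\<mu> (k + 1))) * sqrt (\<mu> k)"
        by (simp only: ac_simps)
      then have "m k / sqrt (\<mu> k) \<le> 2 * (sqrt (\<mu> k) - sqrt (\<mu> (k + 1)))"
        using pos by (simp add: pos_divide_le_eq)
      moreover have "\<mu> k powr (-1/2) = 1 / sqrt (\<mu> k)"
        using pos by (simp add: powr_minus powr_half_sqrt field_simps)
      ultimately show ?thesis by simp
    qed (use mono in simp)
    then have "ennreal (m k * \<mu> k powr (-1/2)) \<le> 2 * ennreal (sqrt (\<mu> k) - sqrt (\<mu> (k + 1)))"
      by (metis ennreal_leI ennreal_mult' ennreal_numeral zero_le_numeral)
    then show "ennreal (m k * \<mu> k powr (-1/2)) * indicator {k. \<mu> k \<le> T} k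
      \<le> 2 * (ennreal (sqrt (\<mu> k) - sqrt (\<mu> (k + 1))) * indicator {k. \<mu> k \<le> T} k)"
      by (auto split: split_indicator)
  qed
  also have "\<dots> \<le> 2 * ennreal (sqrt T)"
  proof (subst nn_integral_cmult, simp, intro mult_left_mono sum_disjoint_intervals_le)
    fix k assume "k \<in> {k. \<mu> k \<le> T}"
    then show "0 \<le> sqrt (\<mu> (k + 1)) \<and> sqrt (\<mu> (k + 1)) \<le> sqrt (\<mu> k) \<and> sqrt (\<mu> k) \<le> sqrt T"
      using \<mu>_antimono[of k "k + 1"] by simp
  next
    fix k k' :: int assume "k < k'"
    then show "sqrt (\<mu> k) \<le> sqrt (\<mu> (k' + 1)) \<or> sqrt (\<mu> k') \<le> sqrt (\<mu> (k + 1))"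
      using \<mu>_antimono[of "k + 1" k'] by simp
  qed simp
  also have "\<dots> = ennreal (2 * sqrt T)"
    using assms by (simp add: ennreal_mult)
  finally show ?thesis .
qed

end

section \<open>Hardy type inequalities for the high and low parts\<close>

lemma nn_integral_powr_to_inf:
  assumes "0 < a" "0 < T"
  shows "(\<integral>\<^sup>+s. indicator {T..} s * ennreal (s powr (- a - 1)) \<partial>lborel) = ennreal (T powr (- a) / a)"
proof -
  have *: "((\<lambda>s. s powr (- a - 1)) has_integral (T powr (- a) / a)) {T..}"
    using has_integral_powr_to_inf[of "- a - 1" T] assms by simp
  show ?thesis
    using nn_integral_has_integral_lebesgue'[OF _ *] by (simp add: mult.commute)
qed

context dyadic_levels
begin

text \<open>The weight \<open>m k * \<mu> k powr (-1/2)\<close>, whose sum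
  \<open>level_weight_sum_le\<close> controls, is split off before Jensen is applied with exponent
  \<open>q\<close>. The compensating power of \<open>\<mu> k\<close> is cancelled afterwards by the
  integral over \<open>t \<ge> \<mu> k powr (1/N)\<close>, and the sum in
  \<open>sum_shift_le\<close> remains.\<close>

lemma high_Hardy:
  assumes q: "1 < q"
  shows "(\<integral>\<^sup>+t. indicator {0<..} t * (ennreal (t powr (N - N * q - 1))
      * enn_powr (\<integral>\<^sup>+x. enn_powr (high t x) (N / q) \<partial>lborel) q) \<partial>lborel)
    \<le> ennreal (2 powr (q - 1) * (2 / (N * (q - 1))) * (2 * 2 powr N)) * energy"
proof -
  define r where "r = N / q"
  have r: "0 < r" "r * q = N" using q N by (auto simp: r_def)
  \<comment> \<open>The given weight is \<open>t powr (- N * (q - 1) - 1)\<close>. The first factor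
    in Jensen's inequality, a power of \<open>sqrt (t powr N)\<close>, uses up half of
    \<open>N * (q - 1)\<close>; the other half is \<open>a\<close> and gives convergence at
    infinity.\<close>
  define a where "a = N * (q - 1) / 2"
  have a: "0 < a" using q N by (simp add: a_def)
  define y where "y = (\<lambda>k::int. 2 powr (N * (real_of_int k + 1)) * m k * \<mu> k powr ((q - 1) / 2))"
  have y0: "0 \<le> y k" for k by (simp add: y_def)
  have pt: "enn_powr (\<integral>\<^sup>+x. enn_powr (high t x) r \<partial>lborel) q
    \<le> ennreal (2 powr (q - 1) * t powr a) * (\<integral>\<^sup>+k. ennreal (y k) * indicator {k. \<mu> k \<le> t powr N} k \<partial>count_space UNIV)"
    if t: "0 < t" for t
  proof -
    define w where "w = (\<lambda>k. ennreal (m k * \<mu> k powr (-1/2)) * indicator {k. \<mu> k \<le> t powr N} k)"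
    define h where "h = (\<lambda>k::int. ennreal (2 powr (r * (real_of_int k + 1)) * \<mu> k powr (1/2)))"
    have wh: "w k * h k = ennreal (2 powr (r * (real_of_int k + 1)) * m k) * indicator {k. \<mu> k \<le> t powr N} k" for k
    \<comment> \<open>A level of measure 0 has \<open>m k = 0\<close>. It is treated separately
      because \<open>0 powr (-1/2) * 0 powr (1/2)\<close> is 0 and not 1.\<close>
    proof (cases "\<mu> k = 0")
      case True
      then show ?thesis using m_le_\<mu>[of k] m_nonneg[of k] by (simp add: w_def)
    next
      case False
      then have "\<mu> k powr (-1/2) * \<mu> k powr (1/2) = 1"
        by (simp add: powr_add[symmetric])
      then have "m k * \<mu> k powr (-1/2) * (2 powr (r * (real_of_int k + 1)) * \<mu> k powr (1/2)) = 2 powr (r * (real_of_int k + 1)) * m k"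
        by algebra
      then show ?thesis
        by (simp add: w_def h_def ennreal_mult[symmetric] split: split_indicator)
    qed
    have wq: "w k * enn_powr (h k) q = ennreal (y k) * indicator {k. \<mu> k \<le> t powr N} k" for k
    proof (cases "\<mu> k = 0")
      case True
      then show ?thesis using m_le_\<mu>[of k] m_nonneg[of k] by (simp add: w_def y_def)
    next
      case False
      have 1: "\<mu> k powr (-1/2) * \<mu> k powr (1/2 * q) = \<mu> k powr ((q - 1) / 2)"
        by (simp add: powr_add[symmetric] diff_divide_distrib)
      have 2: "r * (real_of_int k + 1) * q = N * (real_of_int k + 1)"
        by (simp add: r(2)[symmetric])
      have "m k * \<mu> k powr (-1/2) * ((2 powr (r * (real_of_int k + 1)) * \<mu> k powr (1/2)) powr q)
          = 2 powr (N * (real_of_int k + 1)) * m k * (\<mu> k powr (-1/2) * \<mu> k powr (1/2 * q))"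
        by (simp only: powr_mult powr_powr 2) (simp only: ac_simps)
      then have "m k * \<mu> k powr (-1/2) * ((2 powr (r * (real_of_int k + 1)) * \<mu> k powr (1/2)) powr q) = y k"
        by (simp only: 1 y_def)
      then show ?thesis
        by (simp add: w_def h_def enn_powr_ennreal ennreal_mult[symmetric] split: split_indicator)
    qed
    have "(\<integral>\<^sup>+x. enn_powr (high t x) r \<partial>lborel) \<le> (\<integral>\<^sup>+k. w k * h k \<partial>count_space UNIV)"
      unfolding wh high_def by (rule layers_power_le[OF r(1)])
    then have "enn_powr (\<integral>\<^sup>+x. enn_powr (high t x) r \<partial>lborel) q \<le> enn_powr (\<integral>\<^sup>+k. w k * h k \<partial>count_space UNIV) q"
      using q by (intro enn_powr_mono) auto
    also have "\<dots> \<le> enn_powr (\<integral>\<^sup>+k. w k \<partial>count_space UNIV) (q - 1) * (\<integral>\<^sup>+k. w k * enn_powr (h k) q \<partial>count_space UNIV)"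
      using q by (intro nn_integral_Jensen) auto
    also have "\<dots> \<le> enn_powr (ennreal (2 * sqrt (t powr N))) (q - 1) * (\<integral>\<^sup>+k. w k * enn_powr (h k) q \<partial>count_space UNIV)"
      unfolding w_def using q by (intro mult_right_mono enn_powr_mono level_weight_sum_le) auto
    also have "enn_powr (ennreal (2 * sqrt (t powr N))) (q - 1) = ennreal (2 powr (q - 1) * t powr a)"
      using t by (simp add: enn_powr_ennreal powr_mult powr_half_sqrt[symmetric] powr_powr a_def)
    finally show ?thesis
      unfolding wq .
  qed
  have "(\<integral>\<^sup>+t. indicator {0<..} t * (ennreal (t powr (N - N * q - 1))
      * enn_powr (\<integral>\<^sup>+x. enn_powr (high t x) (N / q) \<partial>lborel) q) \<partial>lborel)
     \<le> (\<integral>\<^sup>+t. (\<integral>\<^sup>+k. ennreal (2 powr (q - 1)) * ennreal (y k)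
           * (indicator {\<mu> k powr (1/N)..} t * ennreal (t powr (- a - 1))) \<partial>count_space UNIV) \<partial>lborel)"
  proof (intro nn_integral_mono)
    fix t :: real
    show "indicator {0<..} t * (ennreal (t powr (N - N * q - 1))
      * enn_powr (\<integral>\<^sup>+x. enn_powr (high t x) (N / q) \<partial>lborel) q)
      \<le> (\<integral>\<^sup>+k. ennreal (2 powr (q - 1)) * ennreal (y k)
           * (indicator {\<mu> k powr (1/N)..} t * ennreal (t powr (- a - 1))) \<partial>count_space UNIV)"
    proof (cases "0 < t")
      case True
      have "ennreal (t powr (N - N * q - 1)) * enn_powr (\<integral>\<^sup>+x. enn_powr (high t x) r \<partial>lborel) q
        \<le> ennreal (t powr (N - N * q - 1)) * (ennreal (2 powr (q - 1) * t powr a)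
           * (\<integral>\<^sup>+k. ennreal (y k) * indicator {k. \<mu> k \<le> t powr N} k \<partial>count_space UNIV))"
        using pt[OF True] by (intro mult_left_mono) auto
      also have "\<dots> = ennreal (2 powr (q - 1) * t powr (- a - 1))
           * (\<integral>\<^sup>+k. ennreal (y k) * indicator {k. \<mu> k \<le> t powr N} k \<partial>count_space UNIV)"
      proof -
        have "N - N * q - 1 + a = - a - 1"
          by (simp add: a_def field_simps)
        then have "t powr (N - N * q - 1) * (2 powr (q - 1) * t powr a) = 2 powr (q - 1) * t powr (- a - 1)"
          by (metis mult.left_commute powr_add)
        then show ?thesis
          by (simp only: mult.assoc[symmetric] ennreal_mult[symmetric] powr_ge_zero mult_nonneg_nonneg)
      qed
      also have "\<dots> = (\<integral>\<^sup>+k. ennreal (2 powr (q - 1) * t powr (- a - 1)) * (ennreal (y k) * indicator {k. \<mu> k \<le> t powr N} k) \<partial>count_space UNIV)"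
        by (subst nn_integral_cmult) auto
      also have "\<dots> \<le> (\<integral>\<^sup>+k. ennreal (2 powr (q - 1)) * ennreal (y k)
           * (indicator {\<mu> k powr (1/N)..} t * ennreal (t powr (- a - 1))) \<partial>count_space UNIV)"
      proof (intro nn_integral_mono)
        fix k :: int
        have "\<mu> k powr (1/N) \<le> t" if "\<mu> k \<le> t powr N"
          using powr_mono2[of "1/N" "\<mu> k" "t powr N"] that N True by (simp add: powr_powr)
        then show "ennreal (2 powr (q - 1) * t powr (- a - 1)) * (ennreal (y k) * indicator {k. \<mu> k \<le> t powr N} k)
          \<le> ennreal (2 powr (q - 1)) * ennreal (y k) * (indicator {\<mu> k powr (1/N)..} t * ennreal (t powr (- a - 1)))"
          by (auto simp: ennreal_mult ac_simps split: split_indicator)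
      qed
      finally show ?thesis
        using True by (simp add: r_def)
    qed simp
  qed
  also have "\<dots> = (\<integral>\<^sup>+k. (\<integral>\<^sup>+t. ennreal (2 powr (q - 1)) * ennreal (y k)
           * (indicator {\<mu> k powr (1/N)..} t * ennreal (t powr (- a - 1))) \<partial>lborel) \<partial>count_space UNIV)"
    by (intro nn_integral_count_space_nn_integral) auto
  also have "\<dots> \<le> (\<integral>\<^sup>+k. ennreal (2 powr (q - 1) * (1 / a)) * ennreal (2 powr (N * (real_of_int k + 1)) * m k) \<partial>count_space UNIV)"
  proof (intro nn_integral_mono)
    fix k :: int
    show "(\<integral>\<^sup>+t. ennreal (2 powr (q - 1)) * ennreal (y k)
           * (indicator {\<mu> k powr (1/N)..} t * ennreal (t powr (- a - 1))) \<partial>lborel)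
       \<le> ennreal (2 powr (q - 1) * (1 / a)) * ennreal (2 powr (N * (real_of_int k + 1)) * m k)"
    proof (cases "\<mu> k = 0")
      case True
      then show ?thesis using m_le_\<mu>[of k] m_nonneg[of k] by (simp add: y_def)
    next
      case False
      then have pos: "0 < \<mu> k" using \<mu>_nonneg[of k] by linarith
      have "(\<integral>\<^sup>+t. ennreal (2 powr (q - 1)) * ennreal (y k)
           * (indicator {\<mu> k powr (1/N)..} t * ennreal (t powr (- a - 1))) \<partial>lborel)
         = ennreal (2 powr (q - 1)) * ennreal (y k) * ennreal ((\<mu> k powr (1/N)) powr (- a) / a)"
        using a pos by (subst nn_integral_cmult) (auto simp: nn_integral_powr_to_inf)
      also have "\<dots> = ennreal (2 powr (q - 1) * (1 / a) * (2 powr (N * (real_of_int k + 1)) * m k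
           * (\<mu> k powr ((q - 1) / 2) * (\<mu> k powr (1/N)) powr (- a))))"
        using a y0 by (simp add: ennreal_mult[symmetric] y_def ac_simps)
      \<comment> \<open>The tail integral returns the inverse of the power of \<open>\<mu> k\<close>
        inside \<open>y k\<close>, because \<open>a / N = (q - 1) / 2\<close>.\<close>
      also have "\<mu> k powr ((q - 1) / 2) * (\<mu> k powr (1/N)) powr (- a) = 1"
        using pos N by (simp add: powr_powr powr_add[symmetric] a_def)
      finally show ?thesis
        using a by (simp add: ennreal_mult[symmetric] )
    qed
  qed
  also have "\<dots> = ennreal (2 powr (q - 1) * (1 / a)) * (\<integral>\<^sup>+k. ennreal (2 powr (N * (real_of_int k + 1)) * m k) \<partial>count_space UNIV)"
    by (subst nn_integral_cmult) auto
  also have "\<dots> \<le> ennreal (2 powr (q - 1) * (1 / a)) * (ennreal (2 * 2 powr N) * energy)"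
    by (intro mult_left_mono sum_shift_le) (auto simp: m_le_\<mu>)
  also have "\<dots> = ennreal (2 powr (q - 1) * (2 / (N * (q - 1))) * (2 * 2 powr N)) * energy"
    using a by (simp add: mult.assoc[symmetric] ennreal_mult[symmetric] a_def)
  finally show ?thesis .
qed

text \<open>The outer exponent \<open>N / p\<close> is below 1, so subadditivity
  (\<open>enn_powr_sum_le\<close>) takes the place of Jensen's inequality. Layer \<open>k\<close>
  contributes only for \<open>t < \<mu> k powr (1/N)\<close>, and integrating
  \<open>t powr (N * \<beta> - 1)\<close> up to there gives
  \<open>\<mu> k powr \<beta> / (N * \<beta>)\<close>: this is where \<open>1 / \<beta>\<close>
  arises.\<close>

lemma low_Hardy:
  assumes p: "N < p"
  defines "\<beta> \<equiv> 1 - N / p"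
  shows "(\<integral>\<^sup>+t. indicator {0<..} t * (ennreal (t powr (N * \<beta> - 1))
      * enn_powr (\<integral>\<^sup>+x. enn_powr (low t x) p \<partial>lborel) (N / p)) \<partial>lborel)
    \<le> ennreal (1 / (N * \<beta>) * (2 * 2 powr N)) * energy"
proof -
  have \<beta>: "0 < \<beta>" using p N by (simp add: \<beta>_def)
  have p0: "0 < p" using p N by simp
  define y where "y = (\<lambda>k::int. 2 powr (N * (real_of_int k + 1)) * m k powr (N / p))"
  have y0: "0 \<le> y k" for k by (simp add: y_def)
  have pt: "enn_powr (\<integral>\<^sup>+x. enn_powr (low t x) p \<partial>lborel) (N / p)
    \<le> (\<integral>\<^sup>+k. ennreal (y k) * indicator {k. t powr N < \<mu> k} k \<partial>count_space UNIV)" for t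
  proof -
    have "enn_powr (\<integral>\<^sup>+x. enn_powr (low t x) p \<partial>lborel) (N / p)
      \<le> enn_powr (\<integral>\<^sup>+k. ennreal (2 powr (p * (real_of_int k + 1)) * m k) * indicator {k. t powr N < \<mu> k} k \<partial>count_space UNIV) (N / p)"
      unfolding low_def using N p0 by (intro enn_powr_mono layers_power_le) auto
    also have "\<dots> \<le> (\<integral>\<^sup>+k. enn_powr (ennreal (2 powr (p * (real_of_int k + 1)) * m k) * indicator {k. t powr N < \<mu> k} k) (N / p) \<partial>count_space UNIV)"
      using N p by (intro enn_powr_sum_le) auto
    also have "\<dots> = (\<integral>\<^sup>+k. ennreal (y k) * indicator {k. t powr N < \<mu> k} k \<partial>count_space UNIV)"
    proof (intro nn_integral_cong)
      fix k :: int
      have "(2 powr (p * (real_of_int k + 1)) * m k) powr (N / p) = y k"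
        using p0 by (simp add: y_def powr_mult powr_powr mult.commute)
      then show "enn_powr (ennreal (2 powr (p * (real_of_int k + 1)) * m k) * indicator {k. t powr N < \<mu> k} k) (N / p)
        = ennreal (y k) * indicator {k. t powr N < \<mu> k} k"
        by (auto simp: enn_powr_ennreal split: split_indicator)
    qed
    finally show ?thesis .
  qed
  have "(\<integral>\<^sup>+t. indicator {0<..} t * (ennreal (t powr (N * \<beta> - 1))
      * enn_powr (\<integral>\<^sup>+x. enn_powr (low t x) p \<partial>lborel) (N / p)) \<partial>lborel)
     \<le> (\<integral>\<^sup>+t. (\<integral>\<^sup>+k. ennreal (y k)
           * (indicator {0<..<\<mu> k powr (1/N)} t * ennreal (t powr (N * \<beta> - 1))) \<partial>count_space UNIV) \<partial>lborel)"
  proof (intro nn_integral_mono)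
    fix t :: real
    show "indicator {0<..} t * (ennreal (t powr (N * \<beta> - 1))
      * enn_powr (\<integral>\<^sup>+x. enn_powr (low t x) p \<partial>lborel) (N / p))
      \<le> (\<integral>\<^sup>+k. ennreal (y k)
           * (indicator {0<..<\<mu> k powr (1/N)} t * ennreal (t powr (N * \<beta> - 1))) \<partial>count_space UNIV)"
    proof (cases "0 < t")
      case True
      have "ennreal (t powr (N * \<beta> - 1)) * enn_powr (\<integral>\<^sup>+x. enn_powr (low t x) p \<partial>lborel) (N / p)
        \<le> ennreal (t powr (N * \<beta> - 1)) * (\<integral>\<^sup>+k. ennreal (y k) * indicator {k. t powr N < \<mu> k} k \<partial>count_space UNIV)"
        by (intro mult_left_mono pt) auto
      also have "\<dots> = (\<integral>\<^sup>+k. ennreal (t powr (N * \<beta> - 1)) * (ennreal (y k) * indicator {k. t powr N < \<mu> k} k) \<partial>count_space UNIV)"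
        by (subst nn_integral_cmult) auto
      also have "\<dots> \<le> (\<integral>\<^sup>+k. ennreal (y k)
           * (indicator {0<..<\<mu> k powr (1/N)} t * ennreal (t powr (N * \<beta> - 1))) \<partial>count_space UNIV)"
      proof (intro nn_integral_mono)
        fix k :: int
        have "t < \<mu> k powr (1/N)" if "t powr N < \<mu> k"
          using powr_less_mono2[of "1/N" "t powr N" "\<mu> k"] that N True by (simp add: powr_powr)
        then show "ennreal (t powr (N * \<beta> - 1)) * (ennreal (y k) * indicator {k. t powr N < \<mu> k} k)
          \<le> ennreal (y k) * (indicator {0<..<\<mu> k powr (1/N)} t * ennreal (t powr (N * \<beta> - 1)))"
          using True by (auto simp: ac_simps split: split_indicator)
      qed
      finally show ?thesis
        using True by simp
    qed simp
  qed
  also have "\<dots> = (\<integral>\<^sup>+k. (\<integral>\<^sup>+t. ennreal (y k)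
           * (indicator {0<..<\<mu> k powr (1/N)} t * ennreal (t powr (N * \<beta> - 1))) \<partial>lborel) \<partial>count_space UNIV)"
    by (intro nn_integral_count_space_nn_integral) auto
  also have "\<dots> = (\<integral>\<^sup>+k. ennreal (1 / (N * \<beta>)) * ennreal (2 powr (N * (real_of_int k + 1)) * (m k powr (N / p) * \<mu> k powr \<beta>)) \<partial>count_space UNIV)"
  proof (intro nn_integral_cong)
    fix k :: int
    have "(\<integral>\<^sup>+t. ennreal (y k)
           * (indicator {0<..<\<mu> k powr (1/N)} t * ennreal (t powr (N * \<beta> - 1))) \<partial>lborel)
         = ennreal (y k) * ennreal ((\<mu> k powr (1/N)) powr (N * \<beta>) / (N * \<beta>))"
      using \<beta> N by (subst nn_integral_cmult) (auto simp: nn_integral_powr_0_to)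
    also have "(\<mu> k powr (1/N)) powr (N * \<beta>) = \<mu> k powr \<beta>"
      using N by (simp add: powr_powr)
    finally show "(\<integral>\<^sup>+t. ennreal (y k)
           * (indicator {0<..<\<mu> k powr (1/N)} t * ennreal (t powr (N * \<beta> - 1))) \<partial>lborel)
         = ennreal (1 / (N * \<beta>)) * ennreal (2 powr (N * (real_of_int k + 1)) * (m k powr (N / p) * \<mu> k powr \<beta>))"
      using \<beta> N by (simp add: ennreal_mult[symmetric] y_def)
  qed
  also have "\<dots> = ennreal (1 / (N * \<beta>)) * (\<integral>\<^sup>+k. ennreal (2 powr (N * (real_of_int k + 1)) * (m k powr (N / p) * \<mu> k powr \<beta>)) \<partial>count_space UNIV)"
    by (subst nn_integral_cmult) auto
  also have "\<dots> \<le> ennreal (1 / (N * \<beta>)) * (ennreal (2 * 2 powr N) * energy)"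
  proof (intro mult_left_mono sum_shift_le conjI)
    fix k
    \<comment> \<open>The exponents \<open>N / p\<close> and \<open>\<beta>\<close> add up to 1, so
      replacing \<open>m k\<close> by \<open>\<mu> k\<close> leaves a single power of
      \<open>\<mu> k\<close>.\<close>
    have "m k powr (N / p) * \<mu> k powr \<beta> \<le> \<mu> k powr (N / p) * \<mu> k powr \<beta>"
      using N p0 by (intro mult_right_mono powr_mono2 m_le_\<mu>) auto
    also have "\<dots> = \<mu> k"
      by (simp add: powr_add[symmetric] \<beta>_def)
    finally show "m k powr (N / p) * \<mu> k powr \<beta> \<le> \<mu> k" .
  qed auto
  also have "\<dots> = ennreal (1 / (N * \<beta>) * (2 * 2 powr N)) * energy"
    using \<beta> N by (simp add: mult.assoc[symmetric] ennreal_mult[symmetric])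
  finally show ?thesis .
qed

end

section \<open>Combining the two parts, with constants uniform in p\<close>

lemma segment_ball_integral_mono:
  "(\<And>x. g x \<le> h x) \<Longrightarrow> segment_ball_integral t g x \<le> segment_ball_integral t h x"
  unfolding segment_ball_integral_def ball_integral_def
  by (intro mult_left_mono nn_integral_mono) auto

lemma segment_ball_integral_add:
  assumes [measurable]: "g \<in> borel_measurable borel" "h \<in> borel_measurable borel"
  shows "segment_ball_integral t (\<lambda>x. g x + h x) x = segment_ball_integral t g x + segment_ball_integral t h x"
proof -
  have "ball_integral \<rho> (\<lambda>x. g x + h x) x = ball_integral \<rho> g x + ball_integral \<rho> h x" for \<rho>
    unfolding ball_integral_def by (subst nn_integral_add[symmetric]) (auto simp: distrib_left)
  then show ?thesis
    unfolding segment_ball_integral_def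
    by (simp add: distrib_left nn_integral_add)
qed

text \<open>Absorbs powers of the unit ball's volume whose exponents depend on \<open>p\<close> into
  one constant; the maximum with 1 makes the bound monotone in the exponent.\<close>

lemma enn_powr_le_max_one:
  assumes "0 \<le> a" "a \<le> b" "0 \<le> v"
  shows "enn_powr (ennreal v) a \<le> ennreal (max 1 v powr b)"
proof -
  have "v powr a \<le> max 1 v powr a"
    using assms by (intro powr_mono2) auto
  also have "\<dots> \<le> max 1 v powr b"
    using assms by (intro powr_mono) auto
  finally show ?thesis
    using assms by (simp add: enn_powr_ennreal ennreal_leI)
qed

context dyadic_levels
begin

text \<open>Here \<open>q\<close> is \<open>N / r\<close> for the exponent \<open>r\<close> used on
  the high part. It is tied to \<open>p0\<close> instead of \<open>p\<close>, so the constants on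
  the right are free of \<open>p\<close>; the powers of \<open>t\<close> and the two norms have the
  form integrated in \<open>high_Hardy\<close> and \<open>low_Hardy\<close>.\<close>

lemma segment_ball_integral_split_le:
  assumes dim: "N = real DIM('a)" and N2: "2 \<le> N" and p: "N < p" and pp: "p < p0" and t: "0 < t"
  defines "q \<equiv> 1 + N / (2 * p0)" and "K \<equiv> max 1 (measure lborel (ball (0::'a) 1)) powr (N + 1)"
  shows "ennreal (t powr (- (N / p) * N) / t)
      * enn_powr (\<integral>\<^sup>+x. enn_powr (segment_ball_integral t (\<lambda>x. ennreal (g x)) x) p \<partial>lborel) (N / p)
    \<le> ennreal (2 * 2 powr N * K) * (ennreal ((2 * p0 / N) powr N)
          * (ennreal (t powr (N - N * q - 1)) * enn_powr (\<integral>\<^sup>+x. enn_powr (high t x) (N / q) \<partial>lborel) q)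
        + ennreal (t powr (N * (1 - N / p) - 1)) * enn_powr (\<integral>\<^sup>+x. enn_powr (low t x) p \<partial>lborel) (N / p))"
proof -
  define r where "r = N / q"
  define v where "v = measure lborel (ball (0::'a) 1)"
  have v: "unit_ball_measure TYPE('a) = ennreal v" "0 \<le> v"
    using emeasure_lborel_ball_finite[of "0::'a" 1] by (auto simp: v_def emeasure_eq_ennreal_measure)
  define S where "S = (\<lambda>u :: 'a \<Rightarrow> ennreal. \<integral>\<^sup>+x. enn_powr (segment_ball_integral t u x) p \<partial>lborel)"
  have p0: "0 < p0" "0 < p" "1 < p" using N2 p pp by auto
  have q: "1 < q" "q < 3/2"
    using p0 N2 p pp by (auto simp: q_def field_simps)
  have r: "1 < r" using q N2 by (simp add: r_def field_simps)
  have Nr: "N / r = q" using q N2 by (simp add: r_def)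
  have "N / q \<le> N" using q N2 by (simp add: field_simps)
  then have rp: "r \<le> p" using p by (simp add: r_def)
  \<comment> \<open>The power of \<open>t\<close> in the bound from \<open>L^r\<close> to
    \<open>L^p\<close>. It equals \<open>N / p - N / (2 * p0)\<close>, and
    \<open>N / p \<ge> N / p0\<close> leaves at least half of \<open>N / p0\<close>; this is the
    reason for the factor 2 in \<open>q\<close>.\<close>
  define e where "e = 1 - q + N / p"
  have e: "N / (2 * p0) \<le> e"
  proof -
    have "N / p0 \<le> N / p" using N2 p0 pp by (intro divide_left_mono) auto
    then show ?thesis by (simp add: e_def q_def)
  qed
  have e0: "0 < e" using e p0 N2 by (meson divide_pos_pos less_le_trans mult_pos_pos zero_less_numeral)
  have Np: "0 \<le> N / p" "N / p \<le> 1" using p0 N2 p by auto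
  have split: "S (\<lambda>x. ennreal (g x)) \<le> enn_powr 2 p * (S (high t) + S (low t))"
  proof -
    have "S (\<lambda>x. ennreal (g x)) \<le> (\<integral>\<^sup>+x. enn_powr 2 p * (enn_powr (segment_ball_integral t (high t) x) p
        + enn_powr (segment_ball_integral t (low t) x) p) \<partial>lborel)"
      unfolding S_def
    proof (intro nn_integral_mono)
      fix x
      have "segment_ball_integral t (\<lambda>x. ennreal (g x)) x \<le> segment_ball_integral t (\<lambda>x. high t x + low t x) x"
        by (intro segment_ball_integral_mono le_high_low)
      then have "enn_powr (segment_ball_integral t (\<lambda>x. ennreal (g x)) x) p
        \<le> enn_powr (segment_ball_integral t (high t) x + segment_ball_integral t (low t) x) p"
        using p0 by (intro enn_powr_mono) (auto simp: segment_ball_integral_add)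
      also have "\<dots> \<le> enn_powr 2 p * (enn_powr (segment_ball_integral t (high t) x) p
        + enn_powr (segment_ball_integral t (low t) x) p)"
        using p0 by (intro enn_powr_add_le) auto
      finally show "enn_powr (segment_ball_integral t (\<lambda>x. ennreal (g x)) x) p
        \<le> enn_powr 2 p * (enn_powr (segment_ball_integral t (high t) x) p
        + enn_powr (segment_ball_integral t (low t) x) p)" .
    qed
    also have "\<dots> = enn_powr 2 p * (S (high t) + S (low t))"
      unfolding S_def by (simp add: nn_integral_cmult nn_integral_add)
    finally show ?thesis .
  qed
  have two: "enn_powr (enn_powr 2 p) (N / p) * enn_powr 2 (N / p) \<le> ennreal (2 * 2 powr N)"
  proof -
    have "2 powr (N / p) \<le> (2::real) powr 1" using Np by (intro powr_mono) auto
    then have "2 powr N * 2 powr (N / p) \<le> (2::real) powr N * 2"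
      by (intro mult_left_mono) auto
    moreover have "enn_powr 2 a = ennreal (2 powr a)" for a
      using enn_powr_ennreal[of 2 a] by simp
    ultimately show ?thesis
      using p0 by (simp add: enn_powr_powr enn_powr_ennreal powr_powr ennreal_mult[symmetric] ennreal_leI mult.commute)
  qed
  have H: "enn_powr (S (high t)) (N / p) \<le> ennreal K * (ennreal ((2 * p0 / N) powr N * t powr (e * N))
      * enn_powr (\<integral>\<^sup>+x. enn_powr (high t x) r \<partial>lborel) q)"
  proof -
    have "S (high t) \<le> enn_powr (ennreal v) (p - p / r + 1) * ennreal ((t powr e / e) powr p)
       * enn_powr (\<integral>\<^sup>+x. enn_powr (high t x) r \<partial>lborel) (p / r)"
      using segment_ball_integral_Lp_le[of "high t", OF _ r rp t] e0
      unfolding S_def v dim[symmetric] Nr e_def by simp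
    then have "enn_powr (S (high t)) (N / p) \<le> enn_powr (enn_powr (ennreal v) (p - p / r + 1) * ennreal ((t powr e / e) powr p)
       * enn_powr (\<integral>\<^sup>+x. enn_powr (high t x) r \<partial>lborel) (p / r)) (N / p)"
      using Np by (intro enn_powr_mono) auto
    also have "\<dots> = enn_powr (ennreal v) ((p - p / r + 1) * (N / p)) * ennreal ((t powr e / e) powr N)
       * enn_powr (\<integral>\<^sup>+x. enn_powr (high t x) r \<partial>lborel) q"
      using p0 Nr r by (simp add: enn_powr_mult enn_powr_powr enn_powr_ennreal powr_powr)
    also have "(p - p / r + 1) * (N / p) = N - q + N / p"
    proof -
      have "(p - p / r + 1) * (N / p) = N - N / r + N / p" using p0 r by (simp add: field_simps)
      then show ?thesis by (simp only: Nr)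
    qed
    also have "enn_powr (ennreal v) (N - q + N / p) * ennreal ((t powr e / e) powr N)
       * enn_powr (\<integral>\<^sup>+x. enn_powr (high t x) r \<partial>lborel) q
      \<le> ennreal K * ennreal ((2 * p0 / N) powr N * t powr (e * N)) * enn_powr (\<integral>\<^sup>+x. enn_powr (high t x) r \<partial>lborel) q"
    proof (intro mult_right_mono mult_mono ennreal_leI)
      show "enn_powr (ennreal v) (N - q + N / p) \<le> ennreal K"
        unfolding K_def v_def[symmetric] using q N2 Np v by (intro enn_powr_le_max_one) auto
      have "1 / e \<le> 2 * p0 / N"
        using e e0 p0 N2 by (simp add: field_simps)
      then have "(1 / e) powr N \<le> (2 * p0 / N) powr N"
        using e0 N2 by (intro powr_mono2) auto
      then have "(1 / e) powr N * t powr (e * N) \<le> (2 * p0 / N) powr N * t powr (e * N)"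
        by (intro mult_right_mono) auto
      moreover have "(t powr e / e) powr N = (1 / e) powr N * t powr (e * N)"
        using e0 by (simp add: powr_divide powr_powr)
      ultimately show "(t powr e / e) powr N \<le> (2 * p0 / N) powr N * t powr (e * N)" by simp
    qed auto
    finally show ?thesis
      by (simp add: mult.assoc)
  qed
  have L: "enn_powr (S (low t)) (N / p) \<le> ennreal K * (ennreal (t powr N)
      * enn_powr (\<integral>\<^sup>+x. enn_powr (low t x) p \<partial>lborel) (N / p))"
  proof -
    have "S (low t) \<le> enn_powr (ennreal v) p * ennreal (t powr p)
       * (\<integral>\<^sup>+x. enn_powr (low t x) p \<partial>lborel)"
      using segment_ball_integral_Lp_le[of "low t", OF _ p0(3) order_refl t] p0 t
      unfolding S_def v dim[symmetric] by simp
    then have "enn_powr (S (low t)) (N / p) \<le> enn_powr (enn_powr (ennreal v) p * ennreal (t powr p)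
       * (\<integral>\<^sup>+x. enn_powr (low t x) p \<partial>lborel)) (N / p)"
      using Np by (intro enn_powr_mono) auto
    also have "\<dots> = enn_powr (ennreal v) N * ennreal (t powr N)
       * enn_powr (\<integral>\<^sup>+x. enn_powr (low t x) p \<partial>lborel) (N / p)"
      using p0 by (simp add: enn_powr_mult enn_powr_powr enn_powr_ennreal powr_powr)
    also have "\<dots> \<le> ennreal K * ennreal (t powr N) * enn_powr (\<integral>\<^sup>+x. enn_powr (low t x) p \<partial>lborel) (N / p)"
      unfolding K_def v_def[symmetric] using N2 v by (intro mult_right_mono enn_powr_le_max_one) auto
    finally show ?thesis
      by (simp add: mult.assoc)
  qed
  have K0: "0 \<le> K" by (simp add: K_def)
  define JH where "JH = enn_powr (\<integral>\<^sup>+x. enn_powr (high t x) r \<partial>lborel) q"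
  define JL where "JL = enn_powr (\<integral>\<^sup>+x. enn_powr (low t x) p \<partial>lborel) (N / p)"
  define T where "T = ennreal (t powr (- (N / p) * N) / t)"
  have "enn_powr (S (\<lambda>x. ennreal (g x))) (N / p) \<le> enn_powr (enn_powr 2 p * (S (high t) + S (low t))) (N / p)"
    using Np by (intro enn_powr_mono split) auto
  also have "\<dots> \<le> enn_powr (enn_powr 2 p) (N / p) * (enn_powr 2 (N / p) * (enn_powr (S (high t)) (N / p) + enn_powr (S (low t)) (N / p)))"
    unfolding enn_powr_mult using Np by (intro mult_left_mono enn_powr_add_le) auto
  also have "\<dots> \<le> ennreal (2 * 2 powr N) * (enn_powr (S (high t)) (N / p) + enn_powr (S (low t)) (N / p))"
    unfolding mult.assoc[symmetric] by (intro mult_right_mono two) auto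
  also have "\<dots> \<le> ennreal (2 * 2 powr N) * (ennreal K * (ennreal ((2 * p0 / N) powr N * t powr (e * N)) * JH)
      + ennreal K * (ennreal (t powr N) * JL))"
    unfolding JH_def JL_def by (intro mult_left_mono add_mono H L) auto
  finally have "T * enn_powr (S (\<lambda>x. ennreal (g x))) (N / p)
      \<le> T * (ennreal (2 * 2 powr N) * (ennreal K * (ennreal ((2 * p0 / N) powr N * t powr (e * N)) * JH)
      + ennreal K * (ennreal (t powr N) * JL)))"
    by (intro mult_left_mono) auto
  also have "\<dots> = ennreal (2 * 2 powr N * K) * (ennreal ((2 * p0 / N) powr N) * ((T * ennreal (t powr (e * N))) * JH)
      + (T * ennreal (t powr N)) * JL)"
    using K0 by (simp add: ennreal_mult distrib_left ac_simps)
  also have "T * ennreal (t powr (e * N)) = ennreal (t powr (N - N * q - 1))"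
  proof -
    have "- (N / p) * N + e * N - 1 = N - N * q - 1" by (simp add: e_def algebra_simps)
    then have "t powr (- (N / p) * N) * t powr (e * N) / t = t powr (N - N * q - 1)"
      using t by (metis powr_add powr_diff powr_one less_imp_le)
    then show ?thesis using t by (simp add: T_def ennreal_mult[symmetric])
  qed
  also have "T * ennreal (t powr N) = ennreal (t powr (N * (1 - N / p) - 1))"
  proof -
    have "- (N / p) * N + N - 1 = N * (1 - N / p) - 1" by (simp add: algebra_simps)
    then have "t powr (- (N / p) * N) * t powr N / t = t powr (N * (1 - N / p) - 1)"
      using t by (metis powr_add powr_diff powr_one less_imp_le)
    then show ?thesis using t by (simp add: T_def ennreal_mult[symmetric])
  qed
  finally show ?thesis
    by (simp add: T_def S_def JH_def JL_def r_def)
qed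

end

lemma segment_ball_integral_Besov_bound:
  fixes p0 :: real
  assumes N2: "2 \<le> DIM('a::euclidean_space)" and p0: "real DIM('a) < p0"
  defines "N \<equiv> real DIM('a)"
  obtains C where "0 \<le> C" "\<And>p (g :: 'a \<Rightarrow> real). N < p \<Longrightarrow> p < p0 \<Longrightarrow> g \<in> borel_measurable borel \<Longrightarrow>
     (\<And>x. 0 \<le> g x) \<Longrightarrow> (\<integral>\<^sup>+x. ennreal (g x powr N) \<partial>lborel) < top \<Longrightarrow>
     (\<integral>\<^sup>+t. indicator {0<..} t * (ennreal (t powr (- (N / p) * N) / t)
        * enn_powr (\<integral>\<^sup>+x. enn_powr (segment_ball_integral t (\<lambda>x. ennreal (g x)) x) p \<partial>lborel) (N / p)) \<partial>lborel)
     \<le> ennreal (C / (1 - N / p)) * (\<integral>\<^sup>+x. ennreal (g x powr N) \<partial>lborel)"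
proof -
  define q where "q = 1 + N / (2 * p0)"
  define K where "K = max 1 (measure lborel (ball (0::'a) 1)) powr (N + 1)"
  \<comment> \<open>\<open>A\<close> collects the constants of the high part, \<open>B\<close> those
    of the low part without \<open>1 / \<beta>\<close>. Both are built from \<open>N\<close> and
    \<open>p0\<close> alone.\<close>
  define A where "A = (2 * p0 / N) powr N * (2 powr (q - 1) * (2 / (N * (q - 1))) * (2 * 2 powr N))"
  define B where "B = 1 / N * (2 * 2 powr N)"
  define C where "C = 2 * 2 powr N * K * (A + B)"
  have N2': "2 \<le> N" and dim: "N = real DIM('a)" using N2 by (simp_all add: N_def)
  have q: "1 < q" using N2' p0 by (simp add: q_def N_def)
  have pos: "0 \<le> A" "0 \<le> B" "0 \<le> K" using q N2' by (auto simp: A_def B_def K_def)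
  show ?thesis
  proof (rule that)
    show "0 \<le> C" using pos by (simp add: C_def)
    fix p and g :: "'a \<Rightarrow> real"
    assume p: "N < p" "p < p0" and g [measurable]: "g \<in> borel_measurable borel" and nn: "\<And>x. 0 \<le> g x"
      and fin: "(\<integral>\<^sup>+x. ennreal (g x powr N) \<partial>lborel) < top"
    interpret dyadic_levels g N
      using g nn fin N2' by unfold_locales auto
    define \<beta> where "\<beta> = 1 - N / p"
    have \<beta>: "0 < \<beta>" "\<beta> \<le> 1" using p N2' by (auto simp: \<beta>_def)
    define FH where "FH = (\<lambda>t. ennreal (t powr (N - N * q - 1)) * enn_powr (\<integral>\<^sup>+x. enn_powr (high t x) (N / q) \<partial>lborel) q)"
    define FL where "FL = (\<lambda>t. ennreal (t powr (N * \<beta> - 1)) * enn_powr (\<integral>\<^sup>+x. enn_powr (low t x) p \<partial>lborel) (N / p))"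
    have [measurable]: "FH \<in> borel_measurable borel" "FL \<in> borel_measurable borel"
      unfolding FH_def FL_def by measurable
    have "(\<integral>\<^sup>+t. indicator {0<..} t * (ennreal (t powr (- (N / p) * N) / t)
        * enn_powr (\<integral>\<^sup>+x. enn_powr (segment_ball_integral t (\<lambda>x. ennreal (g x)) x) p \<partial>lborel) (N / p)) \<partial>lborel)
      \<le> (\<integral>\<^sup>+t. ennreal (2 * 2 powr N * K) * (ennreal ((2 * p0 / N) powr N) * (indicator {0<..} t * FH t)
          + indicator {0<..} t * FL t) \<partial>lborel)"
    proof (intro nn_integral_mono)
      fix t :: real
      show "indicator {0<..} t * (ennreal (t powr (- (N / p) * N) / t)
        * enn_powr (\<integral>\<^sup>+x. enn_powr (segment_ball_integral t (\<lambda>x. ennreal (g x)) x) p \<partial>lborel) (N / p))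
        \<le> ennreal (2 * 2 powr N * K) * (ennreal ((2 * p0 / N) powr N) * (indicator {0<..} t * FH t)
          + indicator {0<..} t * FL t)"
        using segment_ball_integral_split_le[OF dim N2' p, of t]
        by (auto simp: FH_def FL_def q_def K_def \<beta>_def split: split_indicator)
    qed
    also have "\<dots> = ennreal (2 * 2 powr N * K) * (ennreal ((2 * p0 / N) powr N) * (\<integral>\<^sup>+t. indicator {0<..} t * FH t \<partial>lborel)
          + (\<integral>\<^sup>+t. indicator {0<..} t * FL t \<partial>lborel))"
      by (simp add: nn_integral_cmult nn_integral_add)
    also have "\<dots> \<le> ennreal (2 * 2 powr N * K) * (ennreal ((2 * p0 / N) powr N) *
        (ennreal (2 powr (q - 1) * (2 / (N * (q - 1))) * (2 * 2 powr N)) * energy)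
          + ennreal (1 / (N * \<beta>) * (2 * 2 powr N)) * energy)"
      unfolding FH_def FL_def \<beta>_def by (intro mult_left_mono add_mono high_Hardy low_Hardy q p) auto
    also have "\<dots> = ennreal (2 * 2 powr N * K * (A + B / \<beta>)) * energy"
    proof -
      have "ennreal ((2 * p0 / N) powr N) * (ennreal (2 powr (q - 1) * (2 / (N * (q - 1))) * (2 * 2 powr N)) * energy) = ennreal A * energy"
        unfolding A_def using q N2' by (subst ennreal_mult) (auto simp: mult.assoc)
      moreover have "1 / (N * \<beta>) * (2 * 2 powr N) = B / \<beta>"
        by (simp add: B_def)
      ultimately show ?thesis
        using pos \<beta> by (simp add: ennreal_mult ennreal_plus[symmetric] distrib_right[symmetric] mult.assoc del: ennreal_plus)
    qed
    also have "\<dots> \<le> ennreal (C / \<beta>) * energy"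
    proof (intro mult_right_mono ennreal_leI)
      \<comment> \<open>Since \<open>\<beta> \<le> 1\<close>, the high part may be charged with
        \<open>1 / \<beta>\<close> as well, which gives a single constant.\<close>
      have "A * 1 \<le> A * (1 / \<beta>)" using \<beta> pos by (intro mult_left_mono) (auto simp: field_simps)
      then have "A + B / \<beta> \<le> (A + B) / \<beta>" by (simp add: add_divide_distrib)
      then show "2 * 2 powr N * K * (A + B / \<beta>) \<le> C / \<beta>"
        unfolding C_def using pos by (metis mult_left_mono mult_nonneg_nonneg powr_ge_zero times_divide_eq_right zero_le_numeral)
    qed auto
    finally show "(\<integral>\<^sup>+t. indicator {0<..} t * (ennreal (t powr (- (N / p) * N) / t)
        * enn_powr (\<integral>\<^sup>+x. enn_powr (segment_ball_integral t (\<lambda>x. ennreal (g x)) x) p \<partial>lborel) (N / p)) \<partial>lborel)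
     \<le> ennreal (C / (1 - N / p)) * (\<integral>\<^sup>+x. ennreal (g x powr N) \<partial>lborel)"
      by (simp add: \<beta>_def energy_def)
  qed
qed

section \<open>A smooth compactly supported kernel\<close>

text \<open>The class generated by differentiating \<open>exp (- 1 / (s * (1 - s)))\<close>,
  extended by 0: a derivative changes only the polynomial \<open>P\<close> and the power
  \<open>m\<close>.\<close>

definition bump_family :: "real poly \<Rightarrow> nat \<Rightarrow> real \<Rightarrow> real" where
  "bump_family P m s = (if 0 < s \<and> s < 1 then poly P s / (s * (1 - s)) ^ m * exp (- 1 / (s * (1 - s))) else 0)"

text \<open>Put \<open>w = s * (1 - s)\<close>. One term of the exponential series gives
  \<open>exp (1/w) \<ge> (1/w) ^ (m + 2) / fact (m + 2)\<close>, so the exponential beats the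
  denominator with two powers of \<open>w\<close> to spare. At either endpoint this is a quadratic
  bound, which forces the derivative there to be 0.\<close>

lemma bump_family_bounds:
  obtains C where "0 \<le> C" "\<And>s. \<bar>bump_family P m s\<bar> \<le> C * s\<^sup>2"
    "\<And>s. \<bar>bump_family P m s\<bar> \<le> C * (s - 1)\<^sup>2" "\<And>s. \<bar>bump_family P m s\<bar> \<le> C"
proof -
  have "compact ((\<lambda>s. \<bar>poly P s\<bar>) ` {0..1})"
    by (intro compact_continuous_image continuous_intros) auto
  then obtain B where B: "\<And>s. s \<in> {0..1} \<Longrightarrow> \<bar>poly P s\<bar> \<le> B"
    by (metis (no_types, lifting) bounded_real compact_imp_bounded image_eqI abs_idempotent)
  have B0: "0 \<le> B" using B[of 0] by simp
  define C where "C = B * fact (m + 2)"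
  have C0: "0 \<le> C" using B0 by (simp add: C_def)
  have main: "\<bar>bump_family P m s\<bar> \<le> C * (s * (1 - s))\<^sup>2" if s: "0 < s" "s < 1" for s
  proof -
    define w where "w = s * (1 - s)"
    have w: "0 < w" using s by (simp add: w_def)
    have "(1/w) ^ (m + 2) / fact (m + 2) \<le> exp (1/w)"
    proof -
      have "(\<Sum>i\<in>{m + 2}. (1/w) ^ i /\<^sub>R fact i) \<le> (\<Sum>i. (1/w) ^ i /\<^sub>R fact i)"
        using w by (intro sum_le_suminf summable_exp_generic) auto
      then show ?thesis
        by (simp add: exp_def divide_inverse mult.commute)
    qed
    then have "1 / w ^ (m + 2) \<le> exp (1/w) * fact (m + 2)"
      by (simp only: pos_divide_le_eq[OF fact_gt_zero] power_one_over)
    then have "1 / w ^ (m + 2) * exp (- 1 / w) \<le> exp (1/w) * fact (m + 2) * exp (- 1 / w)"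
      by (intro mult_right_mono) auto
    also have "\<dots> = fact (m + 2)"
      by (simp add: exp_minus field_simps)
    finally have *: "1 / w ^ m * exp (- 1 / w) \<le> fact (m + 2) * w\<^sup>2"
      using w by (simp add: power_add field_simps power2_eq_square)
    have "\<bar>bump_family P m s\<bar> = \<bar>poly P s\<bar> * (1 / w ^ m * exp (- 1 / w))"
      using s w by (simp add: bump_family_def w_def[symmetric] abs_mult)
    also have "\<dots> \<le> B * (fact (m + 2) * w\<^sup>2)"
      using * B[of s] s w B0 by (intro mult_mono[OF _ *]) auto
    finally show ?thesis
      by (simp add: C_def w_def)
  qed
  have 1: "(s * (1 - s))\<^sup>2 \<le> s\<^sup>2" "(s * (1 - s))\<^sup>2 \<le> (s - 1)\<^sup>2" "(s * (1 - s))\<^sup>2 \<le> 1" if s: "0 < s" "s < 1" for s :: real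
  proof -
    have a: "s\<^sup>2 \<le> 1" "(1 - s)\<^sup>2 \<le> 1" using s by (auto simp: power_le_one)
    have "s\<^sup>2 * (1 - s)\<^sup>2 \<le> s\<^sup>2 * 1" "s\<^sup>2 * (1 - s)\<^sup>2 \<le> 1 * (1 - s)\<^sup>2"
      using mult_left_mono[OF a(2), of "s\<^sup>2"] mult_right_mono[OF a(1), of "(1 - s)\<^sup>2"] by auto
    then show "(s * (1 - s))\<^sup>2 \<le> s\<^sup>2" "(s * (1 - s))\<^sup>2 \<le> (s - 1)\<^sup>2" "(s * (1 - s))\<^sup>2 \<le> 1"
      using a unfolding power_mult_distrib power2_commute[of s 1] by linarith+
  qed
  show ?thesis
  proof (rule that[OF C0])
    fix s
    show "\<bar>bump_family P m s\<bar> \<le> C * s\<^sup>2" "\<bar>bump_family P m s\<bar> \<le> C * (s - 1)\<^sup>2" "\<bar>bump_family P m s\<bar> \<le> C"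
      using main[of s] mult_left_mono[OF 1(1) C0, of s] mult_left_mono[OF 1(2) C0, of s]
        mult_left_mono[OF 1(3) C0, of s] C0
      by (cases "0 < s \<and> s < 1"; force simp: bump_family_def)+
  qed
qed

lemma has_real_derivative_0_quadratic:
  fixes f :: "real \<Rightarrow> real"
  assumes "\<And>s. \<bar>f s\<bar> \<le> C * (s - a)\<^sup>2"
  shows "(f has_real_derivative 0) (at a)"
proof -
  have fa: "f a = 0" using assms[of a] by simp
  have "((\<lambda>h. (f (a + h) - f a) / h) \<longlongrightarrow> 0) (at 0)"
  proof (rule Lim_null_comparison)
    show "\<forall>\<^sub>F h in at 0. norm ((f (a + h) - f a) / h) \<le> C * \<bar>h\<bar>"
    proof (rule eventually_mono[OF eventually_neq_at_within[of 0]])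
      fix h :: real assume "h \<noteq> 0"
      have "\<bar>f (a + h)\<bar> / \<bar>h\<bar> \<le> C * \<bar>h\<bar>"
        using assms[of "a + h"] \<open>h \<noteq> 0\<close> by (simp add: pos_divide_le_eq power2_eq_square mult.assoc)
      then show "norm ((f (a + h) - f a) / h) \<le> C * \<bar>h\<bar>"
        using fa by simp
    qed
    show "((\<lambda>h. C * \<bar>h\<bar>) \<longlongrightarrow> 0) (at 0)"
      by (auto intro!: tendsto_eq_intros)
  qed
  then show ?thesis
    by (simp add: DERIV_def)
qed

text \<open>The numerator of the derivative over the common denominator \<open>w ^ (m + 2)\<close>,
  where \<open>[:0, 1, -1:]\<close> is \<open>w = s * (1 - s)\<close> and \<open>[:1, -2:]\<close>
  is the derivative of \<open>w\<close>.\<close>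

definition bump_next :: "real poly \<Rightarrow> nat \<Rightarrow> real poly" where
  "bump_next P m = pderiv P * [:0, 1, -1:]^2 - smult (real m) (P * [:1, -2:] * [:0, 1, -1:]) + P * [:1, -2:]"

lemma poly_bump_next:
  "poly (bump_next P m) s = poly (pderiv P) s * (s * (1 - s))\<^sup>2
     - real m * (poly P s * (1 - 2 * s) * (s * (1 - s))) + poly P s * (1 - 2 * s)"
proof -
  have w: "poly [:0, 1, -1:] s = s * (1 - s)" "poly [:1, -2:] s = 1 - 2 * s"
    by (simp_all add: algebra_simps)
  show ?thesis
    unfolding bump_next_def poly_add poly_diff poly_mult poly_power poly_smult w ..
qed

text \<open>The reduction to a common denominator in abstract variables, with \<open>v\<close> for
  \<open>w ^ m\<close> and \<open>E\<close> for the exponential, so that simplification meets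
  neither powers nor \<open>exp\<close>.\<close>

lemma bump_derivative_identity:
  fixes a b c v w E k :: real
  assumes "v \<noteq> 0" "w \<noteq> 0"
  shows "(a * (w * w) - k * (b * c * w) + b * c) / (v * (w * w)) * E
    = (a / v - b * (k * c) / (v * w)) * E + b / v * (E * (c / (w * w)))"
  using assms by (simp add: field_simps)

text \<open>Away from 0 and 1 this is calculus. At these two points the quadratic bounds give
  derivative 0, which is also the value of the extended formula.\<close>

lemma bump_family_deriv:
  "(bump_family P m has_real_derivative bump_family (bump_next P m) (m + 2) s) (at s)"
proof -
  obtain C where C: "\<And>s. \<bar>bump_family P m s\<bar> \<le> C * s\<^sup>2" "\<And>s. \<bar>bump_family P m s\<bar> \<le> C * (s - 1)\<^sup>2"
    using bump_family_bounds by metis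
  consider "s < 0 \<or> 1 < s" | "s = 0" | "s = 1" | "0 < s" "s < 1" by linarith
  then show ?thesis
  proof cases
    case 1
    have "((\<lambda>_. 0) has_real_derivative 0) (at s)" by simp
    moreover have "open (- {0..1::real})" "s \<in> - {0..1}" using 1 by auto
    ultimately have "(bump_family P m has_real_derivative 0) (at s)"
      by (rule has_field_derivative_transform_within_open) (auto simp: bump_family_def)
    then show ?thesis using 1 by (auto simp: bump_family_def)
  next
    case 2
    then show ?thesis
      using has_real_derivative_0_quadratic[of "bump_family P m" C 0] C(1) by (simp add: bump_family_def)
  next
    case 3
    then show ?thesis
      using has_real_derivative_0_quadratic[of "bump_family P m" C 1] C(2) by (simp add: bump_family_def)
  next
    case 4
    define w where "w = s * (1 - s)"
    have w: "w \<noteq> 0" using 4 by (simp add: w_def)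
    let ?D = "(poly (pderiv P) s / w ^ m - poly P s * (real m * (1 - 2 * s)) / w ^ (m + 1)) * exp (- 1 / w)
        + poly P s / w ^ m * (exp (- 1 / w) * ((1 - 2 * s) / w\<^sup>2))"
    have dw: "((\<lambda>s. s * (1 - s)) has_real_derivative (1 - 2 * s)) (at s)"
      by (auto intro!: derivative_eq_intros)
    have d1: "((\<lambda>s. poly P s / (s * (1 - s)) ^ m) has_real_derivative
       (poly (pderiv P) s / w ^ m - poly P s * (real m * (1 - 2 * s)) / w ^ (m + 1))) (at s)"
    proof -
      have "((\<lambda>s. poly P s / (s * (1 - s)) ^ m) has_real_derivative
        (poly (pderiv P) s * w ^ m - poly P s * (real m * ((1 - 2 * s) * w ^ (m - Suc 0)))) / (w ^ m * w ^ m)) (at s)"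
        using w unfolding w_def
        by (intro DERIV_cong[OF DERIV_divide[OF poly_DERIV DERIV_power[OF dw]]]) auto
      moreover have "(poly (pderiv P) s * w ^ m - poly P s * (real m * ((1 - 2 * s) * w ^ (m - Suc 0)))) / (w ^ m * w ^ m)
        = poly (pderiv P) s / w ^ m - poly P s * (real m * (1 - 2 * s)) / w ^ (m + 1)"
        using w by (cases m) (simp_all add: field_simps)
      ultimately show ?thesis by (rule DERIV_cong)
    qed
    have d2: "((\<lambda>s. exp (- 1 / (s * (1 - s)))) has_real_derivative exp (- 1 / w) * ((1 - 2 * s) / w\<^sup>2)) (at s)"
      using w unfolding w_def
      by (intro DERIV_fun_exp DERIV_cong[OF DERIV_divide[OF DERIV_const dw]]) (auto simp: power2_eq_square)
    have "((\<lambda>s. poly P s / (s * (1 - s)) ^ m * exp (- 1 / (s * (1 - s)))) has_real_derivative ?D) (at s)"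
      by (rule DERIV_cong[OF DERIV_mult[OF d1 d2]]) (simp add: w_def[symmetric] ac_simps)
    then have "(bump_family P m has_real_derivative ?D) (at s)"
      by (rule has_field_derivative_transform_within_open[where S = "{0<..<1}"]) (use 4 in \<open>auto simp: bump_family_def\<close>)
    moreover have "?D = bump_family (bump_next P m) (m + 2) s"
    proof -
      have "bump_family (bump_next P m) (m + 2) s = (poly (pderiv P) s * w^2 - real m * (poly P s * (1 - 2 * s) * w)
          + poly P s * (1 - 2 * s)) / w ^ (m + 2) * exp (- 1 / w)"
        unfolding w_def bump_family_def poly_bump_next using 4 by simp
      also have "\<dots> = ?D"
        unfolding power_add power_one_right power2_eq_square
        by (rule bump_derivative_identity) (use w in auto)
      finally show ?thesis ..
    qed
    ultimately show ?thesis by simp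
  qed
qed

fun bump_poly :: "nat \<Rightarrow> real poly" where
  "bump_poly 0 = 1"
| "bump_poly (Suc k) = bump_next (bump_poly k) (2 * k)"

text \<open>The \<open>k\<close>-th derivative of the bump; each differentiation adds 2 to the power
  of the denominator.\<close>

definition bump_deriv :: "nat \<Rightarrow> real \<Rightarrow> real" where
  "bump_deriv k = bump_family (bump_poly k) (2 * k)"

lemma bump_deriv_DERIV: "(bump_deriv k has_real_derivative bump_deriv (Suc k) s) (at s)"
  using bump_family_deriv[of "bump_poly k" "2 * k" s] by (simp add: bump_deriv_def)

lemma bump_deriv_outside: "s \<le> 0 \<or> 1 \<le> s \<Longrightarrow> bump_deriv k s = 0"
  by (auto simp: bump_deriv_def bump_family_def)

lemma bump_deriv_bounded: obtains C where "0 \<le> C" "\<And>s. \<bar>bump_deriv k s\<bar> \<le> C"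
proof (rule bump_family_bounds[of "bump_poly k" "2 * k"])
  fix C assume "0 \<le> C" "\<And>s. \<bar>bump_family (bump_poly k) (2 * k) s\<bar> \<le> C"
  then show thesis
    by (intro that[of C]) (simp_all add: bump_deriv_def)
qed

lemma bump_0: "bump_deriv 0 s = (if 0 < s \<and> s < 1 then exp (- 1 / (s * (1 - s))) else 0)"
  by (simp add: bump_deriv_def bump_family_def)

lemma bump_nonneg: "0 \<le> bump_deriv 0 s" and bump_le_1: "bump_deriv 0 s \<le> 1"
  by (auto simp: bump_0)

text \<open>On the middle half both factors of \<open>s * (1 - s)\<close> are at least 1/4, hence
  the 16. This feeds the lower bound on the mass of the kernel.\<close>

lemma bump_lower: "1/4 \<le> s \<Longrightarrow> s \<le> 3/4 \<Longrightarrow> exp (- 16) \<le> bump_deriv 0 s"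
proof -
  assume s: "1/4 \<le> s" "s \<le> 3/4"
  then have "(1/4) * (1/4) \<le> s * (1 - s)" by (intro mult_mono) auto
  then have "1 / (s * (1 - s)) \<le> 16" by (simp add: divide_le_eq)
  then show ?thesis using s by (simp add: bump_0)
qed

section \<open>Partial derivatives of products of one-variable functions\<close>

lemma prod_deriv_axis:
  fixes u :: "'n::finite \<Rightarrow> nat \<Rightarrow> real \<Rightarrow> real"
  assumes D: "\<And>i k s. (u i k has_real_derivative u i (Suc k) s) (at s)"
  shows "((\<lambda>t. \<Prod>j\<in>UNIV. u j (c j) ((y + t *\<^sub>R axis i 1) $ j)) has_real_derivative
     (\<Prod>j\<in>UNIV. u j ((c(i := Suc (c i))) j) (y $ j))) (at 0)"
proof -
  have split: "(\<Prod>j\<in>UNIV. F j) = F i * (\<Prod>j\<in>UNIV - {i}. F j)" for F :: "'n \<Rightarrow> real"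
    by (rule prod.remove) auto
  have "(\<lambda>t. \<Prod>j\<in>UNIV. u j (c j) ((y + t *\<^sub>R axis i 1) $ j))
     = (\<lambda>t. u i (c i) (y $ i + t) * (\<Prod>j\<in>UNIV - {i}. u j (c j) (y $ j)))"
    by (subst split) (auto simp: axis_def intro!: ext prod.cong)
  moreover have "(\<Prod>j\<in>UNIV. u j ((c(i := Suc (c i))) j) (y $ j))
      = u i (Suc (c i)) (y $ i) * (\<Prod>j\<in>UNIV - {i}. u j (c j) (y $ j))"
    by (subst split) (auto intro!: prod.cong)
  moreover have "((\<lambda>t. u i (c i) (y $ i + t)) has_real_derivative u i (Suc (c i)) (y $ i)) (at 0)"
    using D[of i "c i" "y $ i"] DERIV_shift[of "u i (c i)" "u i (Suc (c i)) (y $ i)" 0 "y $ i"] by (simp add: add.commute)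
  ultimately show ?thesis
    by (auto intro!: derivative_eq_intros)
qed

text \<open>\<open>count_list\<close> turns the list of directions into a multi-index, since
  differentiating in direction \<open>i\<close> only raises the order of the \<open>i\<close>-th
  factor. All iterated partial derivatives are thus explicit, and smoothness follows from
  one-variable facts.\<close>

lemma iter_partial_prod:
  fixes u :: "'n::finite \<Rightarrow> nat \<Rightarrow> real \<Rightarrow> real"
  assumes D: "\<And>i k s. (u i k has_real_derivative u i (Suc k) s) (at s)"
  shows "iter_partial is (\<lambda>y. \<Prod>j\<in>UNIV. u j 0 (y $ j)) = (\<lambda>y. \<Prod>j\<in>UNIV. u j (count_list is j) (y $ j))"
proof (induction "is")
  case (Cons i "is")
  have "count_list (i # is) = (count_list is)(i := Suc (count_list is i))"
    by (auto simp: fun_eq_iff)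
  then show ?case
    using DERIV_imp_deriv[OF prod_deriv_axis[where u = u, OF D, where c = "count_list is" and i = i]] Cons
    by (simp add: partial_deriv_def fun_eq_iff)
qed simp

lemma smooth_fun_prod:
  fixes u :: "'n::finite \<Rightarrow> nat \<Rightarrow> real \<Rightarrow> real"
  assumes D: "\<And>i k s. (u i k has_real_derivative u i (Suc k) s) (at s)"
  shows "smooth_fun (\<lambda>y. \<Prod>j\<in>UNIV. u j 0 (y $ j))"
  unfolding smooth_fun_def iter_partial_prod[where u = u, OF D]
proof (intro allI conjI)
  fix "is" :: "'n list" and i and x :: "real^'n"
  have "continuous_on UNIV (u j k)" for j k
    using D by (intro DERIV_continuous_on[of _ _ "u j (Suc k)"]) (auto intro: has_field_derivative_at_within)
  then have "continuous_on UNIV (\<lambda>y :: real^'n. u j k (y $ j))" for j k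
    by (rule continuous_on_compose2) (auto intro!: continuous_on_component continuous_on_id)
  then show "continuous_on UNIV (\<lambda>y. \<Prod>j\<in>UNIV. u j (count_list is j) (y $ j))"
    by (intro continuous_on_prod)
  show "(\<lambda>t. \<Prod>j\<in>UNIV. u j (count_list is j) ((x + t *\<^sub>R axis i 1) $ j)) differentiable (at 0)"
    using prod_deriv_axis[where u = u, OF D, where c = "count_list is" and i = i and y = x] real_differentiable_def by blast
qed

text \<open>Not normalised; \<open>mollified\<close> divides by the mass. The support is a cube with
  a corner, not the centre, at the origin, to match the cubes
  \<open>cbox x (x + h *\<^sub>R One)\<close> in the Lebesgue differentiation theorem behind
  \<open>mollified_tendsto\<close>.\<close>

definition kern :: "real \<Rightarrow> real^'n::finite \<Rightarrow> real" where
  "kern \<epsilon> y = (\<Prod>j\<in>UNIV. bump_deriv 0 (y $ j / \<epsilon>))"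

definition kern_deriv :: "real \<Rightarrow> 'n::finite \<Rightarrow> real^'n \<Rightarrow> real" where
  "kern_deriv \<epsilon> i y = bump_deriv 1 (y $ i / \<epsilon>) / \<epsilon> * (\<Prod>j\<in>UNIV - {i}. bump_deriv 0 (y $ j / \<epsilon>))"

lemma kern_chain:
  assumes "\<epsilon> \<noteq> 0"
  shows "((\<lambda>s. bump_deriv k ((s - a) / \<epsilon>) / \<epsilon> ^ k) has_real_derivative bump_deriv (Suc k) ((s - a) / \<epsilon>) / \<epsilon> ^ Suc k) (at s)"
proof -
  have "((\<lambda>s. bump_deriv k ((s - a) / \<epsilon>)) has_real_derivative bump_deriv (Suc k) ((s - a) / \<epsilon>) * (1 / \<epsilon>)) (at s)"
    by (rule DERIV_chain2[OF bump_deriv_DERIV]) (use assms in \<open>auto intro!: derivative_eq_intros\<close>)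
  from DERIV_cdivide[OF this, of "\<epsilon> ^ k"] show ?thesis by simp
qed

lemma kern_test_fun:
  fixes a :: "real^'n::finite"
  assumes "0 < \<epsilon>"
  shows "test_fun (\<lambda>y. kern \<epsilon> (y - a))"
proof -
  have "smooth_fun (\<lambda>y. kern \<epsilon> (y - a))"
    using smooth_fun_prod[of "\<lambda>i k s. bump_deriv k ((s - a $ i) / \<epsilon>) / \<epsilon> ^ k", OF kern_chain] assms
    by (simp add: kern_def)
  moreover have "{y. kern \<epsilon> (y - a) \<noteq> 0} \<subseteq> cbox a (a + \<epsilon> *\<^sub>R 1)"
  proof
    fix y assume "y \<in> {y. kern \<epsilon> (y - a) \<noteq> 0}"
    then have "bump_deriv 0 ((y - a) $ j / \<epsilon>) \<noteq> 0" for j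
      by (auto simp: kern_def)
    then have "0 < (y - a) $ j / \<epsilon> \<and> (y - a) $ j / \<epsilon> < 1" for j
      using bump_deriv_outside not_less by metis
    then show "y \<in> cbox a (a + \<epsilon> *\<^sub>R 1)"
      using assms by (auto simp: mem_box_cart field_simps less_imp_le)
  qed
  ultimately show ?thesis
    unfolding test_fun_def using bounded_cbox bounded_subset by blast
qed

lemma kern_partial_deriv:
  fixes a :: "real^'n::finite"
  assumes "0 < \<epsilon>"
  shows "partial_deriv i (\<lambda>y. kern \<epsilon> (y - a)) y = kern_deriv \<epsilon> i (y - a)"
proof -
  let ?u = "\<lambda>i k s. bump_deriv k ((s - a $ i) / \<epsilon>) / \<epsilon> ^ k"
  have "(\<lambda>y. kern \<epsilon> (y - a)) = (\<lambda>y. \<Prod>j\<in>UNIV. ?u j 0 (y $ j))"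
    by (simp add: kern_def)
  then have "partial_deriv i (\<lambda>y. kern \<epsilon> (y - a)) y = (\<Prod>j\<in>UNIV. ?u j (count_list [i] j) (y $ j))"
    using iter_partial_prod[of ?u "[i]", OF kern_chain] assms by (simp add: fun_eq_iff)
  also have "\<dots> = ?u i (count_list [i] i) (y $ i) * (\<Prod>j\<in>UNIV - {i}. ?u j (count_list [i] j) (y $ j))"
    by (rule prod.remove) auto
  also have "\<dots> = kern_deriv \<epsilon> i (y - a)"
    by (auto simp: kern_deriv_def intro!: prod.cong)
  finally show ?thesis .
qed

text \<open>With \<open>z = y - x\<close> this follows the kernel while its base point moves from
  \<open>x\<close> along \<open>x + s *\<^sub>R w\<close>; hence the minus signs.\<close>

lemma kern_line_deriv:
  fixes z w :: "real^'n::finite"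
  assumes "0 < \<epsilon>"
  shows "((\<lambda>s. kern \<epsilon> (z - s *\<^sub>R w)) has_real_derivative - (\<Sum>i\<in>UNIV. w $ i * kern_deriv \<epsilon> i (z - s *\<^sub>R w))) (at s)"
proof -
  have d: "((\<lambda>s. bump_deriv 0 ((z - s *\<^sub>R w) $ j / \<epsilon>)) has_derivative
      (*) (bump_deriv 1 ((z - s *\<^sub>R w) $ j / \<epsilon>) * (- (w $ j) / \<epsilon>))) (at s)" for j
  proof -
    have "((\<lambda>s. bump_deriv 0 ((z - s *\<^sub>R w) $ j / \<epsilon>)) has_real_derivative
       bump_deriv (Suc 0) ((z - s *\<^sub>R w) $ j / \<epsilon>) * (- (w $ j) / \<epsilon>)) (at s)"
      by (rule DERIV_chain2[OF bump_deriv_DERIV]) (use assms in \<open>auto intro!: derivative_eq_intros\<close>)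
    then show ?thesis
      by (simp add: has_field_derivative_def)
  qed
  show ?thesis
    unfolding kern_def has_field_derivative_def
    by (rule has_derivative_eq_rhs[OF has_derivative_prod[OF d]])
      (auto simp: fun_eq_iff kern_deriv_def sum_distrib_left sum_negf[symmetric] ac_simps intro!: sum.cong)
qed

lemma kern_nonneg: "0 \<le> kern \<epsilon> y" and kern_le_1: "kern \<epsilon> y \<le> 1"
  unfolding kern_def by (auto intro!: prod_nonneg prod_le_1 simp: bump_nonneg bump_le_1)

lemma kern_outside:
  assumes "0 < \<epsilon>" "y \<notin> cbox 0 (\<epsilon> *\<^sub>R 1)"
  shows "kern \<epsilon> y = 0" "kern_deriv \<epsilon> i y = 0"
proof -
  obtain j where "y $ j < 0 \<or> \<epsilon> < y $ j"
    using assms by (auto simp: mem_box_cart not_le)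
  then have "y $ j / \<epsilon> \<le> 0 \<or> 1 \<le> y $ j / \<epsilon>"
    using assms by (auto simp: field_simps)
  then have z: "bump_deriv k (y $ j / \<epsilon>) = 0" for k
    by (rule bump_deriv_outside)
  then show "kern \<epsilon> y = 0"
    unfolding kern_def by (auto intro!: prod_zero)
  show "kern_deriv \<epsilon> i y = 0"
    using z by (cases "i = j") (auto simp: kern_deriv_def intro!: prod_zero)
qed

lemma bump_deriv_continuous: "continuous_on S (bump_deriv k)"
  using bump_deriv_DERIV by (intro DERIV_continuous_on[of _ _ "bump_deriv (Suc k)"]) (auto intro: has_field_derivative_at_within)

lemma bump_deriv_comp_continuous: "continuous_on UNIV (\<lambda>y :: real^'n::finite. bump_deriv k (y $ j / \<epsilon>))"
  unfolding divide_inverse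
  by (rule continuous_on_compose2[OF bump_deriv_continuous[of UNIV]]) (auto intro!: continuous_on_mult continuous_on_component continuous_on_id continuous_on_const)

lemma kern_continuous: "continuous_on UNIV (kern \<epsilon> :: real^'n::finite \<Rightarrow> real)"
  and kern_deriv_continuous: "continuous_on UNIV (kern_deriv \<epsilon> i :: real^'n \<Rightarrow> real)"
  unfolding kern_def kern_deriv_def divide_inverse[of "bump_deriv 1 _"]
  by (intro continuous_on_mult continuous_on_prod bump_deriv_comp_continuous continuous_on_const)+

lemma kern_deriv_bounded:
  assumes "0 < \<epsilon>"
  obtains C where "0 \<le> C" "\<And>y :: real^'n::finite. \<bar>kern_deriv \<epsilon> i y\<bar> \<le> C"
proof -
  obtain C where C: "0 \<le> C" "\<And>s. \<bar>bump_deriv 1 s\<bar> \<le> C"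
    using bump_deriv_bounded by metis
  have "\<bar>kern_deriv \<epsilon> i y\<bar> \<le> C / \<epsilon> * 1" for y :: "real^'n"
    unfolding kern_deriv_def abs_mult
  proof (intro mult_mono)
    show "\<bar>\<Prod>j\<in>UNIV - {i}. bump_deriv 0 (y $ j / \<epsilon>)\<bar> \<le> 1"
      unfolding abs_prod by (intro prod_le_1) (auto simp: bump_nonneg bump_le_1)
  qed (use assms C in \<open>auto simp: divide_right_mono\<close>)
  then show ?thesis using that[of "C / \<epsilon> * 1"] C assms by simp
qed

section \<open>Weakly differentiable functions\<close>

lemma kern_measurable [measurable]: "(kern \<epsilon> :: real^'n::finite \<Rightarrow> real) \<in> borel_measurable borel"
  and kern_deriv_measurable [measurable]: "(kern_deriv \<epsilon> i :: real^'n \<Rightarrow> real) \<in> borel_measurable borel"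
  by (rule borel_measurable_continuous_onI[OF kern_continuous] borel_measurable_continuous_onI[OF kern_deriv_continuous])+

lemma vec_nth_measurable [measurable (raw)]:
  fixes F :: "'a \<Rightarrow> real^'n::finite"
  assumes "F \<in> borel_measurable M"
  shows "(\<lambda>x. F x $ i) \<in> borel_measurable M"
  by (rule measurable_compose[OF assms borel_measurable_continuous_onI]) (intro continuous_intros)

lemma kern_support:
  fixes a :: "real^'n::finite"
  assumes "0 < \<epsilon>" "y \<notin> cbox a (a + \<epsilon> *\<^sub>R 1)"
  shows "kern \<epsilon> (y - a) = 0" "kern_deriv \<epsilon> i (y - a) = 0"
proof -
  have "y - a \<notin> cbox 0 (\<epsilon> *\<^sub>R 1)"
    using assms(2) by (auto simp: mem_box_cart algebra_simps)
  then show "kern \<epsilon> (y - a) = 0" "kern_deriv \<epsilon> i (y - a) = 0"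
    using kern_outside assms(1) by blast+
qed

lemma integrable_times_kern:
  fixes u :: "real^'n::finite \<Rightarrow> real"
  assumes [measurable]: "u \<in> borel_measurable borel" and eps: "0 < \<epsilon>"
    and u: "\<And>K. compact K \<Longrightarrow> integrable lborel (\<lambda>x. indicator K x * u x)"
  shows "integrable lborel (\<lambda>y. u y * kern \<epsilon> (y - a))"
    and "integrable lborel (\<lambda>y. u y * kern_deriv \<epsilon> i (y - a))"
proof -
  let ?K = "cbox a (a + \<epsilon> *\<^sub>R 1)"
  have int: "integrable lborel (\<lambda>y. indicator ?K y * u y)"
    by (rule u) simp
  show "integrable lborel (\<lambda>y. u y * kern \<epsilon> (y - a))"
  proof (rule Bochner_Integration.integrable_bound[OF int])
    show "AE y in lborel. norm (u y * kern \<epsilon> (y - a)) \<le> norm (indicator ?K y * u y)"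
    proof (rule AE_I2)
      fix y
      show "norm (u y * kern \<epsilon> (y - a)) \<le> norm (indicator ?K y * u y)"
        using kern_support(1)[OF eps, of y a] kern_nonneg[of \<epsilon> "y - a"] mult_left_mono[OF kern_le_1[of \<epsilon> "y - a"], of "\<bar>u y\<bar>"]
        by (cases "y \<in> ?K") (auto simp: abs_mult)
    qed
  qed measurable
  obtain C where C: "0 \<le> C" "\<And>y :: real^'n. \<bar>kern_deriv \<epsilon> i y\<bar> \<le> C"
    using kern_deriv_bounded[OF eps] by metis
  show "integrable lborel (\<lambda>y. u y * kern_deriv \<epsilon> i (y - a))"
  proof (rule Bochner_Integration.integrable_bound[OF integrable_mult_right[OF int, of C]])
    show "AE y in lborel. norm (u y * kern_deriv \<epsilon> i (y - a)) \<le> norm (C * (indicator ?K y * u y))"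
    proof (rule AE_I2)
      fix y
      show "norm (u y * kern_deriv \<epsilon> i (y - a)) \<le> norm (C * (indicator ?K y * u y))"
        using kern_support(2)[OF eps, of y a] C(1) mult_right_mono[OF C(2)[of "y - a"], of "\<bar>u y\<bar>"]
        by (cases "y \<in> ?K") (auto simp: abs_mult mult.commute)
    qed
  qed measurable
qed

text \<open>A Borel version of the hypotheses, so that Fubini on products of \<open>lborel\<close>
  applies, with the weak gradient tested against translates of \<open>kern\<close> only.
  \<open>in_Wdot1n_Borel_representative\<close> produces such a pair.\<close>

locale weakly_differentiable =
  fixes f :: "real^'n::finite \<Rightarrow> real" and G :: "real^'n \<Rightarrow> real^'n"
  assumes f [measurable]: "f \<in> borel_measurable borel" and G [measurable]: "G \<in> borel_measurable borel"
    and f_loc: "\<And>K. compact K \<Longrightarrow> integrable lborel (\<lambda>x. indicator K x * f x)"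
    and G_loc: "\<And>K i. compact K \<Longrightarrow> integrable lborel (\<lambda>x. indicator K x * G x $ i)"
    and weak: "\<And>\<epsilon> a i. 0 < \<epsilon> \<Longrightarrow>
      (\<integral>y. f y * kern_deriv \<epsilon> i (y - a) \<partial>lborel) = - (\<integral>y. G y $ i * kern \<epsilon> (y - a) \<partial>lborel)"
begin

text \<open>The fundamental theorem of calculus is applied to the smooth kernel instead of
  \<open>f\<close>. Its derivative along the segment is a combination of the
  \<open>kern_deriv\<close>; once the integrals are exchanged, \<open>weak\<close> replaces, for
  each \<open>s\<close>, the derivative of the kernel by the gradient \<open>G\<close>.\<close>

lemma kern_average_increment:
  assumes eps: "0 < \<epsilon>"
  shows "ennreal \<bar>(\<integral>y. f y * kern \<epsilon> (y - (x + w)) \<partial>lborel) - (\<integral>y. f y * kern \<epsilon> (y - x) \<partial>lborel)\<bar>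
    \<le> ennreal (norm w) * (\<integral>\<^sup>+s. indicator {0<..<1} s *
         (\<integral>\<^sup>+y. ennreal (norm (G y)) * ennreal (kern \<epsilon> (y - (x + s *\<^sub>R w))) \<partial>lborel) \<partial>lborel)"
proof -
  define H where "H = (\<lambda>y s. - (\<Sum>i\<in>UNIV. w $ i * kern_deriv \<epsilon> i (y - (x + s *\<^sub>R w))))"
  have H_meas [measurable]: "(\<lambda>z. H (fst z) (snd z)) \<in> borel_measurable (borel \<Otimes>\<^sub>M borel)"
    unfolding H_def by measurable
  have FTC: "(\<integral>s. H y s * indicator {0..1} s \<partial>lborel) = kern \<epsilon> (y - (x + w)) - kern \<epsilon> (y - x)" for y
  proof -
    have d: "((\<lambda>s. kern \<epsilon> (y - (x + s *\<^sub>R w))) has_real_derivative H y s) (at s)" for s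
      using kern_line_deriv[OF eps, of "y - x" w s] by (simp add: H_def algebra_simps)
    have c: "isCont (H y) s" for s
    proof -
      have "continuous_on UNIV (H y)"
        unfolding H_def
        by (intro continuous_intros continuous_on_compose2[OF kern_deriv_continuous]) auto
      then show ?thesis
        by (simp add: continuous_on_eq_continuous_at)
    qed
    show ?thesis
      using integral_FTC_Icc_real[of 0 1 "\<lambda>s. kern \<epsilon> (y - (x + s *\<^sub>R w))" "H y"] d c by simp
  qed
  obtain B where B: "0 \<le> B" "\<And>y s. \<bar>H y s\<bar> \<le> B"
  proof -
    have "\<forall>i. \<exists>C. \<forall>y :: real^'n. \<bar>kern_deriv \<epsilon> i y\<bar> \<le> C"
      using kern_deriv_bounded[OF eps] by metis
    then obtain C where C: "\<And>i (y :: real^'n). \<bar>kern_deriv \<epsilon> i y\<bar> \<le> C i" by metis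
    have "\<bar>H y s\<bar> \<le> (\<Sum>i\<in>UNIV. \<bar>w $ i\<bar> * C i)" for y s
      unfolding H_def abs_minus_cancel
      by (rule order_trans[OF sum_abs]) (auto simp: abs_mult intro!: sum_mono mult_left_mono C)
    then show ?thesis using that[of "\<Sum>i\<in>UNIV. \<bar>w $ i\<bar> * C i"] by (meson abs_ge_zero order_trans)
  qed
  obtain R where R: "\<And>y s. s \<in> {0..1} \<Longrightarrow> y \<notin> cball x R \<Longrightarrow> H y s = 0"
  proof -
    have "bounded (cbox 0 (\<epsilon> *\<^sub>R 1) :: (real^'n) set)" by simp
    then obtain r where r: "\<And>z :: real^'n. z \<in> cbox 0 (\<epsilon> *\<^sub>R 1) \<Longrightarrow> norm z \<le> r"
      by (meson bounded_iff)
    show ?thesis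
    proof (rule that[of "r + norm w"])
      fix y and s :: real assume s: "s \<in> {0..1}" and y: "y \<notin> cball x (r + norm w)"
      have "r + norm w < norm (y - x)"
        using y by (simp add: dist_norm norm_minus_commute)
      also have "\<dots> \<le> norm (y - (x + s *\<^sub>R w)) + norm (s *\<^sub>R w)"
        using norm_triangle_ineq[of "y - (x + s *\<^sub>R w)" "s *\<^sub>R w"] by (simp add: algebra_simps)
      also have "norm (s *\<^sub>R w) \<le> norm w"
        using s by (simp add: mult_left_le_one_le)
      finally have "y - (x + s *\<^sub>R w) \<notin> cbox 0 (\<epsilon> *\<^sub>R 1)"
        using r[of "y - (x + s *\<^sub>R w)"] by auto
      then show "H y s = 0"
        unfolding H_def kern_outside(2)[OF eps \<open>y - (x + s *\<^sub>R w) \<notin> cbox 0 (\<epsilon> *\<^sub>R 1)\<close>] by simp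
    qed
  qed
  \<comment> \<open>Absolute integrability for Fubini: \<open>H\<close> is bounded and, for
    \<open>s\<close> in the unit interval, supported in one fixed ball, on which \<open>f\<close> is
    integrable.\<close>
  have int: "integrable (lborel \<Otimes>\<^sub>M lborel) (\<lambda>(y, s). f y * (H y s * indicator {0..1} s))"
  proof (rule Bochner_Integration.integrable_bound)
    let ?a = "\<lambda>y. B * (indicator (cball x R) y * \<bar>f y\<bar>)"
    have a: "integrable lborel (\<lambda>y. ?a y)"
      using integrable_abs[OF f_loc[of "cball x R"]] by (simp add: abs_mult)
    show "integrable (lborel \<Otimes>\<^sub>M lborel) (\<lambda>(y, s :: real). ?a y * indicator {0..1} s)"
    proof (rule lborel_pair.Fubini_integrable)
      have [measurable]: "cball x R \<in> sets borel" by simp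
      show "(\<lambda>(y, s :: real). ?a y * indicator {0..1} s) \<in> borel_measurable (lborel \<Otimes>\<^sub>M lborel)"
        by measurable
      show "integrable lborel (\<lambda>y. \<integral>s. norm (case (y, s) of (y, s) \<Rightarrow> ?a y * indicator {0..1::real} s) \<partial>lborel)"
        using a B by (simp add: abs_mult)
    qed (auto intro!: AE_I2 integrable_real_indicator integrable_mult_right)
    show "AE z in lborel \<Otimes>\<^sub>M lborel. norm (case z of (y, s) \<Rightarrow> f y * (H y s * indicator {0..1} s))
       \<le> norm (case z of (y, s) \<Rightarrow> ?a y * indicator {0..1} s)"
    proof (rule AE_I2, clarify)
      fix y :: "real^'n" and s :: real
      have "\<bar>f y\<bar> * \<bar>H y s\<bar> \<le> B * \<bar>f y\<bar>"
        using mult_left_mono[OF B(2)[of y s], of "\<bar>f y\<bar>"] by (simp add: mult.commute)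
      then show "norm (f y * (H y s * indicator {0..1} s)) \<le> norm (?a y * indicator {0..1} s)"
        using R[of s y] B(1) by (cases "y \<in> cball x R"; cases "s \<in> {0..1}") (auto simp: abs_mult simp del: mem_cball)
    qed
  qed measurable
  have inner: "(\<integral>y. f y * (H y s * indicator {0..1} s) \<partial>lborel)
      = indicator {0..1} s * (\<integral>y. (w \<bullet> G y) * kern \<epsilon> (y - (x + s *\<^sub>R w)) \<partial>lborel)" for s
  proof -
    let ?k = "\<lambda>y. kern \<epsilon> (y - (x + s *\<^sub>R w))"
    have i1: "integrable lborel (\<lambda>y. f y * kern_deriv \<epsilon> i (y - (x + s *\<^sub>R w)))" for i
      by (intro integrable_times_kern f f_loc eps)
    have i2: "integrable lborel (\<lambda>y. G y $ i * ?k y)" for i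
      by (intro integrable_times_kern eps G_loc) measurable
    have "(\<integral>y. f y * (H y s * indicator {0..1} s) \<partial>lborel)
      = (\<integral>y. indicator {0..1} s * (\<Sum>i\<in>UNIV. - (w $ i) * (f y * kern_deriv \<epsilon> i (y - (x + s *\<^sub>R w)))) \<partial>lborel)"
      by (intro Bochner_Integration.integral_cong refl)
        (simp add: H_def sum_distrib_left sum_distrib_right sum_negf ac_simps)
    also have "\<dots> = indicator {0..1} s * (\<Sum>i\<in>UNIV. - (w $ i) * (\<integral>y. f y * kern_deriv \<epsilon> i (y - (x + s *\<^sub>R w)) \<partial>lborel))"
      using i1 by (subst integral_mult_right_zero, subst Bochner_Integration.integral_sum) auto
    also have "\<dots> = indicator {0..1} s * (\<Sum>i\<in>UNIV. w $ i * (\<integral>y. G y $ i * ?k y \<partial>lborel))"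
      by (simp add: weak[OF eps])
    also have "(\<Sum>i\<in>UNIV. w $ i * (\<integral>y. G y $ i * ?k y \<partial>lborel)) = (\<integral>y. (\<Sum>i\<in>UNIV. w $ i * (G y $ i * ?k y)) \<partial>lborel)"
      using i2 by (subst Bochner_Integration.integral_sum) auto
    also have "\<dots> = (\<integral>y. (w \<bullet> G y) * ?k y \<partial>lborel)"
      by (simp add: inner_vec_def sum_distrib_right mult.assoc)
    finally show ?thesis .
  qed
  have "(\<integral>y. f y * kern \<epsilon> (y - (x + w)) \<partial>lborel) - (\<integral>y. f y * kern \<epsilon> (y - x) \<partial>lborel)
     = (\<integral>y. f y * (kern \<epsilon> (y - (x + w)) - kern \<epsilon> (y - x)) \<partial>lborel)"
    using integrable_times_kern(1)[OF f eps f_loc] by (simp add: right_diff_distrib)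
  also have "\<dots> = (\<integral>y. (\<integral>s. f y * (H y s * indicator {0..1} s) \<partial>lborel) \<partial>lborel)"
    by (simp add: FTC)
  also have "\<dots> = (\<integral>s. (\<integral>y. f y * (H y s * indicator {0..1} s) \<partial>lborel) \<partial>lborel)"
    using lborel_pair.Fubini_integral[OF int] by simp
  finally have eq: "(\<integral>y. f y * kern \<epsilon> (y - (x + w)) \<partial>lborel) - (\<integral>y. f y * kern \<epsilon> (y - x) \<partial>lborel)
     = (\<integral>s. indicator {0..1} s * (\<integral>y. (w \<bullet> G y) * kern \<epsilon> (y - (x + s *\<^sub>R w)) \<partial>lborel) \<partial>lborel)"
    by (simp add: inner)
  \<comment> \<open>Holds for every \<open>u\<close>, since a function that is not integrable has
    integral 0 by default.\<close>
  have bound: "ennreal \<bar>\<integral>x. u x \<partial>M\<bar> \<le> (\<integral>\<^sup>+x. ennreal \<bar>u x\<bar> \<partial>M)" for u :: "'b \<Rightarrow> real" and M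
    using integral_norm_bound_ennreal[of M u] by (cases "integrable M u") (auto simp: not_integrable_integral_eq)
  have "ennreal \<bar>(\<integral>y. f y * kern \<epsilon> (y - (x + w)) \<partial>lborel) - (\<integral>y. f y * kern \<epsilon> (y - x) \<partial>lborel)\<bar>
    \<le> (\<integral>\<^sup>+s. ennreal \<bar>indicator {0..1} s * (\<integral>y. (w \<bullet> G y) * kern \<epsilon> (y - (x + s *\<^sub>R w)) \<partial>lborel)\<bar> \<partial>lborel)"
    unfolding eq by (rule bound)
  also have "\<dots> \<le> (\<integral>\<^sup>+s. ennreal (norm w) * (indicator {0<..<1} s *
         (\<integral>\<^sup>+y. ennreal (norm (G y)) * ennreal (kern \<epsilon> (y - (x + s *\<^sub>R w))) \<partial>lborel)) \<partial>lborel)"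
  proof (rule nn_integral_mono_AE)
    have "AE s in lborel. s \<noteq> 0 \<and> s \<noteq> (1::real)"
      using AE_lborel_singleton[of "0::real"] AE_lborel_singleton[of "1::real"] by eventually_elim auto
    then show "AE s in lborel. ennreal \<bar>indicator {0..1} s * (\<integral>y. (w \<bullet> G y) * kern \<epsilon> (y - (x + s *\<^sub>R w)) \<partial>lborel)\<bar>
      \<le> ennreal (norm w) * (indicator {0<..<1} s *
         (\<integral>\<^sup>+y. ennreal (norm (G y)) * ennreal (kern \<epsilon> (y - (x + s *\<^sub>R w))) \<partial>lborel))"
    proof eventually_elim
      case (elim s)
      let ?k = "\<lambda>y. kern \<epsilon> (y - (x + s *\<^sub>R w))"
      have "ennreal \<bar>\<integral>y. (w \<bullet> G y) * ?k y \<partial>lborel\<bar> \<le> (\<integral>\<^sup>+y. ennreal \<bar>(w \<bullet> G y) * ?k y\<bar> \<partial>lborel)"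
        by (rule bound)
      also have "\<dots> \<le> (\<integral>\<^sup>+y. ennreal (norm w) * (ennreal (norm (G y)) * ennreal (?k y)) \<partial>lborel)"
      proof (rule nn_integral_mono)
        fix y
        have "\<bar>w \<bullet> G y\<bar> * ?k y \<le> (norm w * norm (G y)) * ?k y"
          by (intro mult_right_mono Cauchy_Schwarz_ineq2 kern_nonneg)
        then show "ennreal \<bar>(w \<bullet> G y) * ?k y\<bar> \<le> ennreal (norm w) * (ennreal (norm (G y)) * ennreal (?k y))"
          by (simp add: abs_mult kern_nonneg ennreal_mult[symmetric] ennreal_leI mult.assoc)
      qed
      also have "\<dots> = ennreal (norm w) * (\<integral>\<^sup>+y. ennreal (norm (G y)) * ennreal (?k y) \<partial>lborel)"
        by (rule nn_integral_cmult) measurable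
      finally show ?case
        using elim by (auto split: split_indicator)
    qed
  qed
  also have "\<dots> = ennreal (norm w) * (\<integral>\<^sup>+s. indicator {0<..<1} s *
         (\<integral>\<^sup>+y. ennreal (norm (G y)) * ennreal (kern \<epsilon> (y - (x + s *\<^sub>R w))) \<partial>lborel) \<partial>lborel)"
    by (rule nn_integral_cmult) measurable
  finally show ?thesis .
qed

end

section \<open>Increments of mollified functions\<close>

text \<open>Substituting \<open>y = x + t w\<close> and exchanging the integrals over
  \<open>s\<close> and \<open>w\<close> turns the line integrals of the hypothesis into averages
  over concentric balls of radius \<open>s t\<close>. The length \<open>norm (t *\<^sub>R w)\<close>
  of a segment is estimated by \<open>t\<close>.\<close>

lemma nn_integral_ball_increment_le:
  fixes U :: "'a::euclidean_space \<Rightarrow> real" and g :: "'a \<Rightarrow> ennreal"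
  assumes [measurable]: "U \<in> borel_measurable borel" "g \<in> borel_measurable borel"
    and incr: "\<And>x w. ennreal \<bar>U (x + w) - U x\<bar> \<le> ennreal (norm w) * (\<integral>\<^sup>+s. indicator {0<..<1} s * g (x + s *\<^sub>R w) \<partial>lborel)"
    and t: "0 < t"
  shows "(\<integral>\<^sup>+y. indicator (ball x t) y * ennreal \<bar>U y - U x\<bar> \<partial>lborel) \<le> ennreal (t ^ DIM('a)) * segment_ball_integral t g x"
proof -
  have "(\<integral>\<^sup>+y. indicator (ball x t) y * ennreal \<bar>U y - U x\<bar> \<partial>lborel)
     = ennreal (t ^ DIM('a)) * (\<integral>\<^sup>+w. indicator (ball x t) (x + t *\<^sub>R w) * ennreal \<bar>U (x + t *\<^sub>R w) - U x\<bar> \<partial>lborel)"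
    by (rule nn_integral_lborel_affine) (use t in \<open>auto\<close>)
  also have "\<dots> \<le> ennreal (t ^ DIM('a)) * (\<integral>\<^sup>+w. ennreal t * (\<integral>\<^sup>+s. indicator {0<..<1} s * (indicator (ball 0 1) w * g (x + (s * t) *\<^sub>R w)) \<partial>lborel) \<partial>lborel)"
  proof (intro mult_left_mono nn_integral_mono)
    fix w :: 'a
    show "indicator (ball x t) (x + t *\<^sub>R w) * ennreal \<bar>U (x + t *\<^sub>R w) - U x\<bar>
       \<le> ennreal t * (\<integral>\<^sup>+s. indicator {0<..<1} s * (indicator (ball 0 1) w * g (x + (s * t) *\<^sub>R w)) \<partial>lborel)"
    proof (cases "norm w < 1")
      case True
      have "ennreal \<bar>U (x + t *\<^sub>R w) - U x\<bar> \<le> ennreal (norm (t *\<^sub>R w)) * (\<integral>\<^sup>+s. indicator {0<..<1} s * g (x + s *\<^sub>R t *\<^sub>R w) \<partial>lborel)"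
        by (rule incr)
      also have "\<dots> \<le> ennreal t * (\<integral>\<^sup>+s. indicator {0<..<1} s * g (x + s *\<^sub>R t *\<^sub>R w) \<partial>lborel)"
        using True t by (intro mult_right_mono ennreal_leI) (auto simp: mult_left_le)
      finally show ?thesis
        using True t by (simp add: dist_norm)
    next
      case False
      then have "x + t *\<^sub>R w \<notin> ball x t"
        using t by (simp add: dist_norm)
      then show ?thesis by simp
    qed
  qed auto
  also have "(\<integral>\<^sup>+w. ennreal t * (\<integral>\<^sup>+s. indicator {0<..<1} s * (indicator (ball 0 1) w * g (x + (s * t) *\<^sub>R w)) \<partial>lborel) \<partial>lborel)
     = ennreal t * (\<integral>\<^sup>+w. (\<integral>\<^sup>+s. indicator {0<..<1} s * (indicator (ball 0 1) w * g (x + (s * t) *\<^sub>R w)) \<partial>lborel) \<partial>lborel)"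
    by (rule nn_integral_cmult) measurable
  also have "(\<integral>\<^sup>+w. (\<integral>\<^sup>+s. indicator {0<..<1} s * (indicator (ball 0 1) w * g (x + (s * t) *\<^sub>R w)) \<partial>lborel) \<partial>lborel)
      = (\<integral>\<^sup>+s. (\<integral>\<^sup>+w. indicator {0<..<1} s * (indicator (ball 0 1) w * g (x + (s * t) *\<^sub>R w)) \<partial>lborel) \<partial>lborel)"
    by (rule lborel_pair.Fubini') measurable
  also have "ennreal t * \<dots> = segment_ball_integral t g x"
    unfolding segment_ball_integral_def ball_integral_def
    by (subst nn_integral_cmult) auto
  finally show ?thesis .
qed

text \<open>Both points are compared with all points of the ball around their midpoint.\<close>

lemma increment_le_segment_ball_integral:
  fixes U :: "'a::euclidean_space \<Rightarrow> real" and g :: "'a \<Rightarrow> ennreal"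
  assumes U [measurable]: "U \<in> borel_measurable borel" and g [measurable]: "g \<in> borel_measurable borel"
    and incr: "\<And>x w. ennreal \<bar>U (x + w) - U x\<bar> \<le> ennreal (norm w) * (\<integral>\<^sup>+s. indicator {0<..<1} s * g (x + s *\<^sub>R w) \<partial>lborel)"
    and h: "norm h < t"
  shows "ennreal \<bar>U (x + h) - U x\<bar> \<le> ennreal (2 ^ DIM('a) / unit_ball_vol (real DIM('a)))
      * (segment_ball_integral t g x + segment_ball_integral t g (x + h))"
proof -
  \<comment> \<open>Since \<open>norm h < t\<close>, this ball lies in the balls of radius
    \<open>t\<close> about both points, so both one-point estimates may be restricted to it.\<close>
  let ?B = "ball (x + (1/2) *\<^sub>R h) (t / 2)"
  define v where "v = unit_ball_vol (real DIM('a))"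
  have v: "0 < v" by (simp add: v_def)
  have t: "0 < t" using h norm_ge_zero[of h] by linarith
  define S where "S = segment_ball_integral t g x + segment_ball_integral t g (x + h)"
  have B1: "?B \<subseteq> ball x t"
  proof (rule subsetI)
    fix y assume "y \<in> ?B"
    moreover have "dist x (x + (1/2) *\<^sub>R h) = norm h / 2" by (simp add: dist_norm)
    ultimately show "y \<in> ball x t"
      using h dist_triangle[of x y "x + (1/2) *\<^sub>R h"] by simp
  qed
  have B2: "?B \<subseteq> ball (x + h) t"
  proof (rule subsetI)
    fix y assume "y \<in> ?B"
    moreover have "dist (x + h) (x + (1/2) *\<^sub>R h) = norm h / 2"
    proof -
      have "(x + h) - (x + (1/2) *\<^sub>R h) = (1/2) *\<^sub>R h" by (simp add: algebra_simps flip: scaleR_left_distrib)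
      then show ?thesis by (simp add: dist_norm)
    qed
    ultimately show "y \<in> ball (x + h) t"
      using h dist_triangle[of "x + h" y "x + (1/2) *\<^sub>R h"] by simp
  qed
  have "ennreal \<bar>U (x + h) - U x\<bar> * emeasure lborel ?B = (\<integral>\<^sup>+y. ennreal \<bar>U (x + h) - U x\<bar> * indicator ?B y \<partial>lborel)"
    by (subst nn_integral_cmult_indicator) auto
  also have "\<dots> \<le> (\<integral>\<^sup>+y. indicator (ball x t) y * ennreal \<bar>U y - U x\<bar> + indicator (ball (x + h) t) y * ennreal \<bar>U y - U (x + h)\<bar> \<partial>lborel)"
  proof (intro nn_integral_mono)
    fix y
    have "ennreal \<bar>U (x + h) - U x\<bar> \<le> ennreal (\<bar>U y - U x\<bar> + \<bar>U y - U (x + h)\<bar>)"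
      by (intro ennreal_leI) linarith
    then show "ennreal \<bar>U (x + h) - U x\<bar> * indicator ?B y
       \<le> indicator (ball x t) y * ennreal \<bar>U y - U x\<bar> + indicator (ball (x + h) t) y * ennreal \<bar>U y - U (x + h)\<bar>"
      using subsetD[OF B1, of y] subsetD[OF B2, of y] by (cases "y \<in> ?B") (auto simp del: mem_ball)
  qed
  also have "\<dots> = (\<integral>\<^sup>+y. indicator (ball x t) y * ennreal \<bar>U y - U x\<bar> \<partial>lborel)
      + (\<integral>\<^sup>+y. indicator (ball (x + h) t) y * ennreal \<bar>U y - U (x + h)\<bar> \<partial>lborel)"
    by (rule nn_integral_add) measurable
  also have "\<dots> \<le> ennreal (t ^ DIM('a)) * segment_ball_integral t g x + ennreal (t ^ DIM('a)) * segment_ball_integral t g (x + h)"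
    by (intro add_mono nn_integral_ball_increment_le U g incr t)
  also have "\<dots> = ennreal (t ^ DIM('a)) * S"
    by (simp add: S_def distrib_left)
  finally have *: "ennreal \<bar>U (x + h) - U x\<bar> * emeasure lborel ?B \<le> ennreal (t ^ DIM('a)) * S" .
  have vol: "emeasure lborel ?B = ennreal (v * (t / 2) ^ DIM('a))"
    using t by (simp add: v_def emeasure_ball)
  \<comment> \<open>The volume of \<open>?B\<close>. Dividing \<open>t ^ DIM('a)\<close> by it
    removes \<open>t\<close>; the radius \<open>t / 2\<close> accounts for the factor
    \<open>2 ^ DIM('a)\<close>.\<close>
  define c where "c = v * (t / 2) ^ DIM('a)"
  have c: "0 < c" using v t by (simp add: c_def)
  have "ennreal \<bar>U (x + h) - U x\<bar> = ennreal (1 / c) * (ennreal \<bar>U (x + h) - U x\<bar> * ennreal c)"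
    using c by (simp add: ennreal_mult[symmetric])
  also have "\<dots> \<le> ennreal (1 / c) * (ennreal (t ^ DIM('a)) * S)"
    using * unfolding vol c_def[symmetric] by (intro mult_left_mono) auto
  also have "\<dots> = ennreal (1 / c * t ^ DIM('a)) * S"
    using c t by (subst ennreal_mult) (auto simp: mult.assoc)
  also have "1 / c * t ^ DIM('a) = 2 ^ DIM('a) / v"
    using t v by (simp add: c_def power_divide)
  finally show ?thesis
    by (simp add: S_def v_def)
qed

lemma increment_Lp_le:
  fixes U :: "'a::euclidean_space \<Rightarrow> real" and g :: "'a \<Rightarrow> ennreal"
  assumes U [measurable]: "U \<in> borel_measurable borel" and g [measurable]: "g \<in> borel_measurable borel"
    and incr: "\<And>x w. ennreal \<bar>U (x + w) - U x\<bar> \<le> ennreal (norm w) * (\<integral>\<^sup>+s. indicator {0<..<1} s * g (x + s *\<^sub>R w) \<partial>lborel)"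
    and h: "norm h < t" and p: "0 < p"
  shows "(\<integral>\<^sup>+x. ennreal (\<bar>U (x + h) - U x\<bar> powr p) \<partial>lborel)
    \<le> ennreal (2 * (2 * 2 ^ DIM('a) / unit_ball_vol (real DIM('a))) powr p)
        * (\<integral>\<^sup>+x. enn_powr (segment_ball_integral t g x) p \<partial>lborel)"
proof -
  define k where "k = 2 ^ DIM('a) / unit_ball_vol (real DIM('a))"
  have k: "0 < k" by (simp add: k_def)
  define Q where "Q = (\<lambda>x. enn_powr (segment_ball_integral t g x) p)"
  have [measurable]: "Q \<in> borel_measurable borel" unfolding Q_def by measurable
  have two: "enn_powr 2 p = ennreal (2 powr p)"
    using enn_powr_ennreal[of 2 p] by simp
  have "(\<integral>\<^sup>+x. ennreal (\<bar>U (x + h) - U x\<bar> powr p) \<partial>lborel)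
     \<le> (\<integral>\<^sup>+x. ennreal ((2 * k) powr p) * (Q x + Q (x + h)) \<partial>lborel)"
  proof (intro nn_integral_mono)
    fix x
    have "ennreal (\<bar>U (x + h) - U x\<bar> powr p) = enn_powr (ennreal \<bar>U (x + h) - U x\<bar>) p"
      by (simp add: enn_powr_ennreal)
    also have "\<dots> \<le> enn_powr (ennreal k * (segment_ball_integral t g x + segment_ball_integral t g (x + h))) p"
      using p unfolding k_def by (intro enn_powr_mono increment_le_segment_ball_integral U g incr h) auto
    also have "\<dots> \<le> ennreal (k powr p) * (enn_powr 2 p * (Q x + Q (x + h)))"
      unfolding enn_powr_mult Q_def using p k
      by (simp add: enn_powr_ennreal) (intro mult_left_mono enn_powr_add_le, auto)
    also have "\<dots> = ennreal ((2 * k) powr p) * (Q x + Q (x + h))"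
      using k by (simp add: two powr_mult ennreal_mult ac_simps)
    finally show "ennreal (\<bar>U (x + h) - U x\<bar> powr p) \<le> ennreal ((2 * k) powr p) * (Q x + Q (x + h))" .
  qed
  also have "\<dots> = ennreal ((2 * k) powr p) * ((\<integral>\<^sup>+x. Q x \<partial>lborel) + (\<integral>\<^sup>+x. Q (x + h) \<partial>lborel))"
    by (simp add: nn_integral_cmult nn_integral_add)
  also have "(\<integral>\<^sup>+x. Q (x + h) \<partial>lborel) = (\<integral>\<^sup>+x. Q x \<partial>lborel)"
    by (rule nn_integral_lborel_translate) measurable
  finally have "(\<integral>\<^sup>+x. ennreal (\<bar>U (x + h) - U x\<bar> powr p) \<partial>lborel) \<le> ennreal ((2 * k) powr p) * (2 * (\<integral>\<^sup>+x. Q x \<partial>lborel))"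
    by (simp only: mult_2)
  also have "\<dots> = ennreal (2 * (2 * k) powr p) * (\<integral>\<^sup>+x. Q x \<partial>lborel)"
    by (simp add: ennreal_mult ac_simps)
  finally show ?thesis
    by (simp add: k_def Q_def)
qed

text \<open>\<^const>\<open>segment_ball_integral\<close> commutes with convolution.\<close>

lemma segment_ball_integral_average_Lp_le:
  fixes g \<phi> :: "'a::euclidean_space \<Rightarrow> ennreal"
  assumes [measurable]: "g \<in> borel_measurable borel" "\<phi> \<in> borel_measurable borel"
    and mass: "(\<integral>\<^sup>+z. \<phi> z \<partial>lborel) = 1" and p: "1 < p"
  shows "(\<integral>\<^sup>+x. enn_powr (segment_ball_integral t (\<lambda>x. \<integral>\<^sup>+z. \<phi> z * g (x + z) \<partial>lborel) x) p \<partial>lborel)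
    \<le> (\<integral>\<^sup>+x. enn_powr (segment_ball_integral t g x) p \<partial>lborel)"
proof -
  have b: "ball_integral \<rho> (\<lambda>x. \<integral>\<^sup>+z. \<phi> z * g (x + z) \<partial>lborel) x = (\<integral>\<^sup>+z. \<phi> z * ball_integral \<rho> g (x + z) \<partial>lborel)" for \<rho> x
  proof -
    have "ball_integral \<rho> (\<lambda>x. \<integral>\<^sup>+z. \<phi> z * g (x + z) \<partial>lborel) x
        = (\<integral>\<^sup>+w. (\<integral>\<^sup>+z. indicator (ball 0 1) w * (\<phi> z * g (x + \<rho> *\<^sub>R w + z)) \<partial>lborel) \<partial>lborel)"
      unfolding ball_integral_def by (simp add: nn_integral_cmult)
    also have "\<dots> = (\<integral>\<^sup>+z. (\<integral>\<^sup>+w. indicator (ball 0 1) w * (\<phi> z * g (x + \<rho> *\<^sub>R w + z)) \<partial>lborel) \<partial>lborel)"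
      by (rule lborel_pair.Fubini') measurable
    also have "\<dots> = (\<integral>\<^sup>+z. (\<integral>\<^sup>+w. \<phi> z * (indicator (ball 0 1) w * g (x + z + \<rho> *\<^sub>R w)) \<partial>lborel) \<partial>lborel)"
      by (simp add: ac_simps)
    also have "\<dots> = (\<integral>\<^sup>+z. \<phi> z * ball_integral \<rho> g (x + z) \<partial>lborel)"
      unfolding ball_integral_def by (simp add: nn_integral_cmult)
    finally show ?thesis .
  qed
  have s: "segment_ball_integral t (\<lambda>x. \<integral>\<^sup>+z. \<phi> z * g (x + z) \<partial>lborel) x = (\<integral>\<^sup>+z. \<phi> z * segment_ball_integral t g (x + z) \<partial>lborel)" for x
  proof -
    have "segment_ball_integral t (\<lambda>x. \<integral>\<^sup>+z. \<phi> z * g (x + z) \<partial>lborel) x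
       = ennreal t * (\<integral>\<^sup>+s. (\<integral>\<^sup>+z. indicator {0<..<1} s * (\<phi> z * ball_integral (s * t) g (x + z)) \<partial>lborel) \<partial>lborel)"
      unfolding segment_ball_integral_def b by (simp add: nn_integral_cmult)
    also have "(\<integral>\<^sup>+s. (\<integral>\<^sup>+z. indicator {0<..<1} s * (\<phi> z * ball_integral (s * t) g (x + z)) \<partial>lborel) \<partial>lborel)
       = (\<integral>\<^sup>+z. (\<integral>\<^sup>+s. indicator {0<..<1} s * (\<phi> z * ball_integral (s * t) g (x + z)) \<partial>lborel) \<partial>lborel)"
      by (rule lborel_pair.Fubini') measurable
    also have "\<dots> = (\<integral>\<^sup>+z. \<phi> z * (\<integral>\<^sup>+s. indicator {0<..<1} s * ball_integral (s * t) g (x + z) \<partial>lborel) \<partial>lborel)"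
      by (subst nn_integral_cmult[symmetric]) (auto simp: ac_simps)
    also have "ennreal t * \<dots> = (\<integral>\<^sup>+z. \<phi> z * segment_ball_integral t g (x + z) \<partial>lborel)"
      unfolding segment_ball_integral_def by (subst nn_integral_cmult[symmetric]) (auto simp: ac_simps)
    finally show ?thesis .
  qed
  \<comment> \<open>Jensen for the probability density \<open>\<phi>\<close>; by translation
    invariance every shift \<open>z\<close> then contributes the same integral over
    \<open>x\<close>.\<close>
  have "(\<integral>\<^sup>+x. enn_powr (segment_ball_integral t (\<lambda>x. \<integral>\<^sup>+z. \<phi> z * g (x + z) \<partial>lborel) x) p \<partial>lborel)
     \<le> (\<integral>\<^sup>+x. (\<integral>\<^sup>+z. \<phi> z * enn_powr (segment_ball_integral t g (x + z)) p \<partial>lborel) \<partial>lborel)"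
  proof (intro nn_integral_mono)
    fix x
    show "enn_powr (segment_ball_integral t (\<lambda>x. \<integral>\<^sup>+z. \<phi> z * g (x + z) \<partial>lborel) x) p
       \<le> (\<integral>\<^sup>+z. \<phi> z * enn_powr (segment_ball_integral t g (x + z)) p \<partial>lborel)"
      unfolding s using nn_integral_Jensen[OF p, of \<phi> lborel "\<lambda>z. segment_ball_integral t g (x + z)"]
      by (simp add: mass)
  qed
  also have "\<dots> = (\<integral>\<^sup>+z. (\<integral>\<^sup>+x. \<phi> z * enn_powr (segment_ball_integral t g (x + z)) p \<partial>lborel) \<partial>lborel)"
    by (rule lborel_pair.Fubini') measurable
  also have "\<dots> = (\<integral>\<^sup>+z. \<phi> z * (\<integral>\<^sup>+x. enn_powr (segment_ball_integral t g x) p \<partial>lborel) \<partial>lborel)"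
    by (simp add: nn_integral_cmult nn_integral_lborel_translate[of "\<lambda>x. enn_powr (segment_ball_integral t g x) p"])
  also have "\<dots> = (\<integral>\<^sup>+x. enn_powr (segment_ball_integral t g x) p \<partial>lborel)"
    by (simp add: nn_integral_multc mass)
  finally show ?thesis .
qed

section \<open>Removing the mollification\<close>

text \<open>Connects the support of \<open>kern\<close>, written with the vector \<open>1\<close>,
  to the differentiation theorem, whose cubes are written with \<open>One\<close>.\<close>

lemma one_eq_One_vec: "(1 :: real^'n::finite) = One"
proof -
  have "(One :: real^'n) $ i = 1" for i
  proof -
    have "axis i 1 \<in> (Basis :: (real^'n) set)"
      by (auto simp: Basis_vec_def)
    then show ?thesis
      by (simp add: cart_eq_inner_axis inner_sum_left inner_Basis)
  qed
  then show ?thesis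
    by (simp add: vec_eq_iff)
qed

lemma content_cube: "0 \<le> l \<Longrightarrow> measure lborel (cbox x (x + l *\<^sub>R (1 :: real^'n::finite))) = l ^ CARD('n)"
  by (subst content_cbox_cart) (auto simp: interval_ne_empty_cart)

lemma integrable_indicator_compact:
  fixes K :: "'a::euclidean_space set"
  shows "compact K \<Longrightarrow> integrable lborel (indicator K :: 'a \<Rightarrow> real)"
  using emeasure_bounded_finite[of K] by (intro integrable_real_indicator) (auto simp: compact_imp_bounded borel_compact)

section \<open>Mass of the kernel\<close>

definition kern_mass :: "'n::finite itself \<Rightarrow> real \<Rightarrow> real" where
  "kern_mass _ \<epsilon> = (\<integral>y. kern \<epsilon> (y :: real^'n) \<partial>lborel)"

lemma kern_integrable: "0 < \<epsilon> \<Longrightarrow> integrable lborel (\<lambda>y :: real^'n::finite. kern \<epsilon> (y - a))"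
  using integrable_times_kern(1)[of "\<lambda>_. 1" \<epsilon> a] by (simp add: integrable_indicator_compact)

lemma nn_integral_kern:
  fixes a :: "real^'n::finite"
  assumes "0 < \<epsilon>"
  shows "(\<integral>\<^sup>+y. ennreal (kern \<epsilon> (y - a)) \<partial>lborel) = ennreal (kern_mass TYPE('n) \<epsilon>)"
proof -
  have "(\<integral>\<^sup>+y. ennreal (kern \<epsilon> (y - a)) \<partial>lborel) = (\<integral>\<^sup>+y. ennreal (kern \<epsilon> (y :: real^'n)) \<partial>lborel)"
    using nn_integral_lborel_translate[of "\<lambda>y :: real^'n. ennreal (kern \<epsilon> y)" "- a"] by simp
  also have "\<dots> = ennreal (kern_mass TYPE('n) \<epsilon>)"
    unfolding kern_mass_def using kern_integrable[OF assms, of 0]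
    by (intro nn_integral_eq_integral) (auto simp: kern_nonneg)
  finally show ?thesis .
qed

lemma kern_mass_nonneg: "0 \<le> kern_mass TYPE('n::finite) \<epsilon>"
  unfolding kern_mass_def by (intro integral_nonneg_AE) (auto simp: kern_nonneg)

lemma integral_kern:
  fixes a :: "real^'n::finite"
  assumes "0 < \<epsilon>"
  shows "(\<integral>y. kern \<epsilon> (y - a) \<partial>lborel) = kern_mass TYPE('n) \<epsilon>"
  using nn_integral_kern[OF assms, of a] kern_mass_nonneg[of \<epsilon>, where 'n = 'n]
  by (subst integral_eq_nn_integral) (auto simp: kern_nonneg)

text \<open>On the middle cube of side \<open>\<epsilon> / 2\<close> every factor of
  \<open>kern\<close> is at least \<open>exp (- 16)\<close>. The mass is thus at least a fixed
  fraction of the volume of the support cube, so averages over cubes control averages against the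
  kernel.\<close>

lemma kern_mass_lower:
  assumes "0 < \<epsilon>"
  shows "(exp (- 16) / 2) ^ CARD('n) * \<epsilon> ^ CARD('n) \<le> kern_mass TYPE('n::finite) \<epsilon>"
proof -
  let ?a = "(\<epsilon> / 4) *\<^sub>R (1 :: real^'n)"
  let ?K = "cbox ?a (?a + (\<epsilon> / 2) *\<^sub>R 1)"
  have "(exp (- 16) / 2) ^ CARD('n) * \<epsilon> ^ CARD('n) = exp (- 16) ^ CARD('n) * measure lborel ?K"
    using assms by (subst content_cube) (auto simp: power_divide)
  also have "\<dots> = (\<integral>y. exp (- 16) ^ CARD('n) * indicator ?K y \<partial>lborel)"
    by simp
  also have "\<dots> \<le> kern_mass TYPE('n) \<epsilon>"
    unfolding kern_mass_def
  proof (rule integral_mono)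
    show "integrable lborel (\<lambda>y. exp (- 16) ^ CARD('n) * indicator ?K y :: real)"
      by (simp add: integrable_indicator_compact)
    show "integrable lborel (kern \<epsilon> :: real^'n \<Rightarrow> real)"
      using kern_integrable[OF assms, of 0] by simp
    fix y :: "real^'n"
    show "exp (- 16) ^ CARD('n) * indicator ?K y \<le> kern \<epsilon> y"
    proof (cases "y \<in> ?K")
      case True
      have "exp (- 16) \<le> bump_deriv 0 (y $ j / \<epsilon>)" for j
      proof (rule bump_lower)
        have "\<epsilon> / 4 \<le> y $ j" "y $ j \<le> \<epsilon> / 4 + \<epsilon> / 2"
          using True by (auto simp: mem_box_cart)
        then show "1 / 4 \<le> y $ j / \<epsilon>" "y $ j / \<epsilon> \<le> 3 / 4"
          using assms by (simp_all add: pos_le_divide_eq pos_divide_le_eq)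
      qed
      then have "(\<Prod>j\<in>(UNIV :: 'n set). exp (- 16)) \<le> kern \<epsilon> y"
        unfolding kern_def by (intro prod_mono) auto
      then show ?thesis using True by simp
    qed (simp add: kern_nonneg)
  qed
  finally show ?thesis .
qed

lemma kern_mass_pos:
  assumes "0 < \<epsilon>"
  shows "0 < kern_mass TYPE('n::finite) \<epsilon>"
proof -
  have "0 < (exp (- 16) / 2) ^ CARD('n) * \<epsilon> ^ CARD('n)"
    using assms by simp
  also note kern_mass_lower[OF assms]
  finally show ?thesis .
qed

lemma AE_lborel_translate:
  fixes P :: "'a::euclidean_space \<Rightarrow> bool"
  assumes "AE x in lborel. P x"
  shows "AE x in lborel. P (x + h)"
proof -
  obtain N where N: "N \<in> null_sets lborel" "{x. \<not> P x} \<subseteq> N"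
    using assms by (auto simp: eventually_ae_filter)
  have [measurable]: "N \<in> sets borel" using N(1) by auto
  have "(\<lambda>x. x + h) -` N \<in> sets borel"
    using measurable_sets_borel[of "\<lambda>x. x + h" borel N] by simp
  moreover have "emeasure lborel ((\<lambda>x. x + h) -` N) = (\<integral>\<^sup>+x. indicator N (x + h) \<partial>lborel)"
  proof -
    have "emeasure lborel ((\<lambda>x. x + h) -` N) = (\<integral>\<^sup>+x. indicator ((\<lambda>x. x + h) -` N) x \<partial>lborel)"
      using calculation by simp
    also have "\<dots> = (\<integral>\<^sup>+x. indicator N (x + h) \<partial>lborel)"
      by (intro nn_integral_cong) (auto split: split_indicator)
    finally show ?thesis .
  qed
  moreover have "(\<integral>\<^sup>+x. indicator N (x + h) \<partial>lborel) = emeasure lborel N"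
    using nn_integral_lborel_translate[of "indicator N" h] by simp
  ultimately have "(\<lambda>x. x + h) -` N \<in> null_sets lborel"
    using N(1) by (intro null_setsI) (auto simp: null_setsD1)
  then show ?thesis
    by (rule AE_I') (use N(2) in auto)
qed

section \<open>Convergence of the mollified functions and passage to the limit\<close>

context weakly_differentiable
begin

definition mollified :: "real \<Rightarrow> real^'n \<Rightarrow> real" where
  "mollified \<epsilon> x = (\<integral>y. f y * kern \<epsilon> (y - x) \<partial>lborel) / kern_mass TYPE('n) \<epsilon>"

lemma mollified_measurable [measurable]: "mollified \<epsilon> \<in> borel_measurable borel"
  unfolding mollified_def by measurable

text \<open>Comparing both \<open>f y\<close> and \<open>f x\<close> with a constant
  \<open>q\<close> avoids the function \<open>\<bar>f y - f x\<bar>\<close>, which changes with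
  \<open>x\<close>: the differentiation theorem can then be applied to
  \<open>\<bar>f y - q\<bar>\<close> for countably many \<open>q\<close>, chosen before
  \<open>x\<close>.\<close>

lemma mollified_error:
  assumes eps: "0 < \<epsilon>"
  shows "kern_mass TYPE('n) \<epsilon> * \<bar>mollified \<epsilon> x - f x\<bar>
    \<le> integral (cbox x (x + \<epsilon> *\<^sub>R One)) (\<lambda>y. \<bar>f y - q\<bar>) + \<bar>f x - q\<bar> * \<epsilon> ^ CARD('n)"
proof -
  let ?K = "cbox x (x + \<epsilon> *\<^sub>R 1)"
  have i1: "integrable lborel (\<lambda>y. f y * kern \<epsilon> (y - x))"
    by (intro integrable_times_kern f f_loc eps)
  have iK: "integrable lborel (\<lambda>y. indicator ?K y :: real)"
    by (simp add: integrable_indicator_compact)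
  have "integrable lborel (\<lambda>y. \<bar>indicator ?K y * f y - q * indicator ?K y\<bar>)"
    by (intro integrable_abs Bochner_Integration.integrable_diff integrable_mult_right f_loc iK) simp
  moreover have "(\<lambda>y. \<bar>indicator ?K y * f y - q * indicator ?K y\<bar>) = (\<lambda>y. indicator ?K y * \<bar>f y - q\<bar>)"
    by (auto split: split_indicator)
  ultimately have i2: "integrable lborel (\<lambda>y. indicator ?K y * \<bar>f y - q\<bar>)" by simp
  have "kern_mass TYPE('n) \<epsilon> * (mollified \<epsilon> x - f x) = (\<integral>y. f y * kern \<epsilon> (y - x) \<partial>lborel) - (\<integral>y. f x * kern \<epsilon> (y - x) \<partial>lborel)"
    using kern_mass_pos[OF eps, where 'n = 'n] by (simp add: mollified_def integral_kern[OF eps] field_simps)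
  also have "\<dots> = (\<integral>y. (f y - f x) * kern \<epsilon> (y - x) \<partial>lborel)"
    using i1 kern_integrable[OF eps, of x] by (simp add: left_diff_distrib)
  finally have "kern_mass TYPE('n) \<epsilon> * (mollified \<epsilon> x - f x) = (\<integral>y. (f y - f x) * kern \<epsilon> (y - x) \<partial>lborel)" .
  moreover have "kern_mass TYPE('n) \<epsilon> * \<bar>mollified \<epsilon> x - f x\<bar> = \<bar>kern_mass TYPE('n) \<epsilon> * (mollified \<epsilon> x - f x)\<bar>"
    using kern_mass_nonneg[of \<epsilon>, where 'n = 'n] by (simp add: abs_mult)
  ultimately have "kern_mass TYPE('n) \<epsilon> * \<bar>mollified \<epsilon> x - f x\<bar> = \<bar>\<integral>y. (f y - f x) * kern \<epsilon> (y - x) \<partial>lborel\<bar>"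
    by simp
  also have "\<dots> \<le> (\<integral>y. \<bar>(f y - f x) * kern \<epsilon> (y - x)\<bar> \<partial>lborel)"
    by (rule integral_abs_bound)
  also have "\<dots> \<le> (\<integral>y. indicator ?K y * \<bar>f y - q\<bar> + \<bar>f x - q\<bar> * indicator ?K y \<partial>lborel)"
  proof (rule integral_mono)
    have "integrable lborel (\<lambda>y. f y * kern \<epsilon> (y - x) - f x * kern \<epsilon> (y - x))"
      using i1 kern_integrable[OF eps, of x] by simp
    then show "integrable lborel (\<lambda>y. \<bar>(f y - f x) * kern \<epsilon> (y - x)\<bar>)"
      unfolding left_diff_distrib by (rule integrable_abs)
    show "integrable lborel (\<lambda>y. indicator ?K y * \<bar>f y - q\<bar> + \<bar>f x - q\<bar> * indicator ?K y)"
      using i2 iK by simp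
    fix y
    show "\<bar>(f y - f x) * kern \<epsilon> (y - x)\<bar> \<le> indicator ?K y * \<bar>f y - q\<bar> + \<bar>f x - q\<bar> * indicator ?K y"
    proof (cases "y \<in> ?K")
      case True
      have "\<bar>f y - f x\<bar> * kern \<epsilon> (y - x) \<le> \<bar>f y - f x\<bar> * 1"
        by (intro mult_left_mono kern_le_1) auto
      also have "\<dots> \<le> \<bar>f y - q\<bar> + \<bar>f x - q\<bar>" by simp
      finally show ?thesis using True by (simp add: abs_mult kern_nonneg)
    qed (simp add: kern_support(1)[OF eps])
  qed
  also have "\<dots> = (\<integral>y. indicator ?K y * \<bar>f y - q\<bar> \<partial>lborel) + \<bar>f x - q\<bar> * \<epsilon> ^ CARD('n)"
    using i2 iK eps content_cube[of \<epsilon> x] by simp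
  also have "(\<integral>y. indicator ?K y * \<bar>f y - q\<bar> \<partial>lborel) = integral ?K (\<lambda>y. \<bar>f y - q\<bar>)"
    using set_borel_integral_eq_integral(2)[of ?K "\<lambda>y. \<bar>f y - q\<bar>"] i2
    by (simp add: set_integrable_def set_lebesgue_integral_def)
  finally show ?thesis
    by (simp add: one_eq_One_vec)
qed

text \<open>Lebesgue points: the averages of \<open>\<bar>f - q\<bar>\<close> converge for all rational \<open>q\<close> simultaneously.\<close>

lemma mollified_tendsto:
  "AE x in lborel. (\<lambda>k. mollified (1 / real (Suc k)) x) \<longlonglongrightarrow> f x"
proof -
  have int: "(\<lambda>y. \<bar>f y - q\<bar>) integrable_on cbox a b" for q a b
  proof -
    have iK: "integrable lborel (\<lambda>y. indicator (cbox a b) y :: real)"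
      by (simp add: integrable_indicator_compact)
    have "integrable lborel (\<lambda>y. \<bar>indicator (cbox a b) y * f y - q * indicator (cbox a b) y\<bar>)"
      by (intro integrable_abs Bochner_Integration.integrable_diff integrable_mult_right f_loc iK) simp
    moreover have "(\<lambda>y. \<bar>indicator (cbox a b) y * f y - q * indicator (cbox a b) y\<bar>) = (\<lambda>y. indicator (cbox a b) y * \<bar>f y - q\<bar>)"
      by (auto split: split_indicator)
    ultimately show ?thesis
      using set_borel_integral_eq_integral(1)[of "cbox a b" "\<lambda>y. \<bar>f y - q\<bar>"] by (simp add: set_integrable_def)
  qed
  define P where "P = (\<lambda>q N. negligible N \<and> (\<forall>x e. x \<notin> N \<longrightarrow> 0 < e \<longrightarrow> (\<exists>d>0. \<forall>h. 0 < h \<and> h < d \<longrightarrow>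
      norm (integral (cbox x (x + h *\<^sub>R One)) (\<lambda>y. \<bar>f y - q\<bar>) /\<^sub>R h ^ DIM(real^'n) - \<bar>f x - q\<bar>) < e)))"
  have ex: "\<exists>N. P q N" for q
  proof (rule integrable_ccontinuous_explicit[OF int[of q]])
    fix N :: "(real^'n) set"
    assume "negligible N" "\<And>x e. x \<notin> N \<Longrightarrow> 0 < e \<Longrightarrow> \<exists>d>0. \<forall>h. 0 < h \<and> h < d \<longrightarrow>
      norm (integral (cbox x (x + h *\<^sub>R One)) (\<lambda>y. \<bar>f y - q\<bar>) /\<^sub>R h ^ DIM(real^'n) - \<bar>f x - q\<bar>) < e"
    then have "P q N" unfolding P_def by blast
    then show ?thesis ..
  qed
  define N where "N q = (SOME N. P q N)" for q
  have "P q (N q)" for q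
    unfolding N_def by (rule someI_ex[OF ex])
  then have neg: "\<And>q. negligible (N q)"
    and N: "\<And>q x e. x \<notin> N q \<Longrightarrow> 0 < e \<Longrightarrow> \<exists>d>0. \<forall>h. 0 < h \<and> h < d \<longrightarrow>
      norm (integral (cbox x (x + h *\<^sub>R One)) (\<lambda>y. \<bar>f y - q\<bar>) /\<^sub>R h ^ DIM(real^'n) - \<bar>f x - q\<bar>) < e"
    unfolding P_def by blast+
  have "negligible (\<Union>q\<in>\<rat>. N q)"
    by (intro negligible_countable_Union countable_image countable_rat) (auto simp: neg)
  then have "AE x in lebesgue. x \<notin> (\<Union>q\<in>\<rat>. N q)"
    unfolding negligible_iff_null_sets by (rule AE_not_in)
  then have "AE x in lborel. x \<notin> (\<Union>q\<in>\<rat>. N q)"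
    by (simp only: AE_completion_iff)
  then show ?thesis
  proof eventually_elim
    case (elim x)
    \<comment> \<open>The inverse of the constant in \<open>kern_mass_lower\<close>, so that
      \<open>h ^ CARD('n) \<le> M * kern_mass TYPE('n) h\<close>.\<close>
    define M where "M = 1 / (exp (- 16 :: real) / 2) ^ CARD('n)"
    have M: "0 < M" by (simp add: M_def)
    show ?case
    proof (rule LIMSEQ_I)
      fix r :: real assume r: "0 < r"
      \<comment> \<open>The cube average of \<open>\<bar>f y - q\<bar>\<close> will be below
        \<open>2 * e\<close> and \<open>\<bar>f x - q\<bar>\<close> below \<open>e\<close>; in total
        \<open>3 * e * M = 3 * r / 4 < r\<close>.\<close>
      define e where "e = r / (4 * M)"
      have e: "0 < e" using r M by (simp add: e_def)
      obtain q where q: "q \<in> \<rat>" "f x < q" "q < f x + e"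
        using Rats_dense_in_real[of "f x" "f x + e"] e by auto
      obtain d where d: "0 < d" "\<And>h. 0 < h \<Longrightarrow> h < d \<Longrightarrow>
        norm (integral (cbox x (x + h *\<^sub>R One)) (\<lambda>y. \<bar>f y - q\<bar>) /\<^sub>R h ^ DIM(real^'n) - \<bar>f x - q\<bar>) < e"
        using N[of x q e] elim q e by blast
      obtain k0 where k0: "1 / real (Suc k0) < d"
        using nat_approx_posE[OF d(1)] by auto
      have "norm (mollified (1 / real (Suc k)) x - f x) < r" if k: "k0 \<le> k" for k
      proof -
        define h where "h = 1 / real (Suc k)"
        have "h \<le> 1 / real (Suc k0)"
          using k by (simp add: h_def frac_le)
        then have h: "0 < h" "h < d"
          using k0 by (simp_all add: h_def)
        define A where "A = integral (cbox x (x + h *\<^sub>R One)) (\<lambda>y. \<bar>f y - q\<bar>)"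
        define Z where "Z = kern_mass TYPE('n) h"
        have hn: "0 < h ^ CARD('n)" using h by simp
        have "A / h ^ CARD('n) < \<bar>f x - q\<bar> + e"
          using d(2)[OF h] by (simp add: A_def divide_inverse mult.commute abs_less_iff)
        then have "A / h ^ CARD('n) < 2 * e" using q by simp
        then have A: "A \<le> 2 * e * h ^ CARD('n)"
          using hn by (simp add: divide_less_eq)
        have "\<bar>f x - q\<bar> * h ^ CARD('n) \<le> e * h ^ CARD('n)"
          using hn q by (intro mult_right_mono) auto
        then have "Z * \<bar>mollified h x - f x\<bar> \<le> 3 * e * h ^ CARD('n)"
          using mollified_error[OF h(1), of x q] A by (simp add: A_def Z_def)
        also have "h ^ CARD('n) \<le> M * Z"
          using kern_mass_lower[OF h(1), where 'n = 'n] by (simp add: M_def Z_def field_simps)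
        then have "3 * e * h ^ CARD('n) \<le> 3 * e * (M * Z)"
          using e by (intro mult_left_mono) auto
        finally have "Z * \<bar>mollified h x - f x\<bar> \<le> Z * (3 * e * M)"
          by (simp add: ac_simps)
        then have "\<bar>mollified h x - f x\<bar> \<le> 3 * e * M"
          using kern_mass_pos[OF h(1), where 'n = 'n] by (simp add: Z_def)
        also have "\<dots> < r" using r M by (simp add: e_def)
        finally show ?thesis by (simp add: h_def)
      qed
      then show "\<exists>no. \<forall>k\<ge>no. norm (mollified (1 / real (Suc k)) x - f x) < r" by blast
    qed
  qed
qed

text \<open>Acts as an upper gradient of \<open>mollified \<epsilon>\<close>
  (\<open>mollified_increment\<close>). With the norm inside the average it has the form required by
  \<open>segment_ball_integral_average_Lp_le\<close>.\<close>

definition mollified_gradient :: "real \<Rightarrow> real^'n \<Rightarrow> ennreal" where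
  "mollified_gradient \<epsilon> x = (\<integral>\<^sup>+z. ennreal (kern \<epsilon> z / kern_mass TYPE('n) \<epsilon>) * ennreal (norm (G (x + z))) \<partial>lborel)"

lemma mollified_gradient_measurable [measurable]: "mollified_gradient \<epsilon> \<in> borel_measurable borel"
  unfolding mollified_gradient_def by measurable

lemma mollified_increment:
  assumes eps: "0 < \<epsilon>"
  shows "ennreal \<bar>mollified \<epsilon> (x + w) - mollified \<epsilon> x\<bar>
    \<le> ennreal (norm w) * (\<integral>\<^sup>+s. indicator {0<..<1} s * mollified_gradient \<epsilon> (x + s *\<^sub>R w) \<partial>lborel)"
proof -
  define Z where "Z = kern_mass TYPE('n) \<epsilon>"
  have Z: "0 < Z" unfolding Z_def using eps by (rule kern_mass_pos)
  have g: "mollified_gradient \<epsilon> a = ennreal (1 / Z) * (\<integral>\<^sup>+y. ennreal (norm (G y)) * ennreal (kern \<epsilon> (y - a)) \<partial>lborel)" for a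
  proof -
    have "mollified_gradient \<epsilon> a = (\<integral>\<^sup>+z. ennreal (1 / Z) * (ennreal (norm (G (z + a))) * ennreal (kern \<epsilon> (z + a - a))) \<partial>lborel)"
      unfolding mollified_gradient_def Z_def[symmetric] using Z
      by (intro nn_integral_cong) (simp add: kern_nonneg ennreal_mult[symmetric] add.commute mult.commute)
    also have "\<dots> = (\<integral>\<^sup>+y. ennreal (1 / Z) * (ennreal (norm (G y)) * ennreal (kern \<epsilon> (y - a))) \<partial>lborel)"
      by (rule nn_integral_lborel_translate) measurable
    also have "\<dots> = ennreal (1 / Z) * (\<integral>\<^sup>+y. ennreal (norm (G y)) * ennreal (kern \<epsilon> (y - a)) \<partial>lborel)"
      by (rule nn_integral_cmult) measurable
    finally show ?thesis .
  qed
  have "ennreal \<bar>mollified \<epsilon> (x + w) - mollified \<epsilon> x\<bar> = ennreal (1 / Z) *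
     ennreal \<bar>(\<integral>y. f y * kern \<epsilon> (y - (x + w)) \<partial>lborel) - (\<integral>y. f y * kern \<epsilon> (y - x) \<partial>lborel)\<bar>"
    using Z by (simp add: mollified_def Z_def[symmetric] ennreal_mult[symmetric] diff_divide_distrib[symmetric])
  also have "\<dots> \<le> ennreal (1 / Z) * (ennreal (norm w) * (\<integral>\<^sup>+s. indicator {0<..<1} s *
         (\<integral>\<^sup>+y. ennreal (norm (G y)) * ennreal (kern \<epsilon> (y - (x + s *\<^sub>R w))) \<partial>lborel) \<partial>lborel))"
    by (intro mult_left_mono kern_average_increment eps) auto
  also have "\<dots> = ennreal (norm w) * (\<integral>\<^sup>+s. ennreal (1 / Z) * (indicator {0<..<1} s *
         (\<integral>\<^sup>+y. ennreal (norm (G y)) * ennreal (kern \<epsilon> (y - (x + s *\<^sub>R w))) \<partial>lborel)) \<partial>lborel)"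
    by (subst nn_integral_cmult) (auto simp: ac_simps)
  also have "\<dots> = ennreal (norm w) * (\<integral>\<^sup>+s. indicator {0<..<1} s * mollified_gradient \<epsilon> (x + s *\<^sub>R w) \<partial>lborel)"
    by (simp add: g ac_simps)
  finally show ?thesis .
qed

text \<open>Averaging does not increase the right-hand side, so the bound for
  \<open>mollified \<epsilon>\<close> is uniform in \<open>\<epsilon>\<close>. Fatou's lemma along
  \<open>\<epsilon> = 1 / Suc k\<close> and almost everywhere convergence at both \<open>x\<close>
  and \<open>x + h\<close> transfer it to \<open>f\<close>.\<close>

lemma translate_difference_Lp_le:
  assumes p: "1 < p" and h: "norm h < t"
  shows "(\<integral>\<^sup>+x. ennreal (\<bar>f (x + h) - f x\<bar> powr p) \<partial>lborel)
    \<le> ennreal (2 * (2 * 2 ^ CARD('n) / unit_ball_vol (real CARD('n))) powr p)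
        * (\<integral>\<^sup>+x. enn_powr (segment_ball_integral t (\<lambda>x. ennreal (norm (G x))) x) p \<partial>lborel)"
proof -
  define u where "u = (\<lambda>k x. ennreal (\<bar>mollified (1 / real (Suc k)) (x + h) - mollified (1 / real (Suc k)) x\<bar> powr p))"
  define R where "R = ennreal (2 * (2 * 2 ^ CARD('n) / unit_ball_vol (real CARD('n))) powr p)
        * (\<integral>\<^sup>+x. enn_powr (segment_ball_integral t (\<lambda>x. ennreal (norm (G x))) x) p \<partial>lborel)"
  have bound: "(\<integral>\<^sup>+x. u k x \<partial>lborel) \<le> R" for k
  proof -
    define \<epsilon> where "\<epsilon> = 1 / real (Suc k)"
    have eps: "0 < \<epsilon>" by (simp add: \<epsilon>_def)
    define \<phi> where "\<phi> = (\<lambda>z :: real^'n. ennreal (kern \<epsilon> z / kern_mass TYPE('n) \<epsilon>))"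
    have mass: "(\<integral>\<^sup>+z. \<phi> z \<partial>lborel) = 1"
    proof -
      have "(\<integral>\<^sup>+z. \<phi> z \<partial>lborel) = (\<integral>\<^sup>+z. ennreal (1 / kern_mass TYPE('n) \<epsilon>) * ennreal (kern \<epsilon> (z :: real^'n)) \<partial>lborel)"
        unfolding \<phi>_def using kern_mass_pos[OF eps, where 'n = 'n]
        by (intro nn_integral_cong) (simp add: kern_nonneg ennreal_mult[symmetric])
      also have "\<dots> = ennreal (1 / kern_mass TYPE('n) \<epsilon>) * ennreal (kern_mass TYPE('n) \<epsilon>)"
        using nn_integral_kern[OF eps, of "0 :: real^'n"] by (subst nn_integral_cmult) auto
      also have "\<dots> = 1"
        using kern_mass_pos[OF eps, where 'n = 'n] by (simp add: ennreal_mult[symmetric])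
      finally show ?thesis .
    qed
    have "(\<integral>\<^sup>+x. u k x \<partial>lborel) \<le> ennreal (2 * (2 * 2 ^ DIM(real^'n) / unit_ball_vol (real DIM(real^'n))) powr p)
        * (\<integral>\<^sup>+x. enn_powr (segment_ball_integral t (mollified_gradient \<epsilon>) x) p \<partial>lborel)"
      unfolding u_def \<epsilon>_def[symmetric] using p
      by (intro increment_Lp_le mollified_increment eps h) auto
    also have "\<dots> \<le> ennreal (2 * (2 * 2 ^ DIM(real^'n) / unit_ball_vol (real DIM(real^'n))) powr p)
        * (\<integral>\<^sup>+x. enn_powr (segment_ball_integral t (\<lambda>x. ennreal (norm (G x))) x) p \<partial>lborel)"
      unfolding mollified_gradient_def[abs_def] \<phi>_def[symmetric]
      using segment_ball_integral_average_Lp_le[of "\<lambda>x. ennreal (norm (G x))" \<phi>, OF _ _ mass p]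
      by (intro mult_left_mono) (auto simp: \<phi>_def)
    finally show ?thesis by (simp add: R_def)
  qed
  have "AE x in lborel. ennreal (\<bar>f (x + h) - f x\<bar> powr p) = liminf (\<lambda>k. u k x)"
    using mollified_tendsto AE_lborel_translate[OF mollified_tendsto, of h]
  proof eventually_elim
    case (elim x)
    have "(\<lambda>k. u k x) \<longlonglongrightarrow> ennreal (\<bar>f (x + h) - f x\<bar> powr p)"
      unfolding u_def using p
      by (intro tendsto_ennrealI tendsto_powr' tendsto_rabs tendsto_diff elim tendsto_const) auto
    then show ?case
      by (intro lim_imp_Liminf[symmetric]) auto
  qed
  then have "(\<integral>\<^sup>+x. ennreal (\<bar>f (x + h) - f x\<bar> powr p) \<partial>lborel) = (\<integral>\<^sup>+x. liminf (\<lambda>k. u k x) \<partial>lborel)"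
    by (rule nn_integral_cong_AE)
  also have "\<dots> \<le> liminf (\<lambda>k. \<integral>\<^sup>+x. u k x \<partial>lborel)"
    by (rule nn_integral_liminf) (simp add: u_def)
  also have "\<dots> \<le> liminf (\<lambda>k :: nat. R)"
    by (intro Liminf_mono always_eventually allI bound)
  also have "\<dots> = R"
    by (simp add: Liminf_const)
  finally show ?thesis
    by (simp add: R_def)
qed

end

section \<open>The embedding\<close>

lemma in_Wdot1n_Borel_representative:
  fixes f :: "real^'n::finite \<Rightarrow> real"
  assumes W: "in_Wdot1n f G"
  obtains f' G' where "weakly_differentiable f' G'" "AE x in lborel. f x = f' x" "AE x in lborel. G x = G' x"
    "(\<integral>\<^sup>+x. ennreal (norm (G' x) powr real CARD('n)) \<partial>lborel) < top"
proof -
  have loc: "\<And>K. compact K \<Longrightarrow> integrable lebesgue (\<lambda>x. indicator K x * f x)"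
    using W by (auto simp: in_Wdot1n_def locally_integrable_def set_integrable_def)
  have G [measurable]: "G \<in> borel_measurable lebesgue"
    using W by (simp add: in_Wdot1n_def)
  \<comment> \<open>Local integrability yields measurability on compact sets; \<open>f\<close> is
    the pointwise limit of its restrictions to growing balls.\<close>
  have f [measurable]: "f \<in> borel_measurable lebesgue"
  proof (rule borel_measurable_LIMSEQ_real)
    show "(\<lambda>x. indicator (cball 0 (real k)) x * f x) \<in> borel_measurable lebesgue" for k
      using loc[of "cball 0 (real k)"] by (intro borel_measurable_integrable) simp
    fix x :: "real^'n"
    obtain m where m: "norm x \<le> real m"
      using real_arch_simple by blast
    have "\<forall>\<^sub>F k in sequentially. indicator (cball 0 (real k)) x * f x = f x"
      using eventually_ge_at_top[of m] by eventually_elim (use m in simp)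
    then show "(\<lambda>k. indicator (cball 0 (real k)) x * f x) \<longlonglongrightarrow> f x"
      by (rule tendsto_eventually)
  qed
  obtain f' where f' [measurable]: "f' \<in> borel_measurable borel" and ff': "AE x in lborel. f x = f' x"
    using completion_ex_borel_measurable_real[OF f] by auto
  have Gi: "(\<lambda>x. G x $ i) \<in> borel_measurable lebesgue" for i
    by measurable
  \<comment> \<open>A Borel version is chosen for each real component; the finitely many exceptional
    null sets together are null, which gives \<open>GG'\<close>.\<close>
  define Gc where "Gc i = (SOME c. c \<in> borel_measurable lborel \<and> (AE x in lborel. G x $ i = c x))" for i
  have Gc: "Gc i \<in> borel_measurable lborel" "AE x in lborel. G x $ i = Gc i x" for i
  proof -
    have "\<exists>c. c \<in> borel_measurable lborel \<and> (AE x in lborel. G x $ i = c x)"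
      using completion_ex_borel_measurable_real[OF Gi[of i]] by auto
    from someI_ex[OF this] show "Gc i \<in> borel_measurable lborel" "AE x in lborel. G x $ i = Gc i x"
      unfolding Gc_def by auto
  qed
  define G' where "G' x = (\<chi> i. Gc i x)" for x
  have [measurable]: "G' \<in> borel_measurable borel"
    using Gc(1) by (subst borel_measurable_euclidean_space) (auto simp: G'_def Basis_vec_def inner_axis)
  have GG': "AE x in lborel. G x = G' x"
  proof -
    have "AE x in lborel. \<forall>i. G x $ i = Gc i x"
      using Gc(2) by (simp add: AE_all_countable)
    then show ?thesis
      by eventually_elim (simp add: G'_def vec_eq_iff)
  qed
  have energy: "(\<integral>\<^sup>+x. ennreal (norm (G' x) powr real CARD('n)) \<partial>lborel) < top"
  proof -
    have "(\<integral>\<^sup>+x. ennreal (norm (G' x) powr real CARD('n)) \<partial>lborel) = (\<integral>\<^sup>+x. ennreal (norm (G x) powr real CARD('n)) \<partial>lebesgue)"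
      unfolding nn_integral_completion using GG' by (intro nn_integral_cong_AE) (auto elim: eventually_mono)
    also have "\<dots> < top"
      using W unfolding in_Wdot1n_def Lq_norm_vec_def by (auto simp: less_top[symmetric])
    finally show ?thesis .
  qed
  have "weakly_differentiable f' G'"
  proof
    fix K :: "(real^'n) set" assume K: "compact K"
    have KS [measurable]: "K \<in> sets borel" using K by (simp add: borel_compact)
    have KL [measurable]: "K \<in> sets lebesgue" using KS by (simp add: sets_completionI_sets)
    have "integrable lebesgue (\<lambda>x. indicator K x * f' x)"
    proof (rule integrable_cong_AE_imp[OF loc[OF K]])
      show "(\<lambda>x. indicator K x * f' x) \<in> borel_measurable lebesgue"
        by (intro measurable_completion) measurable
      show "AE x in lebesgue. indicator K x * f x = indicator K x * f' x"
        unfolding AE_completion_iff using ff' by (auto elim: eventually_mono)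
    qed
    then show "integrable lborel (\<lambda>x. indicator K x * f' x)"
      by (subst (asm) integrable_completion) measurable
  next
    fix K :: "(real^'n) set" and i assume K: "compact K"
    have [measurable]: "K \<in> sets borel" using K by (simp add: borel_compact)
    show "integrable lborel (\<lambda>x. indicator K x * G' x $ i)"
    proof (rule integrableI_bounded)
      have "(\<integral>\<^sup>+x. ennreal (norm (indicator K x * G' x $ i)) \<partial>lborel)
         \<le> (\<integral>\<^sup>+x. indicator K x + ennreal (norm (G' x) powr real CARD('n)) \<partial>lborel)"
      proof (rule nn_integral_mono)
        fix x
        \<comment> \<open>Comparison with 1 where the norm is small and with its power where it is
          large: the global energy bound becomes integrability on compact sets.\<close>
        have "norm (G' x) \<le> 1 + norm (G' x) powr real CARD('n)"
        proof (cases "norm (G' x) \<le> 1")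
          case False
          then have "norm (G' x) powr 1 \<le> norm (G' x) powr real CARD('n)"
            by (intro powr_mono) (auto simp: Suc_le_eq)
          then show ?thesis using False by simp
        qed (simp add: add_increasing2)
        then have "\<bar>G' x $ i\<bar> \<le> 1 + norm (G' x) powr real CARD('n)"
          using component_le_norm_cart[of "G' x" i] by linarith
        then have "ennreal \<bar>G' x $ i\<bar> \<le> 1 + ennreal (norm (G' x) powr real CARD('n))"
          by (metis ennreal_1 ennreal_leI ennreal_plus powr_ge_zero zero_le_one)
        then show "ennreal (norm (indicator K x * G' x $ i)) \<le> indicator K x + ennreal (norm (G' x) powr real CARD('n))"
          by (auto simp: abs_mult split: split_indicator)
      qed
      also have "\<dots> = emeasure lborel K + (\<integral>\<^sup>+x. ennreal (norm (G' x) powr real CARD('n)) \<partial>lborel)"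
        by (subst nn_integral_add) auto
      also have "\<dots> < \<infinity>"
        using energy emeasure_bounded_finite[OF compact_imp_bounded[OF K]] by simp
      finally show "(\<integral>\<^sup>+x. ennreal (norm (indicator K x * G' x $ i)) \<partial>lborel) < \<infinity>" .
    qed measurable
  next
    fix \<epsilon> :: real and a :: "real^'n" and i :: 'n assume eps: "0 < \<epsilon>"
    have "(\<integral>y. f y * kern_deriv \<epsilon> i (y - a) \<partial>lebesgue) = - (\<integral>y. G y $ i * kern \<epsilon> (y - a) \<partial>lebesgue)"
    proof -
      have "weak_gradient f G" using W by (simp add: in_Wdot1n_def)
      then have "(\<integral>y. f y * partial_deriv i (\<lambda>y. kern \<epsilon> (y - a)) y \<partial>lebesgue)
          = - (\<integral>y. G y $ i * kern \<epsilon> (y - a) \<partial>lebesgue)"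
        unfolding weak_gradient_def using kern_test_fun[OF eps, of a] by blast
      then show ?thesis
        by (simp only: kern_partial_deriv[OF eps])
    qed
    moreover have "(\<integral>y. f y * kern_deriv \<epsilon> i (y - a) \<partial>lebesgue) = (\<integral>y. f' y * kern_deriv \<epsilon> i (y - a) \<partial>lborel)"
    proof -
      have [measurable]: "(\<lambda>y. kern_deriv \<epsilon> i (y - a)) \<in> borel_measurable lebesgue" "f' \<in> borel_measurable lebesgue"
        by (intro measurable_completion; measurable)+
      have "(\<integral>y. f y * kern_deriv \<epsilon> i (y - a) \<partial>lebesgue) = (\<integral>y. f' y * kern_deriv \<epsilon> i (y - a) \<partial>lebesgue)"
      proof (rule integral_cong_AE)
        show "AE y in lebesgue. f y * kern_deriv \<epsilon> i (y - a) = f' y * kern_deriv \<epsilon> i (y - a)"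
          unfolding AE_completion_iff using ff' by (auto elim: eventually_mono)
      qed measurable
      also have "\<dots> = (\<integral>y. f' y * kern_deriv \<epsilon> i (y - a) \<partial>lborel)"
        by (rule integral_completion) measurable
      finally show ?thesis .
    qed
    moreover have "(\<integral>y. G y $ i * kern \<epsilon> (y - a) \<partial>lebesgue) = (\<integral>y. G' y $ i * kern \<epsilon> (y - a) \<partial>lborel)"
    proof -
      have [measurable]: "(\<lambda>y. kern \<epsilon> (y - a)) \<in> borel_measurable lebesgue" "G' \<in> borel_measurable lebesgue"
        by (intro measurable_completion; measurable)+
      have "(\<integral>y. G y $ i * kern \<epsilon> (y - a) \<partial>lebesgue) = (\<integral>y. G' y $ i * kern \<epsilon> (y - a) \<partial>lebesgue)"
      proof (rule integral_cong_AE)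
        show "AE y in lebesgue. G y $ i * kern \<epsilon> (y - a) = G' y $ i * kern \<epsilon> (y - a)"
          unfolding AE_completion_iff using GG' by (auto elim: eventually_mono)
      qed measurable
      also have "\<dots> = (\<integral>y. G' y $ i * kern \<epsilon> (y - a) \<partial>lborel)"
        by (rule integral_completion) measurable
      finally show ?thesis .
    qed
    ultimately show "(\<integral>y. f' y * kern_deriv \<epsilon> i (y - a) \<partial>lborel) = - (\<integral>y. G' y $ i * kern \<epsilon> (y - a) \<partial>lborel)"
      by simp
  qed measurable
  then show ?thesis
    using that ff' GG' energy by blast
qed

section \<open>From increments to the modulus of continuity and the Besov norm\<close>

lemma omega_n_eq: "omega_n TYPE('n::finite) = unit_ball_vol (real CARD('n))"
  using content_ball[of 1 "0 :: real^'n"] by (simp add: omega_n_def measure_completion)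

text \<open>The bound on differences is the same for all \<open>h\<close> in the ball, so the mean
  over \<open>h\<close> inherits it. The factor \<open>2 powr (q / p)\<close> produced by the outer
  powers is at most 2 because \<open>q \<le> p\<close>, which leaves a constant free of
  \<open>p\<close>.\<close>

lemma modulus_power_le:
  fixes f :: "real^'n::finite \<Rightarrow> real"
  defines "k \<equiv> 2 * 2 ^ CARD('n) / unit_ball_vol (real CARD('n))"
  assumes wd: "weakly_differentiable f' G'" and ff': "AE x in lborel. f x = f' x"
    and p: "1 < p" and t: "0 < t" and q: "0 \<le> q" "q \<le> p"
  shows "enn_powr (modulus f t p) q \<le> ennreal (2 * k powr q)
     * enn_powr (\<integral>\<^sup>+x. enn_powr (segment_ball_integral t (\<lambda>x. ennreal (norm (G' x))) x) p \<partial>lborel) (q / p)"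
proof -
  interpret weakly_differentiable f' G' by fact
  have k: "0 < k" by (simp add: k_def)
  define D where "D = (\<integral>\<^sup>+x. enn_powr (segment_ball_integral t (\<lambda>x. ennreal (norm (G' x))) x) p \<partial>lborel)"
  define V where "V = ennreal (t ^ CARD('n) * omega_n TYPE('n))"
  have V: "V \<noteq> 0" "V \<noteq> top" using t by (auto simp: V_def omega_n_eq ennreal_eq_0_iff not_le)
  have inner: "(\<integral>\<^sup>+x. ennreal (\<bar>f (x + h) - f x\<bar> powr p) \<partial>lebesgue) \<le> ennreal (2 * k powr p) * D" if "h \<in> ball 0 t" for h
  proof -
    have "(\<integral>\<^sup>+x. ennreal (\<bar>f (x + h) - f x\<bar> powr p) \<partial>lebesgue) = (\<integral>\<^sup>+x. ennreal (\<bar>f' (x + h) - f' x\<bar> powr p) \<partial>lborel)"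
      unfolding nn_integral_completion
    proof (rule nn_integral_cong_AE)
      show "AE x in lborel. ennreal (\<bar>f (x + h) - f x\<bar> powr p) = ennreal (\<bar>f' (x + h) - f' x\<bar> powr p)"
        using ff' AE_lborel_translate[OF ff', of h] by eventually_elim simp
    qed
    also have "\<dots> \<le> ennreal (2 * k powr p) * D"
      unfolding k_def D_def using that p by (intro translate_difference_Lp_le) auto
    finally show ?thesis .
  qed
  have "(\<integral>\<^sup>+h\<in>ball 0 t. (\<integral>\<^sup>+x. ennreal (\<bar>f (x + h) - f x\<bar> powr p) \<partial>lebesgue) \<partial>lebesgue)
     \<le> (\<integral>\<^sup>+h. ennreal (2 * k powr p) * D * indicator (ball (0 :: real^'n) t) h \<partial>lebesgue)"
    using inner by (intro nn_integral_mono) (auto split: split_indicator)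
  also have "\<dots> = ennreal (2 * k powr p) * D * emeasure lborel (ball (0 :: real^'n) t)"
    unfolding nn_integral_completion by (rule nn_integral_cmult_indicator) simp
  also have "emeasure lborel (ball (0 :: real^'n) t) = V"
    using t by (simp add: emeasure_ball V_def omega_n_eq mult.commute)
  finally have "(\<integral>\<^sup>+h\<in>ball 0 t. (\<integral>\<^sup>+x. ennreal (\<bar>f (x + h) - f x\<bar> powr p) \<partial>lebesgue) \<partial>lebesgue) / V
      \<le> ennreal (2 * k powr p) * D * V / V"
    by (rule divide_right_mono_ennreal)
  also have "\<dots> = ennreal (2 * k powr p) * D"
    using V by (rule mult_divide_eq_ennreal)
  finally have "modulus f t p \<le> enn_powr (ennreal (2 * k powr p) * D) (1 / p)"
    unfolding modulus_def V_def using p by (intro enn_powr_mono) auto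
  then have "enn_powr (modulus f t p) q \<le> enn_powr (enn_powr (ennreal (2 * k powr p) * D) (1 / p)) q"
    using q by (intro enn_powr_mono)
  also have "\<dots> = ennreal (2 powr (q / p) * k powr q) * enn_powr D (q / p)"
    using k p by (simp add: enn_powr_powr enn_powr_mult enn_powr_ennreal powr_mult powr_powr)
  also have "\<dots> \<le> ennreal (2 * k powr q) * enn_powr D (q / p)"
  proof (intro mult_right_mono ennreal_leI)
    show "2 powr (q / p) \<le> (2 :: real)"
      using powr_mono[of "q / p" 1 2] p q by simp
  qed auto
  finally show ?thesis
    by (simp add: D_def)
qed

theorem mainTheorem17:
  fixes p0 :: real
  assumes "CARD('n::finite) \<ge> 2" and "real CARD('n) < p0"
  shows "\<exists>c::real. \<forall>(p::real) (f::real^'n \<Rightarrow> real) G.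
           real CARD('n) < p \<and> p < p0 \<and> in_Wdot1n f G \<longrightarrow>
           besov_norm (real CARD('n) / p) p (real CARD('n)) f
             \<le> ennreal (c * (1 - real CARD('n) / p) powr (- 1 / real CARD('n)))
                * Lq_norm_vec (real CARD('n)) G"
proof -
  define N where "N = real CARD('n)"
  have N: "2 \<le> N" using assms(1) by (simp add: N_def)
  have dim: "2 \<le> DIM(real^'n)" "real DIM(real^'n) < p0" "real DIM(real^'n) = N"
    using assms by (auto simp: N_def)
  obtain C where C: "0 \<le> C" and bound: "\<And>p (g :: real^'n \<Rightarrow> real). N < p \<Longrightarrow> p < p0 \<Longrightarrow> g \<in> borel_measurable borel \<Longrightarrow>
     (\<And>x. 0 \<le> g x) \<Longrightarrow> (\<integral>\<^sup>+x. ennreal (g x powr N) \<partial>lborel) < top \<Longrightarrow>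
     (\<integral>\<^sup>+t. indicator {0<..} t * (ennreal (t powr (- (N / p) * N) / t)
        * enn_powr (\<integral>\<^sup>+x. enn_powr (segment_ball_integral t (\<lambda>x. ennreal (g x)) x) p \<partial>lborel) (N / p)) \<partial>lborel)
     \<le> ennreal (C / (1 - N / p)) * (\<integral>\<^sup>+x. ennreal (g x powr N) \<partial>lborel)"
    using segment_ball_integral_Besov_bound[OF dim(1,2)] unfolding dim(3) by blast
  define c1 where "c1 = 2 * (2 * 2 ^ CARD('n) / unit_ball_vol (real CARD('n))) powr N"
  have c1: "0 \<le> c1" by (simp add: c1_def)
  \<comment> \<open>The constant is the \<open>N\<close>-th root of \<open>c1 * C\<close>, where
    \<open>c1\<close> comes from \<open>modulus_power_le\<close> with \<open>q = N\<close>; the same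
    root turns \<open>1 / (1 - N / p)\<close> into the power \<open>- 1 / N\<close>.\<close>
  have "besov_norm (N / p) p N f \<le> ennreal ((c1 * C) powr (1 / N) * (1 - N / p) powr (- 1 / N)) * Lq_norm_vec N G"
    if p: "N < p" "p < p0" and W: "in_Wdot1n f G" for p and f :: "real^'n \<Rightarrow> real" and G
  proof -
    obtain f' G' where wd: "weakly_differentiable f' G'" and ff': "AE x in lborel. f x = f' x"
      and GG': "AE x in lborel. G x = G' x" and fin: "(\<integral>\<^sup>+x. ennreal (norm (G' x) powr N) \<partial>lborel) < top"
      using in_Wdot1n_Borel_representative[OF W] unfolding N_def by blast
    interpret weakly_differentiable f' G' by fact
    define I where "I = (\<integral>\<^sup>+x. ennreal (norm (G' x) powr N) \<partial>lborel)"
    define D where "D t = (\<integral>\<^sup>+x. enn_powr (segment_ball_integral t (\<lambda>x. ennreal (norm (G' x))) x) p \<partial>lborel)" for t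
    have [measurable]: "D \<in> borel_measurable borel" unfolding D_def by measurable
    define \<beta> where "\<beta> = 1 - N / p"
    have \<beta>: "0 < \<beta>" using p N by (simp add: \<beta>_def)
    have "(\<integral>\<^sup>+t\<in>{0<..}. ennreal (t powr (- (N / p) * N) / t) * enn_powr (modulus f t p) N \<partial>lborel)
       \<le> (\<integral>\<^sup>+t. ennreal c1 * (indicator {0<..} t * (ennreal (t powr (- (N / p) * N) / t) * enn_powr (D t) (N / p))) \<partial>lborel)"
    proof (rule nn_integral_mono)
      fix t :: real
      have "ennreal (t powr (- (N / p) * N) / t) * enn_powr (modulus f t p) N
         \<le> ennreal (t powr (- (N / p) * N) / t) * (ennreal c1 * enn_powr (D t) (N / p))" if t: "0 < t"
        unfolding c1_def D_def using p N t
        by (intro mult_left_mono modulus_power_le[OF wd ff']) auto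
      then show "ennreal (t powr (- (N / p) * N) / t) * enn_powr (modulus f t p) N * indicator {0<..} t
        \<le> ennreal c1 * (indicator {0<..} t * (ennreal (t powr (- (N / p) * N) / t) * enn_powr (D t) (N / p)))"
        by (auto simp: mult.left_commute split: split_indicator)
    qed
    also have "\<dots> = ennreal c1 * (\<integral>\<^sup>+t. indicator {0<..} t * (ennreal (t powr (- (N / p) * N) / t) * enn_powr (D t) (N / p)) \<partial>lborel)"
      by (rule nn_integral_cmult) measurable
    also have "\<dots> \<le> ennreal c1 * (ennreal (C / \<beta>) * I)"
      unfolding D_def I_def \<beta>_def using p fin by (intro mult_left_mono bound) auto
    also have "\<dots> = ennreal (c1 * C * (1 / \<beta>)) * I"
      using c1 C \<beta> by (simp add: mult.assoc[symmetric] ennreal_mult[symmetric])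
    finally have "besov_norm (N / p) p N f \<le> enn_powr (ennreal (c1 * C * (1 / \<beta>)) * I) (1 / N)"
      unfolding besov_norm_def using N by (intro enn_powr_mono) auto
    also have "\<dots> = ennreal ((c1 * C * (1 / \<beta>)) powr (1 / N)) * enn_powr I (1 / N)"
      using c1 C \<beta> by (simp add: enn_powr_mult enn_powr_ennreal)
    also have "(c1 * C * (1 / \<beta>)) powr (1 / N) = (c1 * C) powr (1 / N) * \<beta> powr (- 1 / N)"
      using \<beta> by (simp add: powr_mult powr_divide powr_minus_divide)
    also have "I = (\<integral>\<^sup>+x. ennreal (norm (G x) powr N) \<partial>lebesgue)"
      unfolding I_def nn_integral_completion using GG' by (intro nn_integral_cong_AE) (auto elim: eventually_mono)
    finally show ?thesis
      unfolding \<beta>_def Lq_norm_vec_def .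
  qed
  then show ?thesis
    unfolding N_def by blast
qed

end
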